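(* Let $(\mathcal B,\mathcal L,\theta,\mathcal I)$ be a generalized Boolean dynamical system and $R$ a unital commutative ring. Then there exist a subring $S\subseteq L_R(\mathcal B,\mathcal L,\theta,\mathcal I)$ and an $S$-system $(J,I,\psi)$ such that $L_R(\mathcal B,\mathcal L,\theta,\mathcal I)$ is graded isomorphic to the Cuntz--Pimsner algebra $\mathcal O_{(J,I,\psi)}$.
   Context: A generalized Boolean algebra $\mathcal B$ is a distributive lattice with relative complements and a least element $\emptyset$; write $\cup,\cap,\setminus,\subseteq$ for join, meet, relative complement and order. Morphisms preserve $\emptyset$ and all operations. An ideal is a nonempty subset closed under $\cup$ and under $\cap$ with arbitrary elements of $\mathcal B$. A generalized Boolean dynamical system $(\mathcal B,\mathcal L,\theta,\mathcal I)$ consists of a generalized Boolean algebra $\mathcal B$, a set $\mathcal L$, morphisms $\theta_\alpha:\mathcal B\to\mathcal B$ ($\alpha\in\mathcal L$), and ideals $\mathcal I_\alpha$ ($\alpha\in\mathcal L$) with $\{A\in\mathcal B:A\subseteq\theta_\alpha(B)\text{ for some }B\in\mathcal B\}\subseteq\mathcal I_\alpha$. Put $\Delta_A=\{\alpha\in\mathcal L:\theta_\alpha(A)\ne\emptyset\}$ and $\mathcal B_{\mathrm{reg}}=\{A\in\mathcal B:0<|\Delta_B|<\infty\text{ for all }\emptyset\ne B\subseteq A\}$. $L_R(\mathcal B,\mathcal L,\theta,\mathcal I)$ is the universal associative (not necessarily unital) $R$-algebra generated by $\{p_A\}_{A\in\mathcal B}\cup\{s_{\alpha,B},s_{\alpha,B}^*\}_{\alpha\in\mathcal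 L,B\in\mathcal I_\alpha}$ subject to: (1) $p_\emptyset=0$, $p_{A\cap A'}=p_Ap_{A'}$, $p_{A\cup A'}=p_A+p_{A'}-p_{A\cap A'}$; (2) $p_As_{\alpha,B}=s_{\alpha,B}p_{\theta_\alpha(A)}$ and $s_{\alpha,B}^*p_A=p_{\theta_\alpha(A)}s_{\alpha,B}^*$; (3) $s_{\alpha,B}^*s_{\alpha',B'}=\delta_{\alpha,\alpha'}p_{B\cap B'}$; (4) $s_{\alpha,B}p_{B'}=s_{\alpha,B\cap B'}$ and $p_{B'}s_{\alpha,B}^*=s_{\alpha,B\cap B'}^*$; (5) $p_A=\sum_{\alpha\in\Delta_A}s_{\alpha,\theta_\alpha(A)}s_{\alpha,\theta_\alpha(A)}^*$ for all $A\in\mathcal B_{\mathrm{reg}}$. It is $\mathbb Z$-graded with $\deg p_A=0$, $\deg s_{\alpha,A}=1$, $\deg s_{\alpha,A}^*=-1$. Cuntz--Pimsner rings (Carlsen--Ortega). Let $S$ be a ring (not necessarily unital). An $S$-system $(P,Q,\psi)$ consists of $S$-bimodules $P,Q$ and an $S$-bimodule homomorphism $\psi:P\otimes_SQ\to S$. A covariant representation of it on a ring $B$ is a triple $(\sigma,T_P,T_Q)$ of a ring homomorphism $\sigma:S\to B$ and additive maps $T_P:P\to B$, $T_Q:Q\to B$ with $T_P(rp)=\sigma(r)T_P(p)$, $T_P(pr)=T_P(p)\sigma(r)$, $T_Q(rq)=\sigma(r)T_Q(q)$, $T_Q(qr)=T_Q(q)\sigma(r)$ and $\sigma(\psi(p\otimes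 q))=T_P(p)T_Q(q)$ for $r\in S,p\in P,q\in Q$. For $p\in P,q\in Q$ let $\theta_{q,p}\in\mathrm{End}(Q)$, $\theta_{q,p}(x)=q\,\psi(p\otimes x)$, and $\theta_{p,q}\in\mathrm{End}(P)$, $\theta_{p,q}(y)=\psi(y\otimes q)\,p$; let $\mathcal F_P(Q)$ and $\mathcal F_Q(P)$ be the additive spans of the $\theta_{q,p}$ and of the $\theta_{p,q}$ respectively. The system satisfies condition (FS) if for all finite subsets $F\subseteq Q$, $G\subseteq P$ there are $\Theta\in\mathcal F_P(Q)$ and $\Phi\in\mathcal F_Q(P)$ with $\Theta(q)=q$ for all $q\in F$ and $\Phi(p)=p$ for all $p\in G$. Under (FS), each covariant representation on $B$ induces a ring homomorphism $\pi:\mathcal F_P(Q)\to B$ with $\pi(\theta_{q,p})=T_Q(q)T_P(p)$. Let $\Delta:S\to\mathrm{End}(Q)$, $\Delta(r)(q)=rq$. A two-sided ideal $K$ of $S$ is $\psi$-compatible if $\Delta(K)\subseteq\mathcal F_P(Q)$, and faithful if $K\cap\ker\Delta=\{0\}$. If there is a faithful $\psi$-compatible ideal $K$ containing every faithful $\psi$-compatible ideal, the Cuntz--Pimsner algebra (ring) $\mathcal O_{(P,Q,\psi)}$ is the ring universal for covariant representations satisfying $\pi(\Delta(x))=\sigma(x)$ for all $x\in K$. (The assertion that $\mathcal O_{(J,I,\psi)}$ is the Cuntz--Pimsner algebra of the system includes that (FS) holds and that such a $K$ exists.) It is $\mathbb Z$-graded with $\sigma(S)$ in degree $0$, $T_Q(Q)$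 in degree $1$, and $T_P(P)$ in degree $-1$. In $(J,I,\psi)$ one has $P=J$ and $Q=I$. *)

theory Defs
  imports "HOL-Algebra.Module" "HOL-Algebra.QuotRing" "HOL-Algebra.Free_Abelian_Groups"
begin

section \<open>Rings without unit\<close>

text \<open>
  Rings are records of type \<^typ>\<open>'a ring\<close>, as in HOL-Algebra, but no axiom mentions the
  field \<^const>\<open>one\<close>, whose value is irrelevant everywhere below.
\<close>

locale rng = abelian_group R for R (structure) +
  assumes m_closed [simp, intro]:
      "\<lbrakk>x \<in> carrier R; y \<in> carrier R\<rbrakk> \<Longrightarrow> x \<otimes> y \<in> carrier R"
    and m_assoc: "\<lbrakk>x \<in> carrier R; y \<in> carrier R; z \<in> carrier R\<rbrakk> \<Longrightarrow>
      (x \<otimes> y) \<otimes> z = x \<otimes> (y \<otimes> z)"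
    and l_distr: "\<lbrakk>x \<in> carrier R; y \<in> carrier R; z \<in> carrier R\<rbrakk> \<Longrightarrow>
      (x \<oplus> y) \<otimes> z = x \<otimes> z \<oplus> y \<otimes> z"
    and r_distr: "\<lbrakk>x \<in> carrier R; y \<in> carrier R; z \<in> carrier R\<rbrakk> \<Longrightarrow>
      z \<otimes> (x \<oplus> y) = z \<otimes> x \<oplus> z \<otimes> y"

definition rng_hom :: "('a, 'm) ring_scheme \<Rightarrow> ('b, 'n) ring_scheme \<Rightarrow> ('a \<Rightarrow> 'b) set" where
  "rng_hom R B = {h \<in> carrier R \<rightarrow> carrier B. \<forall>x\<in>carrier R. \<forall>y\<in>carrier R.
     h (x \<oplus>\<^bsub>R\<^esub> y) = h x \<oplus>\<^bsub>B\<^esub> h y \<and> h (x \<otimes>\<^bsub>R\<^esub> y) = h x \<otimes>\<^bsub>B\<^esub> h y}"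

definition subrng :: "'a set \<Rightarrow> ('a, 'm) ring_scheme \<Rightarrow> bool" where
  "subrng S R \<longleftrightarrow> additive_subgroup S R \<and> (\<forall>x\<in>S. \<forall>y\<in>S. x \<otimes>\<^bsub>R\<^esub> y \<in> S)"

definition rng_ideal :: "'a set \<Rightarrow> ('a, 'm) ring_scheme \<Rightarrow> bool" where
  "rng_ideal K R \<longleftrightarrow> additive_subgroup K R \<and>
     (\<forall>x\<in>K. \<forall>r\<in>carrier R. r \<otimes>\<^bsub>R\<^esub> x \<in> K \<and> x \<otimes>\<^bsub>R\<^esub> r \<in> K)"

text \<open>Isomorphism of \<open>\<int>\<close>-graded rings; \<open>A n\<close> and \<open>C n\<close> are the components of degree \<open>n\<close>.\<close>

definition graded_isomorphic ::
    "('a, 'm) ring_scheme \<Rightarrow> (int \<Rightarrow> 'a set) \<Rightarrow> ('b, 'n) ring_scheme \<Rightarrow> (int \<Rightarrow> 'b set) \<Rightarrow> bool" where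
  "graded_isomorphic R A B C \<longleftrightarrow>
     (\<exists>h \<in> rng_hom R B. bij_betw h (carrier R) (carrier B) \<and> (\<forall>n. h ` A n = C n))"


section \<open>Algebras given by generators and relations\<close>

text \<open>
  The coefficient ring is a type of sort \<open>{comm_ring, comm_monoid_mult}\<close> rather than
  \<open>comm_ring_1\<close>, because the latter excludes the zero ring.
\<close>

locale nonunital_algebra = rng A
  for A :: "('r::{comm_ring, comm_monoid_mult}, 'a, 'm) module_scheme" (structure) +
  assumes smult_closed [simp, intro]: "x \<in> carrier A \<Longrightarrow> r \<odot> x \<in> carrier A"
    and smult_l_distr: "x \<in> carrier A \<Longrightarrow> (r + s) \<odot> x = r \<odot> x \<oplus> s \<odot> x"
    and smult_r_distr:
      "\<lbrakk>x \<in> carrier A; y \<in> carrier A\<rbrakk> \<Longrightarrow> r \<odot> (x \<oplus> y) = r \<odot> x \<oplus> r \<odot> y"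
    and smult_assoc: "x \<in> carrier A \<Longrightarrow> (r * s) \<odot> x = r \<odot> (s \<odot> x)"
    and smult_one [simp]: "x \<in> carrier A \<Longrightarrow> 1 \<odot> x = x"
    and smult_mult_l:
      "\<lbrakk>x \<in> carrier A; y \<in> carrier A\<rbrakk> \<Longrightarrow> (r \<odot> x) \<otimes> y = r \<odot> (x \<otimes> y)"
    and smult_mult_r:
      "\<lbrakk>x \<in> carrier A; y \<in> carrier A\<rbrakk> \<Longrightarrow> x \<otimes> (r \<odot> y) = r \<odot> (x \<otimes> y)"

datatype 'g word = Word (letters: "'g list")

instantiation word :: (type) monoid_add
begin
definition "0 = Word []"
definition "v + w = Word (letters v @ letters w)"
instance
  by standard (auto simp: zero_word_def plus_word_def)
end

text \<open>
  The product of \<^typ>\<open>'g word \<Rightarrow>\<^sub>0 'r\<close> is convolution over concatenation of words. Excluding the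
  empty word from the supports gives the free non-unital algebra on the set \<open>X\<close>.
\<close>

definition free_alg :: "'g set \<Rightarrow> ('r::{comm_ring, comm_monoid_mult}, 'g word \<Rightarrow>\<^sub>0 'r) module" where
  "free_alg X =
     \<lparr>carrier = {f. \<forall>w\<in>Poly_Mapping.keys f. letters w \<noteq> [] \<and> set (letters w) \<subseteq> X},
      mult = (*), one = undefined, ring.zero = 0, add = (+),
      smult = (\<lambda>r. Poly_Mapping.map ((*) r))\<rparr>"

definition gen :: "'g \<Rightarrow> ('g word \<Rightarrow>\<^sub>0 'r::{comm_ring, comm_monoid_mult})" where
  "gen x = Poly_Mapping.single (Word [x]) 1"

inductive_set alg_ideal :: "('r, 'a, 'm) module_scheme \<Rightarrow> 'a set \<Rightarrow> 'a set"
  for A (structure) and Rel where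
  zero: "\<zero> \<in> alg_ideal A Rel"
| incl: "x \<in> Rel \<Longrightarrow> x \<in> alg_ideal A Rel"
| add: "\<lbrakk>x \<in> alg_ideal A Rel; y \<in> alg_ideal A Rel\<rbrakk> \<Longrightarrow> x \<oplus> y \<in> alg_ideal A Rel"
| smult: "x \<in> alg_ideal A Rel \<Longrightarrow> r \<odot> x \<in> alg_ideal A Rel"
| lmult: "\<lbrakk>a \<in> carrier A; x \<in> alg_ideal A Rel\<rbrakk> \<Longrightarrow> a \<otimes> x \<in> alg_ideal A Rel"
| rmult: "\<lbrakk>x \<in> alg_ideal A Rel; a \<in> carrier A\<rbrakk> \<Longrightarrow> x \<otimes> a \<in> alg_ideal A Rel"

definition quot_alg :: "('r, 'a, 'm) module_scheme \<Rightarrow> 'a set \<Rightarrow> ('r, 'a set) module" where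
  "quot_alg A N =
     \<lparr>carrier = carrier (A Quot N), mult = mult (A Quot N), one = one (A Quot N),
      ring.zero = ring.zero (A Quot N), add = add (A Quot N),
      smult = (\<lambda>r Y. \<Union>y\<in>Y. N +>\<^bsub>A\<^esub> (r \<odot>\<^bsub>A\<^esub> y))\<rparr>"

definition presented_alg ::
    "'g set \<Rightarrow> ('g word \<Rightarrow>\<^sub>0 'r) set \<Rightarrow> ('r::{comm_ring, comm_monoid_mult}, ('g word \<Rightarrow>\<^sub>0 'r) set) module" where
  "presented_alg X Rel = quot_alg (free_alg X) (alg_ideal (free_alg X) Rel)"

definition presented_class ::
    "'g set \<Rightarrow> ('g word \<Rightarrow>\<^sub>0 'r) set \<Rightarrow> ('g word \<Rightarrow>\<^sub>0 'r::{comm_ring, comm_monoid_mult}) \<Rightarrow> ('g word \<Rightarrow>\<^sub>0 'r) set" where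
  "presented_class X Rel f = alg_ideal (free_alg X) Rel +>\<^bsub>(free_alg X :: ('r, _) module)\<^esub> f"

text \<open>
  The degree-\<open>n\<close> component for the grading in which the generator \<open>x\<close> has degree \<open>d x\<close>. The
  components grade the algebra whenever the relations are homogeneous.
\<close>

definition presented_component ::
    "'g set \<Rightarrow> ('g word \<Rightarrow>\<^sub>0 'r) set \<Rightarrow> ('g \<Rightarrow> int) \<Rightarrow> int \<Rightarrow> ('g word \<Rightarrow>\<^sub>0 'r::{comm_ring, comm_monoid_mult}) set set" where
  "presented_component X Rel d n =
     {presented_class X Rel f | f. f \<in> carrier (free_alg X :: ('r, _) module) \<and>
        (\<forall>w\<in>Poly_Mapping.keys f. sum_list (map d (letters w)) = n)}"


section \<open>Generalized Boolean dynamical systems\<close>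

class generalized_boolean_algebra = distrib_lattice + order_bot + minus +
  assumes inf_minus: "inf (x - y) y = bot"
    and sup_minus_inf: "sup (x - y) (inf x y) = x"

definition gba_morphism ::
    "('a::generalized_boolean_algebra \<Rightarrow> 'b::generalized_boolean_algebra) \<Rightarrow> bool" where
  "gba_morphism f \<longleftrightarrow> f bot = bot \<and> (\<forall>x y. f (sup x y) = sup (f x) (f y) \<and>
     f (inf x y) = inf (f x) (f y) \<and> f (x - y) = f x - f y)"

definition gba_ideal :: "'b::generalized_boolean_algebra set \<Rightarrow> bool" where
  "gba_ideal U \<longleftrightarrow> U \<noteq> {} \<and> (\<forall>x\<in>U. \<forall>y\<in>U. sup x y \<in> U) \<and> (\<forall>x\<in>U. \<forall>y. inf x y \<in> U)"

text \<open>The labels form a set \<open>L\<close>, not a whole type, so that \<open>L\<close> may be empty.\<close>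

locale generalized_boolean_dynamical_system =
  fixes L :: "'l set"
    and \<theta> :: "'l \<Rightarrow> 'b::generalized_boolean_algebra \<Rightarrow> 'b"
    and \<I> :: "'l \<Rightarrow> 'b set"
  assumes morphism: "\<alpha> \<in> L \<Longrightarrow> gba_morphism (\<theta> \<alpha>)"
    and ideal: "\<alpha> \<in> L \<Longrightarrow> gba_ideal (\<I> \<alpha>)"
    and range: "\<alpha> \<in> L \<Longrightarrow> {A. \<exists>B. A \<le> \<theta> \<alpha> B} \<subseteq> \<I> \<alpha>"

definition gbds_Delta ::
    "'l set \<Rightarrow> ('l \<Rightarrow> 'b \<Rightarrow> 'b::generalized_boolean_algebra) \<Rightarrow> 'b \<Rightarrow> 'l set" where
  "gbds_Delta L \<theta> A = {\<alpha>\<in>L. \<theta> \<alpha> A \<noteq> bot}"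

definition gbds_reg ::
    "'l set \<Rightarrow> ('l \<Rightarrow> 'b \<Rightarrow> 'b::generalized_boolean_algebra) \<Rightarrow> 'b set" where
  "gbds_reg L \<theta> = {A. \<forall>B. B \<noteq> bot \<and> B \<le> A \<longrightarrow>
     finite (gbds_Delta L \<theta> B) \<and> 0 < card (gbds_Delta L \<theta> B)}"


section \<open>The algebra of a generalized Boolean dynamical system\<close>

datatype ('b, 'l) gbds_gen = Proj 'b | Edge 'l 'b | Edge_star 'l 'b

abbreviation gen_p ("p\<^bsub>_\<^esub>") where "p\<^bsub>A\<^esub> \<equiv> gen (Proj A)"
abbreviation gen_s ("s\<^bsub>_,_\<^esub>") where "s\<^bsub>\<alpha>,B\<^esub> \<equiv> gen (Edge \<alpha> B)"
abbreviation gen_s_star ("s\<^sup>*\<^bsub>_,_\<^esub>") where "s\<^sup>*\<^bsub>\<alpha>,B\<^esub> \<equiv> gen (Edge_star \<alpha> B)"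

definition gbds_gens :: "'l set \<Rightarrow> ('l \<Rightarrow> 'b set) \<Rightarrow> ('b, 'l) gbds_gen set" where
  "gbds_gens L \<I> =
     range Proj \<union> {Edge \<alpha> B | \<alpha> B. \<alpha> \<in> L \<and> B \<in> \<I> \<alpha>} \<union> {Edge_star \<alpha> B | \<alpha> B. \<alpha> \<in> L \<and> B \<in> \<I> \<alpha>}"

text \<open>An element \<open>x - y\<close> encodes the relation \<open>x = y\<close>.\<close>

inductive_set gbds_rel ::
    "'l set \<Rightarrow> ('l \<Rightarrow> 'b::generalized_boolean_algebra \<Rightarrow> 'b) \<Rightarrow> ('l \<Rightarrow> 'b set) \<Rightarrow>
     (('b, 'l) gbds_gen word \<Rightarrow>\<^sub>0 'r::{comm_ring, comm_monoid_mult}) set"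
  for L \<theta> \<I> where
  p_bot: "p\<^bsub>bot\<^esub> \<in> gbds_rel L \<theta> \<I>"
| p_inf: "p\<^bsub>inf A A'\<^esub> - p\<^bsub>A\<^esub> * p\<^bsub>A'\<^esub> \<in> gbds_rel L \<theta> \<I>"
| p_sup: "p\<^bsub>sup A A'\<^esub> - (p\<^bsub>A\<^esub> + p\<^bsub>A'\<^esub> - p\<^bsub>inf A A'\<^esub>) \<in> gbds_rel L \<theta> \<I>"
| p_s: "\<lbrakk>\<alpha> \<in> L; B \<in> \<I> \<alpha>\<rbrakk> \<Longrightarrow>
    p\<^bsub>A\<^esub> * s\<^bsub>\<alpha>,B\<^esub> - s\<^bsub>\<alpha>,B\<^esub> * p\<^bsub>\<theta> \<alpha> A\<^esub> \<in> gbds_rel L \<theta> \<I>"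
| s_star_p: "\<lbrakk>\<alpha> \<in> L; B \<in> \<I> \<alpha>\<rbrakk> \<Longrightarrow>
    s\<^sup>*\<^bsub>\<alpha>,B\<^esub> * p\<^bsub>A\<^esub> - p\<^bsub>\<theta> \<alpha> A\<^esub> * s\<^sup>*\<^bsub>\<alpha>,B\<^esub> \<in> gbds_rel L \<theta> \<I>"
| s_star_s: "\<lbrakk>\<alpha> \<in> L; B \<in> \<I> \<alpha>; \<alpha>' \<in> L; B' \<in> \<I> \<alpha>'\<rbrakk> \<Longrightarrow>
    s\<^sup>*\<^bsub>\<alpha>,B\<^esub> * s\<^bsub>\<alpha>',B'\<^esub> - (if \<alpha> = \<alpha>' then p\<^bsub>inf B B'\<^esub> else 0) \<in> gbds_rel L \<theta> \<I>"
| s_p: "\<lbrakk>\<alpha> \<in> L; B \<in> \<I> \<alpha>\<rbrakk> \<Longrightarrow>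
    s\<^bsub>\<alpha>,B\<^esub> * p\<^bsub>B'\<^esub> - s\<^bsub>\<alpha>,inf B B'\<^esub> \<in> gbds_rel L \<theta> \<I>"
| p_s_star: "\<lbrakk>\<alpha> \<in> L; B \<in> \<I> \<alpha>\<rbrakk> \<Longrightarrow>
    p\<^bsub>B'\<^esub> * s\<^sup>*\<^bsub>\<alpha>,B\<^esub> - s\<^sup>*\<^bsub>\<alpha>,inf B B'\<^esub> \<in> gbds_rel L \<theta> \<I>"
| regular: "A \<in> gbds_reg L \<theta> \<Longrightarrow>
    p\<^bsub>A\<^esub> - (\<Sum>\<alpha>\<in>gbds_Delta L \<theta> A. s\<^bsub>\<alpha>,\<theta> \<alpha> A\<^esub> * s\<^sup>*\<^bsub>\<alpha>,\<theta> \<alpha> A\<^esub>) \<in> gbds_rel L \<theta> \<I>"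

type_synonym ('r, 'b, 'l) gbds_elem = "(('b, 'l) gbds_gen word \<Rightarrow>\<^sub>0 'r) set"

text \<open>
  The first argument carries no data besides its type, the coefficient ring.
\<close>

definition gbds_alg ::
    "'r::{comm_ring, comm_monoid_mult} itself \<Rightarrow> 'l set \<Rightarrow>
     ('l \<Rightarrow> 'b::generalized_boolean_algebra \<Rightarrow> 'b) \<Rightarrow> ('l \<Rightarrow> 'b set) \<Rightarrow>
     ('r, ('r, 'b, 'l) gbds_elem) module" where
  "gbds_alg R L \<theta> \<I> = presented_alg (gbds_gens L \<I>) (gbds_rel L \<theta> \<I>)"

fun gbds_deg :: "('b, 'l) gbds_gen \<Rightarrow> int" where
  "gbds_deg (Proj A) = 0"
| "gbds_deg (Edge \<alpha> B) = 1"
| "gbds_deg (Edge_star \<alpha> B) = -1"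

definition gbds_component ::
    "'r::{comm_ring, comm_monoid_mult} itself \<Rightarrow> 'l set \<Rightarrow>
     ('l \<Rightarrow> 'b::generalized_boolean_algebra \<Rightarrow> 'b) \<Rightarrow> ('l \<Rightarrow> 'b set) \<Rightarrow>
     int \<Rightarrow> ('r, 'b, 'l) gbds_elem set" where
  "gbds_component R L \<theta> \<I> = presented_component (gbds_gens L \<I>) (gbds_rel L \<theta> \<I>) gbds_deg"


section \<open>Bimodules and tensor products\<close>

text \<open>As for \<^typ>\<open>('a, 'b) module\<close>, the fields \<^const>\<open>mult\<close> and \<^const>\<open>one\<close> are unused.\<close>

record ('s, 'a) bimodule = "'a ring" +
  lact :: "['s, 'a] \<Rightarrow> 'a" (infixl "\<triangleright>\<index>" 70)
  ract :: "['a, 's] \<Rightarrow> 'a" (infixl "\<triangleleft>\<index>" 70)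

locale bimodule = S?: rng S + M?: abelian_group M
  for S :: "('s, 'n) ring_scheme" and M :: "('s, 'a, 'm) bimodule_scheme" +
  assumes lact_closed: "\<lbrakk>r \<in> carrier S; x \<in> carrier M\<rbrakk> \<Longrightarrow> r \<triangleright>\<^bsub>M\<^esub> x \<in> carrier M"
    and ract_closed: "\<lbrakk>x \<in> carrier M; r \<in> carrier S\<rbrakk> \<Longrightarrow> x \<triangleleft>\<^bsub>M\<^esub> r \<in> carrier M"
    and lact_add_scalar: "\<lbrakk>r \<in> carrier S; t \<in> carrier S; x \<in> carrier M\<rbrakk> \<Longrightarrow>
      (r \<oplus>\<^bsub>S\<^esub> t) \<triangleright>\<^bsub>M\<^esub> x = r \<triangleright>\<^bsub>M\<^esub> x \<oplus>\<^bsub>M\<^esub> t \<triangleright>\<^bsub>M\<^esub> x"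
    and lact_add: "\<lbrakk>r \<in> carrier S; x \<in> carrier M; y \<in> carrier M\<rbrakk> \<Longrightarrow>
      r \<triangleright>\<^bsub>M\<^esub> (x \<oplus>\<^bsub>M\<^esub> y) = r \<triangleright>\<^bsub>M\<^esub> x \<oplus>\<^bsub>M\<^esub> r \<triangleright>\<^bsub>M\<^esub> y"
    and lact_mult: "\<lbrakk>r \<in> carrier S; t \<in> carrier S; x \<in> carrier M\<rbrakk> \<Longrightarrow>
      (r \<otimes>\<^bsub>S\<^esub> t) \<triangleright>\<^bsub>M\<^esub> x = r \<triangleright>\<^bsub>M\<^esub> (t \<triangleright>\<^bsub>M\<^esub> x)"
    and ract_add_scalar: "\<lbrakk>r \<in> carrier S; t \<in> carrier S; x \<in> carrier M\<rbrakk> \<Longrightarrow>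
      x \<triangleleft>\<^bsub>M\<^esub> (r \<oplus>\<^bsub>S\<^esub> t) = x \<triangleleft>\<^bsub>M\<^esub> r \<oplus>\<^bsub>M\<^esub> x \<triangleleft>\<^bsub>M\<^esub> t"
    and ract_add: "\<lbrakk>r \<in> carrier S; x \<in> carrier M; y \<in> carrier M\<rbrakk> \<Longrightarrow>
      (x \<oplus>\<^bsub>M\<^esub> y) \<triangleleft>\<^bsub>M\<^esub> r = x \<triangleleft>\<^bsub>M\<^esub> r \<oplus>\<^bsub>M\<^esub> y \<triangleleft>\<^bsub>M\<^esub> r"
    and ract_mult: "\<lbrakk>r \<in> carrier S; t \<in> carrier S; x \<in> carrier M\<rbrakk> \<Longrightarrow>
      x \<triangleleft>\<^bsub>M\<^esub> (r \<otimes>\<^bsub>S\<^esub> t) = (x \<triangleleft>\<^bsub>M\<^esub> r) \<triangleleft>\<^bsub>M\<^esub> t"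
    and lact_ract: "\<lbrakk>r \<in> carrier S; t \<in> carrier S; x \<in> carrier M\<rbrakk> \<Longrightarrow>
      (r \<triangleright>\<^bsub>M\<^esub> x) \<triangleleft>\<^bsub>M\<^esub> t = r \<triangleright>\<^bsub>M\<^esub> (x \<triangleleft>\<^bsub>M\<^esub> t)"

definition regular_bimodule :: "('s, 'n) ring_scheme \<Rightarrow> ('s, 's) bimodule" where
  "regular_bimodule S =
     \<lparr>carrier = carrier S, mult = mult S, one = one S, ring.zero = ring.zero S, add = add S,
      lact = mult S, ract = mult S\<rparr>"

definition bimodule_hom ::
    "('s, 'n) ring_scheme \<Rightarrow> ('s, 'a, 'k) bimodule_scheme \<Rightarrow> ('s, 'b, 'm) bimodule_scheme \<Rightarrow>
     ('a \<Rightarrow> 'b) set" where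
  "bimodule_hom S M N = {h \<in> carrier M \<rightarrow> carrier N.
     (\<forall>x\<in>carrier M. \<forall>y\<in>carrier M. h (x \<oplus>\<^bsub>M\<^esub> y) = h x \<oplus>\<^bsub>N\<^esub> h y) \<and>
     (\<forall>r\<in>carrier S. \<forall>x\<in>carrier M.
        h (r \<triangleright>\<^bsub>M\<^esub> x) = r \<triangleright>\<^bsub>N\<^esub> h x \<and> h (x \<triangleleft>\<^bsub>M\<^esub> r) = h x \<triangleleft>\<^bsub>N\<^esub> r)}"

inductive_set tensor_rel ::
    "('s, 'n) ring_scheme \<Rightarrow> ('s, 'p, 'k) bimodule_scheme \<Rightarrow> ('s, 'q, 'm) bimodule_scheme \<Rightarrow>
     ('p \<times> 'q \<Rightarrow>\<^sub>0 int) set"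
  for S P Q where
  add_l: "\<lbrakk>p \<in> carrier P; p' \<in> carrier P; q \<in> carrier Q\<rbrakk> \<Longrightarrow>
    frag_of (p \<oplus>\<^bsub>P\<^esub> p', q) - (frag_of (p, q) + frag_of (p', q)) \<in> tensor_rel S P Q"
| add_r: "\<lbrakk>p \<in> carrier P; q \<in> carrier Q; q' \<in> carrier Q\<rbrakk> \<Longrightarrow>
    frag_of (p, q \<oplus>\<^bsub>Q\<^esub> q') - (frag_of (p, q) + frag_of (p, q')) \<in> tensor_rel S P Q"
| balanced: "\<lbrakk>p \<in> carrier P; r \<in> carrier S; q \<in> carrier Q\<rbrakk> \<Longrightarrow>
    frag_of (p \<triangleleft>\<^bsub>P\<^esub> r, q) - frag_of (p, r \<triangleright>\<^bsub>Q\<^esub> q) \<in> tensor_rel S P Q"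

definition tensor_null ::
    "('s, 'n) ring_scheme \<Rightarrow> ('s, 'p, 'k) bimodule_scheme \<Rightarrow> ('s, 'q, 'm) bimodule_scheme \<Rightarrow>
     ('p \<times> 'q \<Rightarrow>\<^sub>0 int) set" where
  "tensor_null S P Q =
     generate (free_Abelian_group (carrier P \<times> carrier Q)) (tensor_rel S P Q)"

definition tensor_class ::
    "('s, 'n) ring_scheme \<Rightarrow> ('s, 'p, 'k) bimodule_scheme \<Rightarrow> ('s, 'q, 'm) bimodule_scheme \<Rightarrow>
     ('p \<times> 'q \<Rightarrow>\<^sub>0 int) \<Rightarrow> ('p \<times> 'q \<Rightarrow>\<^sub>0 int) set" where
  "tensor_class S P Q x =
     tensor_null S P Q #>\<^bsub>free_Abelian_group (carrier P \<times> carrier Q)\<^esub> x"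

text \<open>
  The bimodule \<open>P \<otimes>\<^sub>S Q\<close>, with \<open>r (p \<otimes> q) = rp \<otimes> q\<close> and \<open>(p \<otimes> q) r = p \<otimes> qr\<close>.
\<close>

definition tensor ::
    "('s, 'n) ring_scheme \<Rightarrow> ('s, 'p, 'k) bimodule_scheme \<Rightarrow> ('s, 'q, 'm) bimodule_scheme \<Rightarrow>
     ('s, ('p \<times> 'q \<Rightarrow>\<^sub>0 int) set) bimodule" where
  "tensor S P Q =
     (let T = free_Abelian_group (carrier P \<times> carrier Q) Mod tensor_null S P Q in
      \<lparr>carrier = carrier T, mult = undefined, one = undefined, ring.zero = one T, add = mult T,
       lact = (\<lambda>r X. \<Union>x\<in>X. tensor_class S P Q (frag_extend (\<lambda>(p, q). frag_of (r \<triangleright>\<^bsub>P\<^esub> p, q)) x)),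
       ract = (\<lambda>X r. \<Union>x\<in>X. tensor_class S P Q (frag_extend (\<lambda>(p, q). frag_of (p, q \<triangleleft>\<^bsub>Q\<^esub> r)) x))\<rparr>)"

abbreviation pure_tensor ::
    "('s, 'n) ring_scheme \<Rightarrow> ('s, 'p, 'k) bimodule_scheme \<Rightarrow> ('s, 'q, 'm) bimodule_scheme \<Rightarrow>
     'p \<Rightarrow> 'q \<Rightarrow> ('p \<times> 'q \<Rightarrow>\<^sub>0 int) set" where
  "pure_tensor S P Q p q \<equiv> tensor_class S P Q (frag_of (p, q))"


section \<open>Systems and Cuntz--Pimsner rings\<close>

locale ring_system = rng S + P: bimodule S P + Q: bimodule S Q
  for S :: "('s, 'n) ring_scheme" and P :: "('s, 'p, 'k) bimodule_scheme"
    and Q :: "('s, 'q, 'm) bimodule_scheme" and \<psi> :: "('p \<times> 'q \<Rightarrow>\<^sub>0 int) set \<Rightarrow> 's" +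
  assumes psi_hom: "\<psi> \<in> bimodule_hom S (tensor S P Q) (regular_bimodule S)"

text \<open>
  The additive group of \<open>End(M)\<close>. Endomorphisms are extensional functions, so that two
  endomorphisms are equal as soon as they agree on the carrier.
\<close>

definition End_group :: "('a, 'm) ring_scheme \<Rightarrow> ('a \<Rightarrow> 'a) monoid" where
  "End_group M =
     \<lparr>carrier = {f \<in> carrier M \<rightarrow>\<^sub>E carrier M.
        \<forall>x\<in>carrier M. \<forall>y\<in>carrier M. f (x \<oplus>\<^bsub>M\<^esub> y) = f x \<oplus>\<^bsub>M\<^esub> f y},
      mult = (\<lambda>f g. \<lambda>x\<in>carrier M. f x \<oplus>\<^bsub>M\<^esub> g x),
      one = (\<lambda>x\<in>carrier M. \<zero>\<^bsub>M\<^esub>)\<rparr>"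

definition theta_Q where
  "theta_Q S P Q \<psi> q p = (\<lambda>x\<in>carrier Q. q \<triangleleft>\<^bsub>Q\<^esub> \<psi> (pure_tensor S P Q p x))"

definition theta_P where
  "theta_P S P Q \<psi> p q = (\<lambda>y\<in>carrier P. \<psi> (pure_tensor S P Q y q) \<triangleright>\<^bsub>P\<^esub> p)"

definition finite_rank_Q where
  "finite_rank_Q S P Q \<psi> =
     generate (End_group Q) {theta_Q S P Q \<psi> q p | q p. q \<in> carrier Q \<and> p \<in> carrier P}"

definition finite_rank_P where
  "finite_rank_P S P Q \<psi> =
     generate (End_group P) {theta_P S P Q \<psi> p q | p q. p \<in> carrier P \<and> q \<in> carrier Q}"

definition condition_FS where
  "condition_FS S P Q \<psi> \<longleftrightarrow>
     (\<forall>F G. finite F \<and> F \<subseteq> carrier Q \<and> finite G \<and> G \<subseteq> carrier P \<longrightarrow>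
        (\<exists>\<Theta>\<in>finite_rank_Q S P Q \<psi>. \<exists>\<Phi>\<in>finite_rank_P S P Q \<psi>.
           (\<forall>q\<in>F. \<Theta> q = q) \<and> (\<forall>p\<in>G. \<Phi> p = p)))"

definition left_mult where
  "left_mult Q r = (\<lambda>q\<in>carrier Q. r \<triangleright>\<^bsub>Q\<^esub> q)"

definition psi_compatible where
  "psi_compatible S P Q \<psi> K \<longleftrightarrow> left_mult Q ` K \<subseteq> finite_rank_Q S P Q \<psi>"

definition faithful_ideal where
  "faithful_ideal S Q K \<longleftrightarrow>
     K \<inter> {r \<in> carrier S. left_mult Q r = \<one>\<^bsub>End_group Q\<^esub>} = {\<zero>\<^bsub>S\<^esub>}"

definition greatest_faithful_compatible where
  "greatest_faithful_compatible S P Q \<psi> K \<longleftrightarrow>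
     rng_ideal K S \<and> psi_compatible S P Q \<psi> K \<and> faithful_ideal S Q K \<and>
     (\<forall>K'. rng_ideal K' S \<and> psi_compatible S P Q \<psi> K' \<and> faithful_ideal S Q K' \<longrightarrow> K' \<subseteq> K)"

text \<open>
  The graph of \<open>\<pi>\<close>: all pairs of \<open>\<Sum> \<theta>\<^bsub>q,p\<^esub>\<close> and \<open>\<Sum> T\<^sub>Q(q) T\<^sub>P(p)\<close>, over the same finite family
  of pairs \<open>(q, p)\<close>. For a covariant representation of a system with (FS) it is the graph of a
  function on \<^const>\<open>finite_rank_Q\<close>.
\<close>

definition pi_graph where
  "pi_graph S P Q \<psi> B T\<^sub>P T\<^sub>Q =
     generate (End_group Q \<times>\<times> add_monoid B)
       {(theta_Q S P Q \<psi> q p, T\<^sub>Q q \<otimes>\<^bsub>B\<^esub> T\<^sub>P p) | q p. q \<in> carrier Q \<and> p \<in> carrier P}"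

locale covariant_representation = ring_system S P Q \<psi> + B: rng B
  for S :: "('s, 'n) ring_scheme" and P :: "('s, 'p, 'k) bimodule_scheme"
    and Q :: "('s, 'q, 'm) bimodule_scheme" and \<psi> and B :: "('b, 'l) ring_scheme" +
  fixes \<sigma> :: "'s \<Rightarrow> 'b" and T\<^sub>P :: "'p \<Rightarrow> 'b" and T\<^sub>Q :: "'q \<Rightarrow> 'b"
  assumes sigma_hom: "\<sigma> \<in> rng_hom S B"
    and TP_closed: "T\<^sub>P \<in> carrier P \<rightarrow> carrier B"
    and TQ_closed: "T\<^sub>Q \<in> carrier Q \<rightarrow> carrier B"
    and TP_add: "\<lbrakk>p \<in> carrier P; p' \<in> carrier P\<rbrakk> \<Longrightarrow> T\<^sub>P (p \<oplus>\<^bsub>P\<^esub> p') = T\<^sub>P p \<oplus>\<^bsub>B\<^esub> T\<^sub>P p'"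
    and TQ_add: "\<lbrakk>q \<in> carrier Q; q' \<in> carrier Q\<rbrakk> \<Longrightarrow> T\<^sub>Q (q \<oplus>\<^bsub>Q\<^esub> q') = T\<^sub>Q q \<oplus>\<^bsub>B\<^esub> T\<^sub>Q q'"
    and TP_lact: "\<lbrakk>r \<in> carrier S; p \<in> carrier P\<rbrakk> \<Longrightarrow> T\<^sub>P (r \<triangleright>\<^bsub>P\<^esub> p) = \<sigma> r \<otimes>\<^bsub>B\<^esub> T\<^sub>P p"
    and TP_ract: "\<lbrakk>r \<in> carrier S; p \<in> carrier P\<rbrakk> \<Longrightarrow> T\<^sub>P (p \<triangleleft>\<^bsub>P\<^esub> r) = T\<^sub>P p \<otimes>\<^bsub>B\<^esub> \<sigma> r"
    and TQ_lact: "\<lbrakk>r \<in> carrier S; q \<in> carrier Q\<rbrakk> \<Longrightarrow> T\<^sub>Q (r \<triangleright>\<^bsub>Q\<^esub> q) = \<sigma> r \<otimes>\<^bsub>B\<^esub> T\<^sub>Q q"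
    and TQ_ract: "\<lbrakk>r \<in> carrier S; q \<in> carrier Q\<rbrakk> \<Longrightarrow> T\<^sub>Q (q \<triangleleft>\<^bsub>Q\<^esub> r) = T\<^sub>Q q \<otimes>\<^bsub>B\<^esub> \<sigma> r"
    and sigma_psi: "\<lbrakk>p \<in> carrier P; q \<in> carrier Q\<rbrakk> \<Longrightarrow>
      \<sigma> (\<psi> (pure_tensor S P Q p q)) = T\<^sub>P p \<otimes>\<^bsub>B\<^esub> T\<^sub>Q q"

definition (in covariant_representation) induced_pi :: "('q \<Rightarrow> 'q) \<Rightarrow> 'b" where
  "induced_pi \<Theta> = (THE b. (\<Theta>, b) \<in> pi_graph S P Q \<psi> B T\<^sub>P T\<^sub>Q)"

datatype ('s, 'p, 'q) cp_gen = Sig 's | TP 'p | TQ 'q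

definition cp_gens ::
    "('s, 'n) ring_scheme \<Rightarrow> ('s, 'p, 'k) bimodule_scheme \<Rightarrow> ('s, 'q, 'm) bimodule_scheme \<Rightarrow>
     ('s, 'p, 'q) cp_gen set" where
  "cp_gens S P Q = Sig ` carrier S \<union> TP ` carrier P \<union> TQ ` carrier Q"

abbreviation cp_free ::
    "('s, 'n) ring_scheme \<Rightarrow> ('s, 'p, 'k) bimodule_scheme \<Rightarrow> ('s, 'q, 'm) bimodule_scheme \<Rightarrow>
     (int, ('s, 'p, 'q) cp_gen word \<Rightarrow>\<^sub>0 int) module" where
  "cp_free S P Q \<equiv> free_alg (cp_gens S P Q)"

text \<open>
  The relations saying that \<open>\<sigma>\<close>, \<open>T\<^sub>P\<close>, \<open>T\<^sub>Q\<close> form a covariant representation with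
  \<open>\<pi> (\<Delta> x) = \<sigma> x\<close> for all \<open>x\<close> in \<open>K\<close>.
\<close>

inductive_set cp_rel ::
    "('s, 'n) ring_scheme \<Rightarrow> ('s, 'p, 'k) bimodule_scheme \<Rightarrow> ('s, 'q, 'm) bimodule_scheme \<Rightarrow>
     (('p \<times> 'q \<Rightarrow>\<^sub>0 int) set \<Rightarrow> 's) \<Rightarrow> 's set \<Rightarrow> (('s, 'p, 'q) cp_gen word \<Rightarrow>\<^sub>0 int) set"
  for S P Q \<psi> K where
  sigma_add: "\<lbrakk>r \<in> carrier S; t \<in> carrier S\<rbrakk> \<Longrightarrow>
    gen (Sig (r \<oplus>\<^bsub>S\<^esub> t)) - (gen (Sig r) + gen (Sig t)) \<in> cp_rel S P Q \<psi> K"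
| sigma_mult: "\<lbrakk>r \<in> carrier S; t \<in> carrier S\<rbrakk> \<Longrightarrow>
    gen (Sig (r \<otimes>\<^bsub>S\<^esub> t)) - gen (Sig r) * gen (Sig t) \<in> cp_rel S P Q \<psi> K"
| TP_add: "\<lbrakk>p \<in> carrier P; p' \<in> carrier P\<rbrakk> \<Longrightarrow>
    gen (TP (p \<oplus>\<^bsub>P\<^esub> p')) - (gen (TP p) + gen (TP p')) \<in> cp_rel S P Q \<psi> K"
| TQ_add: "\<lbrakk>q \<in> carrier Q; q' \<in> carrier Q\<rbrakk> \<Longrightarrow>
    gen (TQ (q \<oplus>\<^bsub>Q\<^esub> q')) - (gen (TQ q) + gen (TQ q')) \<in> cp_rel S P Q \<psi> K"
| TP_lact: "\<lbrakk>r \<in> carrier S; p \<in> carrier P\<rbrakk> \<Longrightarrow>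
    gen (TP (r \<triangleright>\<^bsub>P\<^esub> p)) - gen (Sig r) * gen (TP p) \<in> cp_rel S P Q \<psi> K"
| TP_ract: "\<lbrakk>r \<in> carrier S; p \<in> carrier P\<rbrakk> \<Longrightarrow>
    gen (TP (p \<triangleleft>\<^bsub>P\<^esub> r)) - gen (TP p) * gen (Sig r) \<in> cp_rel S P Q \<psi> K"
| TQ_lact: "\<lbrakk>r \<in> carrier S; q \<in> carrier Q\<rbrakk> \<Longrightarrow>
    gen (TQ (r \<triangleright>\<^bsub>Q\<^esub> q)) - gen (Sig r) * gen (TQ q) \<in> cp_rel S P Q \<psi> K"
| TQ_ract: "\<lbrakk>r \<in> carrier S; q \<in> carrier Q\<rbrakk> \<Longrightarrow>
    gen (TQ (q \<triangleleft>\<^bsub>Q\<^esub> r)) - gen (TQ q) * gen (Sig r) \<in> cp_rel S P Q \<psi> K"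
| sigma_psi: "\<lbrakk>p \<in> carrier P; q \<in> carrier Q\<rbrakk> \<Longrightarrow>
    gen (Sig (\<psi> (pure_tensor S P Q p q))) - gen (TP p) * gen (TQ q) \<in> cp_rel S P Q \<psi> K"
| pi_Delta: "\<lbrakk>x \<in> K;
      (left_mult Q x, b) \<in> pi_graph S P Q \<psi> (cp_free S P Q) (\<lambda>p. gen (TP p)) (\<lambda>q. gen (TQ q))\<rbrakk> \<Longrightarrow>
    b - gen (Sig x) \<in> cp_rel S P Q \<psi> K"

text \<open>The Cuntz--Pimsner ring is presented as an algebra over \<^typ>\<open>int\<close>, that is, as a ring.\<close>

definition cp_ring ::
    "('s, 'n) ring_scheme \<Rightarrow> ('s, 'p, 'k) bimodule_scheme \<Rightarrow> ('s, 'q, 'm) bimodule_scheme \<Rightarrow>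
     (('p \<times> 'q \<Rightarrow>\<^sub>0 int) set \<Rightarrow> 's) \<Rightarrow> 's set \<Rightarrow> (int, (('s, 'p, 'q) cp_gen word \<Rightarrow>\<^sub>0 int) set) module" where
  "cp_ring S P Q \<psi> K = presented_alg (cp_gens S P Q) (cp_rel S P Q \<psi> K)"

fun cp_deg :: "('s, 'p, 'q) cp_gen \<Rightarrow> int" where
  "cp_deg (Sig r) = 0"
| "cp_deg (TP p) = -1"
| "cp_deg (TQ q) = 1"

definition cp_component ::
    "('s, 'n) ring_scheme \<Rightarrow> ('s, 'p, 'k) bimodule_scheme \<Rightarrow> ('s, 'q, 'm) bimodule_scheme \<Rightarrow>
     (('p \<times> 'q \<Rightarrow>\<^sub>0 int) set \<Rightarrow> 's) \<Rightarrow> 's set \<Rightarrow> int \<Rightarrow> (('s, 'p, 'q) cp_gen word \<Rightarrow>\<^sub>0 int) set set" where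
  "cp_component S P Q \<psi> K = presented_component (cp_gens S P Q) (cp_rel S P Q \<psi> K) cp_deg"


section \<open>Free algebras and their quotients\<close>

lemma poly_mapping_sum_single: "f = (\<Sum>w\<in>Poly_Mapping.keys f. Poly_Mapping.single w (Poly_Mapping.lookup f w))"
  by (rule poly_mapping_eqI)
     (auto simp: lookup_sum lookup_single when_def in_keys_iff sum.delta)

lemma free_alg_simps [simp]:
  "mult (free_alg X) = (*)" "ring.zero (free_alg X) = 0" "add (free_alg X) = (+)"
  "f \<in> carrier (free_alg X) \<longleftrightarrow>
     (\<forall>w\<in>Poly_Mapping.keys f. letters w \<noteq> [] \<and> set (letters w) \<subseteq> X)"
  by (auto simp: free_alg_def)

lemma free_alg_smult: "r \<odot>\<^bsub>free_alg X\<^esub> f = Poly_Mapping.single 0 r * f"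
  by (simp add: free_alg_def mult_map_scale_conv_mult)

lemma single_zero_central:
  fixes f :: "'g word \<Rightarrow>\<^sub>0 'r::comm_ring"
  shows "f * Poly_Mapping.single 0 r = Poly_Mapping.single 0 r * f"
  by (subst (1 2) poly_mapping_sum_single[of f])
     (simp add: sum_distrib_left sum_distrib_right mult_single mult.commute)

lemma single_zero_one: 
  fixes f :: "'g word \<Rightarrow>\<^sub>0 'r::{comm_ring, comm_monoid_mult}"
  shows "Poly_Mapping.single 0 1 * f = f"
proof -
  have "Poly_Mapping.single 0 1 * f = Poly_Mapping.single 0 1 * (\<Sum>w\<in>Poly_Mapping.keys f. Poly_Mapping.single w (Poly_Mapping.lookup f w))"
    by (subst poly_mapping_sum_single[of f]) simp
  also have "\<dots> = (\<Sum>w\<in>Poly_Mapping.keys f. Poly_Mapping.single w (Poly_Mapping.lookup f w))"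
    by (simp add: sum_distrib_left mult_single)
  also have "\<dots> = f" by (rule poly_mapping_sum_single[symmetric])
  finally show ?thesis .
qed

lemma free_alg_add_closed:
  "f \<in> carrier (free_alg X) \<Longrightarrow> g \<in> carrier (free_alg X) \<Longrightarrow> f + g \<in> carrier (free_alg X)"
  using keys_add[of f g] unfolding free_alg_simps by blast

lemma free_alg_uminus_closed: "f \<in> carrier (free_alg X) \<Longrightarrow> - f \<in> carrier (free_alg X)"
  by (simp add: in_keys_iff)

lemma free_alg_diff_closed:
  "f \<in> carrier (free_alg X) \<Longrightarrow> g \<in> carrier (free_alg X) \<Longrightarrow> f - g \<in> carrier (free_alg X)"
  using free_alg_add_closed[of f X "- g"] free_alg_uminus_closed[of g X] by simp

lemma free_alg_mult_closed:
  "f \<in> carrier (free_alg X) \<Longrightarrow> g \<in> carrier (free_alg X) \<Longrightarrow> f * g \<in> carrier (free_alg X)"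
  using keys_mult[of f g] unfolding free_alg_simps
  apply (intro ballI) apply (drule (1) subsetD) apply clarsimp
  apply (auto simp: plus_word_def dest!: bspec) done

lemma gen_closed: "x \<in> X \<Longrightarrow> gen x \<in> carrier (free_alg X)"
  by (auto simp: gen_def keys_single split: if_splits)


lemma free_alg_nonunital_algebra:
  "nonunital_algebra (free_alg X :: ('r::{comm_ring, comm_monoid_mult}, 'g word \<Rightarrow>\<^sub>0 'r) module)"
proof (intro nonunital_algebra.intro rng.intro rng_axioms.intro nonunital_algebra_axioms.intro)
  let ?F = "free_alg X :: ('r, 'g word \<Rightarrow>\<^sub>0 'r) module"
  show "abelian_group ?F"
  proof (rule abelian_groupI)
    fix x assume "x \<in> carrier ?F"
    then show "\<exists>y\<in>carrier ?F. y \<oplus>\<^bsub>?F\<^esub> x = \<zero>\<^bsub>?F\<^esub>"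
      by (intro bexI[of _ "- x"] free_alg_uminus_closed) auto
    fix y assume "y \<in> carrier ?F"
    then show "x \<oplus>\<^bsub>?F\<^esub> y \<in> carrier ?F"
      using free_alg_add_closed[OF \<open>x \<in> carrier ?F\<close>] by (simp del: free_alg_simps(4))
  qed (simp_all add: ac_simps)
  fix x y :: "'g word \<Rightarrow>\<^sub>0 'r" and r s
  show "x \<otimes>\<^bsub>?F\<^esub> y \<in> carrier ?F" if "x \<in> carrier ?F" "y \<in> carrier ?F"
    using free_alg_mult_closed that by (auto simp del: free_alg_simps(4))
  show "r \<odot>\<^bsub>?F\<^esub> x \<in> carrier ?F" if "x \<in> carrier ?F"
    using keys_mult[of "Poly_Mapping.single 0 r" x] that
    by (simp add: free_alg_smult split: if_splits) blast
  show "x \<otimes>\<^bsub>?F\<^esub> (r \<odot>\<^bsub>?F\<^esub> y) = r \<odot>\<^bsub>?F\<^esub> (x \<otimes>\<^bsub>?F\<^esub> y)"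
    by (simp add: free_alg_smult single_zero_central flip: mult.assoc)
next
  let ?F = "free_alg X :: ('r, 'g word \<Rightarrow>\<^sub>0 'r) module"
  fix x y z :: "'g word \<Rightarrow>\<^sub>0 'r" and r s
  show "x \<otimes>\<^bsub>?F\<^esub> y \<otimes>\<^bsub>?F\<^esub> z = x \<otimes>\<^bsub>?F\<^esub> (y \<otimes>\<^bsub>?F\<^esub> z)"
    "(x \<oplus>\<^bsub>?F\<^esub> y) \<otimes>\<^bsub>?F\<^esub> z = x \<otimes>\<^bsub>?F\<^esub> z \<oplus>\<^bsub>?F\<^esub> y \<otimes>\<^bsub>?F\<^esub> z"
    "z \<otimes>\<^bsub>?F\<^esub> (x \<oplus>\<^bsub>?F\<^esub> y) = z \<otimes>\<^bsub>?F\<^esub> x \<oplus>\<^bsub>?F\<^esub> z \<otimes>\<^bsub>?F\<^esub> y"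
    "(r + s) \<odot>\<^bsub>?F\<^esub> x = r \<odot>\<^bsub>?F\<^esub> x \<oplus>\<^bsub>?F\<^esub> s \<odot>\<^bsub>?F\<^esub> x"
    "r \<odot>\<^bsub>?F\<^esub> (x \<oplus>\<^bsub>?F\<^esub> y) = r \<odot>\<^bsub>?F\<^esub> x \<oplus>\<^bsub>?F\<^esub> r \<odot>\<^bsub>?F\<^esub> y"
    "(r \<odot>\<^bsub>?F\<^esub> x) \<otimes>\<^bsub>?F\<^esub> y = r \<odot>\<^bsub>?F\<^esub> (x \<otimes>\<^bsub>?F\<^esub> y)"
    "1 \<odot>\<^bsub>?F\<^esub> x = x"
    by (simp_all add: free_alg_smult mult.assoc distrib_left distrib_right single_add single_zero_one)
  show "(r * s) \<odot>\<^bsub>?F\<^esub> x = r \<odot>\<^bsub>?F\<^esub> (s \<odot>\<^bsub>?F\<^esub> x)"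
    by (simp add: free_alg_smult mult_single flip: mult.assoc)
qed

context rng
begin

lemma l_null [simp]: "x \<in> carrier R \<Longrightarrow> \<zero> \<otimes> x = \<zero>"
  using l_distr[of \<zero> \<zero> x] by (simp add: add.r_cancel_one')

lemma r_null [simp]: "x \<in> carrier R \<Longrightarrow> x \<otimes> \<zero> = \<zero>"
  using r_distr[of \<zero> \<zero> x] by (simp add: add.r_cancel_one')

lemma l_minus: "x \<in> carrier R \<Longrightarrow> y \<in> carrier R \<Longrightarrow> (\<ominus> x) \<otimes> y = \<ominus> (x \<otimes> y)"
  using l_distr[of "\<ominus> x" x y] by (metis a_inv_closed add.inv_equality l_neg l_null m_closed)

lemma r_minus: "x \<in> carrier R \<Longrightarrow> y \<in> carrier R \<Longrightarrow> x \<otimes> (\<ominus> y) = \<ominus> (x \<otimes> y)"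
  using r_distr[of "\<ominus> y" y x] by (metis a_inv_closed add.inv_equality l_neg r_null m_closed)

end

lemma rng_homD:
  assumes "h \<in> rng_hom R B"
  shows "x \<in> carrier R \<Longrightarrow> h x \<in> carrier B"
    and "x \<in> carrier R \<Longrightarrow> y \<in> carrier R \<Longrightarrow> h (x \<oplus>\<^bsub>R\<^esub> y) = h x \<oplus>\<^bsub>B\<^esub> h y"
    and "x \<in> carrier R \<Longrightarrow> y \<in> carrier R \<Longrightarrow> h (x \<otimes>\<^bsub>R\<^esub> y) = h x \<otimes>\<^bsub>B\<^esub> h y"
  using assms by (auto simp: rng_hom_def)

lemma additive_zero_minus:
  assumes "abelian_group R" "abelian_group B"
    and "\<And>x. x \<in> carrier R \<Longrightarrow> h x \<in> carrier B"
    and "\<And>x y. x \<in> carrier R \<Longrightarrow> y \<in> carrier R \<Longrightarrow> h (x \<oplus>\<^bsub>R\<^esub> y) = h x \<oplus>\<^bsub>B\<^esub> h y"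
  shows "h \<zero>\<^bsub>R\<^esub> = \<zero>\<^bsub>B\<^esub>" and "x \<in> carrier R \<Longrightarrow> h (\<ominus>\<^bsub>R\<^esub> x) = \<ominus>\<^bsub>B\<^esub> h x"
proof -
  interpret abelian_group_hom R B h
    using assms by (intro abelian_group_homI group_hom.intro group_hom_axioms.intro)
      (auto simp: hom_def abelian_group.a_group)
  show "h \<zero>\<^bsub>R\<^esub> = \<zero>\<^bsub>B\<^esub>" "x \<in> carrier R \<Longrightarrow> h (\<ominus>\<^bsub>R\<^esub> x) = \<ominus>\<^bsub>B\<^esub> h x" by simp_all
qed

context nonunital_algebra
begin

lemma smult_zero: "r \<odot> \<zero> = \<zero>"
  using smult_r_distr[of \<zero> \<zero> r] by (simp add: add.r_cancel_one')

lemma zero_smult: "x \<in> carrier A \<Longrightarrow> 0 \<odot> x = \<zero>"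
  using smult_l_distr[of x 0 0] by (simp add: add.r_cancel_one')

lemma smult_minus_one: "x \<in> carrier A \<Longrightarrow> (- 1) \<odot> x = \<ominus> x"
  using smult_l_distr[of x "- 1" 1] by (simp add: zero_smult add.inv_equality)

end

locale alg_quotient = nonunital_algebra A
  for A :: "('r::{comm_ring, comm_monoid_mult}, 'a, 'm) module_scheme" (structure) +
  fixes N :: "'a set"
  assumes N_add: "additive_subgroup N A"
    and N_smult: "x \<in> N \<Longrightarrow> r \<odot> x \<in> N"
    and N_lmult: "a \<in> carrier A \<Longrightarrow> x \<in> N \<Longrightarrow> a \<otimes> x \<in> N"
    and N_rmult: "a \<in> carrier A \<Longrightarrow> x \<in> N \<Longrightarrow> x \<otimes> a \<in> N"
begin

sublocale N: abelian_subgroup N A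
  by (rule abelian_subgroupI3[OF N_add abelian_group_axioms])

lemma class_eq_iff: "x \<in> carrier A \<Longrightarrow> y \<in> carrier A \<Longrightarrow> N +> x = N +> y \<longleftrightarrow> x \<ominus> y \<in> N"
  using N.a_rcos_module[of y x] N.a_rcos_self[of x] N.a_repr_independence'[of x y]
  by (auto simp: minus_eq)

lemma quot_carrier: "carrier (quot_alg A N) = (\<lambda>x. N +> x) ` carrier A"
  by (auto simp: quot_alg_def FactRing_def A_RCOSETS_def')

lemma quot_zero: "\<zero>\<^bsub>quot_alg A N\<^esub> = N +> \<zero>"
  by (simp add: quot_alg_def FactRing_def a_coset_add_zero N.a_subset)

lemma quot_add: "x \<in> carrier A \<Longrightarrow> y \<in> carrier A \<Longrightarrow>
    (N +> x) \<oplus>\<^bsub>quot_alg A N\<^esub> (N +> y) = N +> (x \<oplus> y)"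
  by (simp add: quot_alg_def FactRing_def N.a_rcos_sum)

lemma rcos_obtain: assumes "x' \<in> N +> x" "x \<in> carrier A" obtains n where "n \<in> N" "x' = n \<oplus> x"
  using assms by (auto simp: a_r_coset_def')

lemma quot_mult: 
  assumes x: "x \<in> carrier A" and y: "y \<in> carrier A" 
  shows "(N +> x) \<otimes>\<^bsub>quot_alg A N\<^esub> (N +> y) = N +> (x \<otimes> y)"
proof -
  have *: "N +> (x' \<otimes> y') = N +> (x \<otimes> y)" if "x' \<in> N +> x" "y' \<in> N +> y" for x' y'
  proof -
    from that obtain n m where n: "n \<in> N" "m \<in> N" "x' = n \<oplus> x" "y' = m \<oplus> y"
      using rcos_obtain x y by metis
    have nm: "n \<in> carrier A" "m \<in> carrier A" using n by auto
    have "x' \<otimes> y' \<ominus> x \<otimes> y = n \<otimes> m \<oplus> n \<otimes> y \<oplus> x \<otimes> m"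
      using nm x y by (simp add: n l_distr r_distr a_ac minus_eq r_neg2 r_neg1 r_neg)
    also have "\<dots> \<in> N" using n nm x y by (intro N.a_closed N_lmult N_rmult)
    finally show ?thesis using nm x y n by (subst class_eq_iff) auto
  qed
  have "(N +> x) \<otimes>\<^bsub>quot_alg A N\<^esub> (N +> y) = (\<Union>x'\<in>N +> x. \<Union>y'\<in>N +> y. N +> (x' \<otimes> y'))"
    by (simp add: quot_alg_def FactRing_def rcoset_mult_def)
  also have "\<dots> = (\<Union>x'\<in>N +> x. \<Union>y'\<in>N +> y. N +> (x \<otimes> y))"
    by (intro SUP_cong refl) (rule *)
  also have "\<dots> = N +> (x \<otimes> y)"
    using N.a_rcos_self[OF x] N.a_rcos_self[OF y] by blast
  finally show ?thesis .
qed

lemma quot_smult: 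
  assumes x: "x \<in> carrier A"
  shows "r \<odot>\<^bsub>quot_alg A N\<^esub> (N +> x) = N +> (r \<odot> x)"
proof -
  have *: "N +> (r \<odot> x') = N +> (r \<odot> x)" if "x' \<in> N +> x" for x'
  proof -
    from that obtain n where n: "n \<in> N" "x' = n \<oplus> x"
      using rcos_obtain x by metis
    have nm: "n \<in> carrier A" using n by auto
    have "r \<odot> x' \<ominus> r \<odot> x = r \<odot> n"
      using nm x by (simp add: n smult_r_distr a_ac minus_eq r_neg2 r_neg1 r_neg)
    also have "\<dots> \<in> N" using n by (intro N_smult)
    finally show ?thesis using nm x n by (subst class_eq_iff) auto
  qed
  have "r \<odot>\<^bsub>quot_alg A N\<^esub> (N +> x) = (\<Union>x'\<in>N +> x. N +> (r \<odot> x'))"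
    by (simp add: quot_alg_def)
  also have "\<dots> = (\<Union>x'\<in>N +> x. N +> (r \<odot> x))"
    by (intro SUP_cong refl) (rule *)
  also have "\<dots> = N +> (r \<odot> x)"
    using N.a_rcos_self[OF x] by blast
  finally show ?thesis .
qed

lemma quot_nonunital_algebra: "nonunital_algebra (quot_alg A N)"
proof (intro nonunital_algebra.intro rng.intro rng_axioms.intro nonunital_algebra_axioms.intro abelian_groupI)
  fix x assume "x \<in> carrier (quot_alg A N)"
  then obtain a where a: "a \<in> carrier A" "x = N +> a" by (auto simp: quot_carrier)
  show "\<exists>y\<in>carrier (quot_alg A N). y \<oplus>\<^bsub>quot_alg A N\<^esub> x = \<zero>\<^bsub>quot_alg A N\<^esub>"
    using a by (intro bexI[of _ "N +> (\<ominus> a)"]) (auto simp: quot_add quot_zero l_neg quot_carrier)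
qed (auto simp: quot_carrier quot_add quot_mult quot_smult quot_zero a_ac m_assoc l_distr r_distr
      smult_l_distr smult_r_distr smult_assoc smult_mult_l smult_mult_r)

lemma quot_universal:
  assumes h: "h \<in> rng_hom A B" and B: "rng B" and N: "\<And>n. n \<in> N \<Longrightarrow> h n = \<zero>\<^bsub>B\<^esub>"
  shows "\<exists>k \<in> rng_hom (quot_alg A N) B. \<forall>x\<in>carrier A. k (N +> x) = h x"
proof -
  interpret B: rng B by fact
  have *: "h x' = h x" if "x' \<in> N +> x" "x \<in> carrier A" for x x'
  proof -
    from that obtain n where n: "n \<in> N" "x' = n \<oplus> x" by (rule rcos_obtain)
    then show ?thesis using that N[of n] by (simp add: rng_homD[OF h])
  qed
  define k where "k Y = h (SOME y. y \<in> Y)" for Y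
  have k: "k (N +> x) = h x" if "x \<in> carrier A" for x
    unfolding k_def by (rule *[OF someI[of "\<lambda>y. y \<in> N +> x"]]) (use that N.a_rcos_self in auto)
  moreover have "k \<in> rng_hom (quot_alg A N) B"
    by (auto simp: rng_hom_def quot_carrier quot_add quot_mult k rng_homD[OF h])
  ultimately show ?thesis by blast
qed

end

lemma (in nonunital_algebra) alg_ideal_quotient:
  assumes "Rel \<subseteq> carrier A" shows "alg_quotient A (alg_ideal A Rel)"
proof -
  have sub: "x \<in> carrier A" if "x \<in> alg_ideal A Rel" for x
    using that by induction (use assms in auto)
  have "subgroup (alg_ideal A Rel) (add_monoid A)"
  proof (rule add.subgroupI)
    show "alg_ideal A Rel \<noteq> {}" using alg_ideal.zero by blast
    show "\<ominus> a \<in> alg_ideal A Rel" if "a \<in> alg_ideal A Rel" for a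
      using alg_ideal.smult[OF that, of "- 1"] sub[OF that] by (simp add: smult_minus_one)
  qed (auto intro: sub alg_ideal.add)
  then show ?thesis
    by (intro alg_quotient.intro alg_quotient_axioms.intro nonunital_algebra_axioms additive_subgroup.intro)
       (auto intro: alg_ideal.intros)
qed

fun word_prod :: "('b, 'm) ring_scheme \<Rightarrow> ('g \<Rightarrow> 'b) \<Rightarrow> 'g list \<Rightarrow> 'b" where
  "word_prod B g [] = undefined"
| "word_prod B g [x] = g x"
| "word_prod B g (x # y # ys) = g x \<otimes>\<^bsub>B\<^esub> word_prod B g (y # ys)"

lemma (in rng) word_prod_closed:
  "xs \<noteq> [] \<Longrightarrow> set xs \<subseteq> X \<Longrightarrow> g \<in> X \<rightarrow> carrier R \<Longrightarrow> word_prod R g xs \<in> carrier R"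
proof (induction xs)
  case (Cons x xs)
  then show ?case by (cases xs) auto
qed simp

lemma (in rng) word_prod_append:
  "xs \<noteq> [] \<Longrightarrow> set xs \<subseteq> X \<Longrightarrow> ys \<noteq> [] \<Longrightarrow> set ys \<subseteq> X \<Longrightarrow> g \<in> X \<rightarrow> carrier R \<Longrightarrow>
   word_prod R g (xs @ ys) = word_prod R g xs \<otimes> word_prod R g ys"
proof (induction xs)
  case (Cons x xs)
  obtain y ys' where [simp]: "ys = y # ys'" using Cons.prems by (cases ys) auto
  show ?case
  proof (cases xs)
    case (Cons z zs)
    have "word_prod R g xs \<in> carrier R" "word_prod R g ys \<in> carrier R" "g x \<in> carrier R"
      using Cons.prems Cons by (auto intro!: word_prod_closed[of _ X])
    then show ?thesis using Cons.IH Cons.prems Cons by (simp add: m_assoc)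
  qed auto
qed auto

definition alg_eval :: "('r, 'b, 'm) module_scheme \<Rightarrow> ('g \<Rightarrow> 'b) \<Rightarrow> ('g word \<Rightarrow>\<^sub>0 'r::{comm_ring, comm_monoid_mult}) \<Rightarrow> 'b" where
  "alg_eval B g f = (\<Oplus>\<^bsub>B\<^esub>w\<in>Poly_Mapping.keys f. Poly_Mapping.lookup f w \<odot>\<^bsub>B\<^esub> word_prod B g (letters w))"

lemma free_alg_induct [consumes 1, case_names zero single add]:
  assumes f: "f \<in> carrier (free_alg X)" and "P 0"
    and s: "\<And>w c. letters w \<noteq> [] \<Longrightarrow> set (letters w) \<subseteq> X \<Longrightarrow> P (Poly_Mapping.single w c)"
    and a: "\<And>f g. f \<in> carrier (free_alg X) \<Longrightarrow> g \<in> carrier (free_alg X) \<Longrightarrow> P f \<Longrightarrow> P g \<Longrightarrow> P (f + g)"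
  shows "P f"
proof -
  have "P (\<Sum>w\<in>W. Poly_Mapping.single w (Poly_Mapping.lookup f w)) \<and>
     (\<Sum>w\<in>W. Poly_Mapping.single w (Poly_Mapping.lookup f w)) \<in> carrier (free_alg X)"
    if "finite W" "W \<subseteq> Poly_Mapping.keys f" for W
    using that
  proof (induction W)
    case (insert w W)
    then have w: "letters w \<noteq> []" "set (letters w) \<subseteq> X" using f by auto
    have "Poly_Mapping.single w (Poly_Mapping.lookup f w) \<in> carrier (free_alg X)" 
      using w by (auto split: if_splits)
    with insert show ?case 
      using free_alg_add_closed s[OF w] a by (auto simp del: free_alg_simps)
  qed (auto simp: assms)
  from this[of "Poly_Mapping.keys f"] show ?thesis
    using poly_mapping_sum_single[of f] by simp
qed

context nonunital_algebra
begin

context fixes g :: "'g \<Rightarrow> 'a" and X assumes g: "g \<in> X \<rightarrow> carrier A"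
begin

lemma alg_eval_superset:
  assumes "finite W" "Poly_Mapping.keys f \<subseteq> W" "\<forall>w\<in>W. letters w \<noteq> [] \<and> set (letters w) \<subseteq> X"
  shows "alg_eval A g f = (\<Oplus>w\<in>W. Poly_Mapping.lookup f w \<odot> word_prod A g (letters w))"
  unfolding alg_eval_def using assms word_prod_closed[OF _ _ g]
  by (intro add.finprod_mono_neutral_cong_left) (auto simp: in_keys_iff zero_smult)

lemma alg_eval_closed: "f \<in> carrier (free_alg X) \<Longrightarrow> alg_eval A g f \<in> carrier A"
  unfolding alg_eval_def using word_prod_closed[OF _ _ g] by (intro finsum_closed) auto

lemma alg_eval_add:
  assumes "f \<in> carrier (free_alg X)" "f' \<in> carrier (free_alg X)"
  shows "alg_eval A g (f + f') = alg_eval A g f \<oplus> alg_eval A g f'"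
proof -
  let ?W = "Poly_Mapping.keys f \<union> Poly_Mapping.keys f'"
  have W: "finite ?W" "\<forall>w\<in>?W. letters w \<noteq> [] \<and> set (letters w) \<subseteq> X" using assms by auto
  have wc: "word_prod A g (letters w) \<in> carrier A" if "w \<in> ?W" for w
    using W(2) that by (intro word_prod_closed[OF _ _ g]) auto
  have "alg_eval A g (f + f') = (\<Oplus>w\<in>?W. Poly_Mapping.lookup f w \<odot> word_prod A g (letters w) \<oplus>
      Poly_Mapping.lookup f' w \<odot> word_prod A g (letters w))"
    by (subst alg_eval_superset[OF W(1) keys_add W(2)], intro add.finprod_cong')
       (use wc in \<open>auto simp: lookup_add smult_l_distr\<close>)
  also have "\<dots> = (\<Oplus>w\<in>?W. Poly_Mapping.lookup f w \<odot> word_prod A g (letters w)) \<oplus>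
     (\<Oplus>w\<in>?W. Poly_Mapping.lookup f' w \<odot> word_prod A g (letters w))"
    using wc by (intro finsum_addf) auto
  finally show ?thesis by (simp add: alg_eval_superset[OF W(1) _ W(2)])
qed

lemma alg_eval_single:
  assumes "letters w \<noteq> []" "set (letters w) \<subseteq> X"
  shows "alg_eval A g (Poly_Mapping.single w c) = c \<odot> word_prod A g (letters w)"
proof -
  have "word_prod A g (letters w) \<in> carrier A" using assms g by (intro word_prod_closed) 
  then show ?thesis using assms by (subst alg_eval_superset[of "{w}"]) auto
qed

lemma alg_eval_gen: "x \<in> X \<Longrightarrow> alg_eval A g (gen x) = g x"
  using g funcset_mem[OF g] by (auto simp: gen_def alg_eval_single)

lemma alg_eval_mult:
  assumes f: "f \<in> carrier (free_alg X)" and f': "f' \<in> carrier (free_alg X)"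
  shows "alg_eval A g (f * f') = alg_eval A g f \<otimes> alg_eval A g f'"
  using f
proof (induction rule: free_alg_induct)
  case zero
  show ?case using alg_eval_closed[OF f'] by (simp add: alg_eval_def)
next
  case (add f1 f2)
  then show ?case using f'
    by (simp add: distrib_right alg_eval_add free_alg_mult_closed alg_eval_closed l_distr
        del: free_alg_simps)
next
  case (single w c)
  have sc: "Poly_Mapping.single w c \<in> carrier (free_alg X)" using single by auto
  show ?case using f'
  proof (induction rule: free_alg_induct)
    case zero
    show ?case using alg_eval_closed[OF sc] by (simp add: alg_eval_def[of _ _ 0])
  next
    case (add f1 f2)
    then show ?case using sc
      by (simp add: distrib_left alg_eval_add free_alg_mult_closed alg_eval_closed r_distr
          del: free_alg_simps)
  next
    case (single v d)
    note v = this
    have "word_prod A g (letters w) \<in> carrier A" "word_prod A g (letters v) \<in> carrier A"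
      using v \<open>letters w \<noteq> []\<close> \<open>set (letters w) \<subseteq> X\<close> g by (auto intro!: word_prod_closed[of _ X])
    then show ?case using v \<open>letters w \<noteq> []\<close> \<open>set (letters w) \<subseteq> X\<close> g
      by (subst mult_single)
        (simp add: plus_word_def alg_eval_single word_prod_append[of _ X] smult_mult_l smult_mult_r
          smult_assoc[symmetric] mult.commute)
  qed
qed

lemma alg_eval_hom: "alg_eval A g \<in> rng_hom (free_alg X) A"
  by (auto simp: rng_hom_def alg_eval_closed alg_eval_add alg_eval_mult simp del: free_alg_simps(4))

lemma alg_eval_smult: "f \<in> carrier (free_alg X) \<Longrightarrow> alg_eval A g (r \<odot>\<^bsub>free_alg X\<^esub> f) = r \<odot> alg_eval A g f"
proof (induction rule: free_alg_induct)
  case zero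
  then show ?case by (simp add: free_alg_smult alg_eval_def smult_zero)
next
  case (single w c)
  have "word_prod A g (letters w) \<in> carrier A" using single g by (intro word_prod_closed) 
  then show ?case using single by (simp add: free_alg_smult mult_single alg_eval_single smult_assoc)
next
  case (add f1 f2)
  then show ?case 
    by (simp add: nonunital_algebra.smult_r_distr[OF free_alg_nonunital_algebra, unfolded free_alg_simps(3)] alg_eval_add alg_eval_closed smult_r_distr
      nonunital_algebra.smult_closed[OF free_alg_nonunital_algebra]   del: free_alg_simps(4))
qed

end
end


section \<open>Properties of systems; the tensor product and the map \<open>\<pi>\<close>\<close>

lemma End_group_simps [simp]:
  "\<one>\<^bsub>End_group M\<^esub> = (\<lambda>x\<in>carrier M. \<zero>\<^bsub>M\<^esub>)"
  "f \<otimes>\<^bsub>End_group M\<^esub> g = (\<lambda>x\<in>carrier M. f x \<oplus>\<^bsub>M\<^esub> g x)"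
  by (simp_all add: End_group_def)

lemma (in abelian_group) End_group_group: "group (End_group G)"
proof (rule groupI)
  fix f assume f: "f \<in> carrier (End_group G)"
  then have c: "f x \<in> carrier G" if "x \<in> carrier G" for x using that by (auto simp: End_group_def)
  show "\<exists>g\<in>carrier (End_group G). g \<otimes>\<^bsub>End_group G\<^esub> f = \<one>\<^bsub>End_group G\<^esub>"
    using f c by (intro bexI[of _ "\<lambda>x\<in>carrier G. \<ominus> f x"])
      (auto simp: End_group_def minus_add l_neg r_neg a_ac intro!: restrict_ext)
next
  fix f g h
  assume *: "f \<in> carrier (End_group G)" "g \<in> carrier (End_group G)" "h \<in> carrier (End_group G)"
  then have c: "f x \<in> carrier G" "g x \<in> carrier G" "h x \<in> carrier G" if "x \<in> carrier G" for x
    using that by (auto simp: End_group_def)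
  show "f \<otimes>\<^bsub>End_group G\<^esub> g \<in> carrier (End_group G)"
    using * c by (auto simp: End_group_def a_ac)
  show "f \<otimes>\<^bsub>End_group G\<^esub> g \<otimes>\<^bsub>End_group G\<^esub> h = f \<otimes>\<^bsub>End_group G\<^esub> (g \<otimes>\<^bsub>End_group G\<^esub> h)"
    using c by (auto simp: a_assoc intro!: restrict_ext)
  show "\<one>\<^bsub>End_group G\<^esub> \<otimes>\<^bsub>End_group G\<^esub> f = f"
    using * c by (auto simp: End_group_def fun_eq_iff PiE_def extensional_def)
qed (auto simp: End_group_def)

lemma (in abelian_group) End_group_inv:
  assumes f: "f \<in> carrier (End_group G)"
  shows "inv\<^bsub>End_group G\<^esub> f = (\<lambda>x\<in>carrier G. \<ominus> f x)"
proof (rule group.inv_equality[OF End_group_group _ f])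
  have c: "f x \<in> carrier G" if "x \<in> carrier G" for x using that f by (auto simp: End_group_def)
  show "(\<lambda>x\<in>carrier G. \<ominus> f x) \<in> carrier (End_group G)"
    using f c by (auto simp: End_group_def minus_add)
  show "(\<lambda>x\<in>carrier G. \<ominus> f x) \<otimes>\<^bsub>End_group G\<^esub> f = \<one>\<^bsub>End_group G\<^esub>"
    using c by (auto simp: l_neg intro!: restrict_ext)
qed

context ring_system
begin

lemma tensor_rel_closed: "x \<in> tensor_rel S P Q \<Longrightarrow> Poly_Mapping.keys x \<subseteq> carrier P \<times> carrier Q"
proof (induction rule: tensor_rel.induct)
  case (add_l p p' q)
  then have "frag_of (p \<oplus>\<^bsub>P\<^esub> p', q) - (frag_of (p, q) + frag_of (p', q)) \<in> carrier (free_Abelian_group (carrier P \<times> carrier Q))"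
    by (simp only: carrier_free_Abelian_group_iff) (rule subset_trans[OF keys_diff], use add_l keys_add in fastforce)
  then show ?case by simp
next
  case (add_r p q q')
  then show ?case 
    by - (rule subset_trans[OF keys_diff], use add_r keys_add in fastforce)
next
  case (balanced p r q)
  then show ?case 
    by - (rule subset_trans[OF keys_diff], use balanced P.ract_closed Q.lact_closed in fastforce)
qed

abbreviation (input) "FA \<equiv> free_Abelian_group (carrier P \<times> carrier Q)"

lemma tensor_null_subgroup: "subgroup (tensor_null S P Q) FA"
  unfolding tensor_null_def 
  by (rule group.generate_is_subgroup) (use tensor_rel_closed in auto)

lemma tensor_null_normal: "tensor_null S P Q \<lhd> FA"
  by (rule comm_group.subgroup_imp_normal[OF abelian_free_Abelian_group tensor_null_subgroup])

lemma tensor_carrier: "Poly_Mapping.keys x \<subseteq> carrier P \<times> carrier Q \<Longrightarrow> tensor_class S P Q x \<in> carrier (tensor S P Q)"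
  by (auto simp: tensor_def tensor_class_def FactGroup_def RCOSETS_def Let_def)

lemma tensor_add: 
  "Poly_Mapping.keys x \<subseteq> carrier P \<times> carrier Q \<Longrightarrow> Poly_Mapping.keys y \<subseteq> carrier P \<times> carrier Q \<Longrightarrow>
   tensor_class S P Q x \<oplus>\<^bsub>tensor S P Q\<^esub> tensor_class S P Q y = tensor_class S P Q (x + y)"
  using normal.rcos_sum[OF tensor_null_normal, of x y]
  by (simp add: tensor_def tensor_class_def FactGroup_def Let_def)

lemma tensor_eq:
  assumes "x - y \<in> tensor_rel S P Q" "Poly_Mapping.keys x \<subseteq> carrier P \<times> carrier Q" "Poly_Mapping.keys y \<subseteq> carrier P \<times> carrier Q"
  shows "tensor_class S P Q x = tensor_class S P Q y"
proof -
  have "x - y \<in> tensor_null S P Q" using assms(1) by (auto simp: tensor_null_def intro: generate.incl)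
  then have "x \<in> tensor_null S P Q #>\<^bsub>FA\<^esub> y"
    by (auto simp: r_coset_def intro!: bexI[of _ "x - y"])
  then show ?thesis unfolding tensor_class_def
    using group.repr_independence[OF group_free_Abelian_group _ _ tensor_null_subgroup] assms by auto
qed

lemma psi_closed: "p \<in> carrier P \<Longrightarrow> q \<in> carrier Q \<Longrightarrow> \<psi> (pure_tensor S P Q p q) \<in> carrier S"
  using psi_hom tensor_carrier[of "frag_of (p, q)"] by (auto simp: bimodule_hom_def regular_bimodule_def)

lemma psi_add_class:
  "Poly_Mapping.keys x \<subseteq> carrier P \<times> carrier Q \<Longrightarrow> Poly_Mapping.keys y \<subseteq> carrier P \<times> carrier Q \<Longrightarrow>
   \<psi> (tensor_class S P Q (x + y)) = \<psi> (tensor_class S P Q x) \<oplus>\<^bsub>S\<^esub> \<psi> (tensor_class S P Q y)"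
  using psi_hom tensor_carrier[of x] tensor_carrier[of y]
  by (auto simp: bimodule_hom_def regular_bimodule_def simp flip: tensor_add)

lemma psi_add_l:
  assumes "p \<in> carrier P" "p' \<in> carrier P" "q \<in> carrier Q"
  shows "\<psi> (pure_tensor S P Q (p \<oplus>\<^bsub>P\<^esub> p') q) = \<psi> (pure_tensor S P Q p q) \<oplus>\<^bsub>S\<^esub> \<psi> (pure_tensor S P Q p' q)"
proof -
  have "tensor_class S P Q (frag_of (p \<oplus>\<^bsub>P\<^esub> p', q)) = tensor_class S P Q (frag_of (p, q) + frag_of (p', q))"
    using assms by (intro tensor_eq tensor_rel.add_l subset_trans[OF keys_add]) auto
  then show ?thesis using assms by (simp add: psi_add_class)
qed

lemma psi_add_r:
  assumes "p \<in> carrier P" "q' \<in> carrier Q" "q \<in> carrier Q"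
  shows "\<psi> (pure_tensor S P Q p (q \<oplus>\<^bsub>Q\<^esub> q')) = \<psi> (pure_tensor S P Q p q) \<oplus>\<^bsub>S\<^esub> \<psi> (pure_tensor S P Q p q')"
proof -
  have "tensor_class S P Q (frag_of (p, q \<oplus>\<^bsub>Q\<^esub> q')) = tensor_class S P Q (frag_of (p, q) + frag_of (p, q'))"
    using assms by (intro tensor_eq tensor_rel.add_r subset_trans[OF keys_add]) auto
  then show ?thesis using assms by (simp add: psi_add_class)
qed

lemma theta_Q_End: "q \<in> carrier Q \<Longrightarrow> p \<in> carrier P \<Longrightarrow> theta_Q S P Q \<psi> q p \<in> carrier (End_group Q)"
  by (auto simp: theta_Q_def End_group_def psi_closed Q.ract_closed psi_add_r Q.ract_add_scalar)

lemma theta_P_End: "q \<in> carrier Q \<Longrightarrow> p \<in> carrier P \<Longrightarrow> theta_P S P Q \<psi> p q \<in> carrier (End_group P)"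
  by (auto simp: theta_P_def End_group_def psi_closed P.lact_closed psi_add_l P.lact_add_scalar)

context
  fixes B :: "('b, 'l) ring_scheme" (structure)
    and T\<^sub>P :: "'p \<Rightarrow> 'b" and T\<^sub>Q :: "'q \<Rightarrow> 'b"
  assumes B: "rng B" and TP: "T\<^sub>P \<in> carrier P \<rightarrow> carrier B" and TQ: "T\<^sub>Q \<in> carrier Q \<rightarrow> carrier B"
begin

interpretation B: rng B by (rule B)

lemma prod_group: "group (End_group Q \<times>\<times> add_monoid B)"
  by (intro DirProd_group Q.M.End_group_group B.a_group)

lemma pi_gen_closed: "q \<in> carrier Q \<Longrightarrow> p \<in> carrier P \<Longrightarrow>
   (theta_Q S P Q \<psi> q p, T\<^sub>Q q \<otimes> T\<^sub>P p) \<in> carrier (End_group Q \<times>\<times> add_monoid B)"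
  using TP TQ theta_Q_End by (auto simp: DirProd_def)

lemma pi_graph_subgroup: "subgroup (pi_graph S P Q \<psi> B T\<^sub>P T\<^sub>Q) (End_group Q \<times>\<times> add_monoid B)"
  unfolding pi_graph_def by (rule group.generate_is_subgroup[OF prod_group]) (use pi_gen_closed in blast)

lemma pi_graph_induct [consumes 1, case_names zero theta minus add]:
  assumes "(\<Theta>, b) \<in> pi_graph S P Q \<psi> B T\<^sub>P T\<^sub>Q"
    and z: "R (\<lambda>x\<in>carrier Q. \<zero>\<^bsub>Q\<^esub>) \<zero>"
    and t: "\<And>q p. q \<in> carrier Q \<Longrightarrow> p \<in> carrier P \<Longrightarrow> R (theta_Q S P Q \<psi> q p) (T\<^sub>Q q \<otimes> T\<^sub>P p)"
    and m: "\<And>\<Theta> b. (\<Theta>, b) \<in> pi_graph S P Q \<psi> B T\<^sub>P T\<^sub>Q \<Longrightarrow> \<Theta> \<in> carrier (End_group Q) \<Longrightarrow> b \<in> carrier B \<Longrightarrow> R \<Theta> b \<Longrightarrow> 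
        R (\<lambda>x\<in>carrier Q. \<ominus>\<^bsub>Q\<^esub> \<Theta> x) (\<ominus> b)"
    and a: "\<And>\<Theta> b \<Theta>' b'. (\<Theta>, b) \<in> pi_graph S P Q \<psi> B T\<^sub>P T\<^sub>Q \<Longrightarrow> \<Theta> \<in> carrier (End_group Q) \<Longrightarrow> b \<in> carrier B \<Longrightarrow> 
        (\<Theta>', b') \<in> pi_graph S P Q \<psi> B T\<^sub>P T\<^sub>Q \<Longrightarrow> \<Theta>' \<in> carrier (End_group Q) \<Longrightarrow> b' \<in> carrier B \<Longrightarrow>
        R \<Theta> b \<Longrightarrow> R \<Theta>' b' \<Longrightarrow> R (\<lambda>x\<in>carrier Q. \<Theta> x \<oplus>\<^bsub>Q\<^esub> \<Theta>' x) (b \<oplus> b')"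
  shows "R \<Theta> b"
proof -
  let ?H = "{(theta_Q S P Q \<psi> q p, T\<^sub>Q q \<otimes> T\<^sub>P p) | q p. q \<in> carrier Q \<and> p \<in> carrier P}"
  let ?G = "End_group Q \<times>\<times> add_monoid B"
  have sub: "z \<in> carrier ?G" if "z \<in> generate ?G ?H" for z
    using that subgroup.mem_carrier[OF pi_graph_subgroup] by (auto simp: pi_graph_def)
  have "case z of (\<Theta>, b) \<Rightarrow> R \<Theta> b" if "z \<in> generate ?G ?H" for z
    using that
  proof induction
    case one
    then show ?case using z by simp
  next
    case (incl h)
    then show ?case using t by auto
  next
    case (inv h)
    then obtain q p where h: "q \<in> carrier Q" "p \<in> carrier P" "h = (theta_Q S P Q \<psi> q p, T\<^sub>Q q \<otimes> T\<^sub>P p)" by auto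
    have "h \<in> generate ?G ?H" using inv by (rule generate.incl)
    moreover have "h \<in> carrier ?G" using h pi_gen_closed by auto
    moreover have "inv\<^bsub>?G\<^esub> h = (\<lambda>x\<in>carrier Q. \<ominus>\<^bsub>Q\<^esub> theta_Q S P Q \<psi> q p x, \<ominus> (T\<^sub>Q q \<otimes> T\<^sub>P p))"
      using h pi_gen_closed[OF h(1,2)] Q.M.End_group_inv
      by (simp add: inv_DirProd[OF Q.M.End_group_group B.a_group] a_inv_def)
    ultimately show ?case using h m[of "theta_Q S P Q \<psi> q p" "T\<^sub>Q q \<otimes> T\<^sub>P p"] t[of q p]
      by (simp add: pi_graph_def)
  next
    case (eng h1 h2)
    obtain \<Theta> b \<Theta>' b' where [simp]: "h1 = (\<Theta>, b)" "h2 = (\<Theta>', b')" by (cases h1, cases h2)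
    show ?case using eng sub[OF eng(1)] sub[OF eng(2)] a[of \<Theta> b \<Theta>' b'] by (simp add: pi_graph_def)
  qed
  then show ?thesis using assms(1) by (auto simp: pi_graph_def)
qed

lemma pi_graph_closed:
  assumes "(\<Theta>, b) \<in> pi_graph S P Q \<psi> B T\<^sub>P T\<^sub>Q"
  shows "\<Theta> \<in> carrier (End_group Q)" "b \<in> carrier B"
  using subgroup.mem_carrier[OF pi_graph_subgroup assms] by auto

lemma pi_graph_zero: "(\<lambda>x\<in>carrier Q. \<zero>\<^bsub>Q\<^esub>, \<zero>) \<in> pi_graph S P Q \<psi> B T\<^sub>P T\<^sub>Q"
  using subgroup.one_closed[OF pi_graph_subgroup] by simp

lemma pi_graph_theta: "q \<in> carrier Q \<Longrightarrow> p \<in> carrier P \<Longrightarrow>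
    (theta_Q S P Q \<psi> q p, T\<^sub>Q q \<otimes> T\<^sub>P p) \<in> pi_graph S P Q \<psi> B T\<^sub>P T\<^sub>Q"
  unfolding pi_graph_def by (rule generate.incl) blast

lemma pi_graph_add: "(\<Theta>, b) \<in> pi_graph S P Q \<psi> B T\<^sub>P T\<^sub>Q \<Longrightarrow> (\<Theta>', b') \<in> pi_graph S P Q \<psi> B T\<^sub>P T\<^sub>Q \<Longrightarrow>
   (\<lambda>x\<in>carrier Q. \<Theta> x \<oplus>\<^bsub>Q\<^esub> \<Theta>' x, b \<oplus> b') \<in> pi_graph S P Q \<psi> B T\<^sub>P T\<^sub>Q"
  using subgroup.m_closed[OF pi_graph_subgroup, of "(\<Theta>, b)" "(\<Theta>', b')"] by simp

lemma pi_graph_minus: "(\<Theta>, b) \<in> pi_graph S P Q \<psi> B T\<^sub>P T\<^sub>Q \<Longrightarrow>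
   (\<lambda>x\<in>carrier Q. \<ominus>\<^bsub>Q\<^esub> \<Theta> x, \<ominus> b) \<in> pi_graph S P Q \<psi> B T\<^sub>P T\<^sub>Q"
  using subgroup.m_inv_closed[OF pi_graph_subgroup, of "(\<Theta>, b)"] pi_graph_closed[of \<Theta> b]
  by (simp add: inv_DirProd[OF Q.M.End_group_group B.a_group] Q.M.End_group_inv a_inv_def)

lemma pi_graph_total:
  assumes "\<Theta> \<in> finite_rank_Q S P Q \<psi>"
  shows "\<exists>b. (\<Theta>, b) \<in> pi_graph S P Q \<psi> B T\<^sub>P T\<^sub>Q"
  using assms unfolding finite_rank_Q_def
proof induction
  case one
  show ?case unfolding End_group_simps by (rule exI, rule pi_graph_zero)
next
  case (incl h)
  then show ?case using pi_graph_theta by blast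
next
  case (inv h)
  then obtain q p where h: "q \<in> carrier Q" "p \<in> carrier P" "h = theta_Q S P Q \<psi> q p" by blast
  show ?case
    unfolding h(3) Q.M.End_group_inv[OF theta_Q_End[OF h(1,2)]]
    by (rule exI, rule pi_graph_minus[OF pi_graph_theta[OF h(1,2)]])
next
  case (eng h1 h2)
  then obtain b1 b2 where "(h1, b1) \<in> pi_graph S P Q \<psi> B T\<^sub>P T\<^sub>Q" "(h2, b2) \<in> pi_graph S P Q \<psi> B T\<^sub>P T\<^sub>Q"
    by blast
  from pi_graph_add[OF this] show ?case unfolding End_group_simps by (rule exI)
qed

end

lemma pi_graph_image:
  assumes B: "rng B" and B': "rng B'" and h: "h \<in> rng_hom B B'"
    and TP: "T\<^sub>P \<in> carrier P \<rightarrow> carrier B" and TQ: "T\<^sub>Q \<in> carrier Q \<rightarrow> carrier B"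
    and TP': "\<And>p. p \<in> carrier P \<Longrightarrow> h (T\<^sub>P p) = T\<^sub>P' p" and TQ': "\<And>q. q \<in> carrier Q \<Longrightarrow> h (T\<^sub>Q q) = T\<^sub>Q' q"
    and g: "(\<Theta>, b) \<in> pi_graph S P Q \<psi> B T\<^sub>P T\<^sub>Q"
  shows "(\<Theta>, h b) \<in> pi_graph S P Q \<psi> B' T\<^sub>P' T\<^sub>Q'"
proof -
  have T': "T\<^sub>P' \<in> carrier P \<rightarrow> carrier B'" "T\<^sub>Q' \<in> carrier Q \<rightarrow> carrier B'"
    using funcset_mem[OF TP] funcset_mem[OF TQ] rng_homD(1)[OF h] TP' TQ' by (metis Pi_I)+
  note G = pi_graph_zero[OF B' T'] pi_graph_theta[OF B' T'] pi_graph_minus[OF B' T'] pi_graph_add[OF B' T']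
  have hz: "h \<zero>\<^bsub>B\<^esub> = \<zero>\<^bsub>B'\<^esub>" "\<And>x. x \<in> carrier B \<Longrightarrow> h (\<ominus>\<^bsub>B\<^esub> x) = \<ominus>\<^bsub>B'\<^esub> h x"
    using additive_zero_minus[OF rng.axioms(1)[OF B] rng.axioms(1)[OF B'] rng_homD(1,2)[OF h]] by auto
  show ?thesis using B TP TQ g
  proof (induction rule: pi_graph_induct[consumes 4, case_names zero theta minus add])
    case zero
    show ?case using G(1) hz by (simp only: )
  next
    case (theta q p)
    then show ?case using G(2)[of q p] rng_homD(3)[OF h, of "T\<^sub>Q q" "T\<^sub>P p"] TP TQ TP' TQ' by (auto simp: Pi_iff)
  next
    case (minus \<Theta> b)
    show ?case using G(3)[OF minus(4)] hz(2)[OF minus(3)] by (simp only: )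
  next
    case (add \<Theta> b \<Theta>' b')
    show ?case using rng_homD(2)[OF h add(3) add(6)] G(4)[OF add(7,8)] by (simp only: )
  qed
qed

end

context ring_system
begin

lemma tensor_class_cong:
  assumes "x - y \<in> tensor_null S P Q" "Poly_Mapping.keys x \<subseteq> carrier P \<times> carrier Q" "Poly_Mapping.keys y \<subseteq> carrier P \<times> carrier Q"
  shows "tensor_class S P Q x = tensor_class S P Q y"
proof -
  have "x \<in> tensor_null S P Q #>\<^bsub>FA\<^esub> y"
    using assms by (auto simp: r_coset_def intro!: bexI[of _ "x - y"])
  then show ?thesis unfolding tensor_class_def
    using group.repr_independence[OF group_free_Abelian_group _ _ tensor_null_subgroup] assms by auto
qed

lemma frag_extend_closed:
  assumes "f \<in> carrier P \<times> carrier Q \<rightarrow> carrier P \<times> carrier Q" "Poly_Mapping.keys x \<subseteq> carrier P \<times> carrier Q"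
  shows "Poly_Mapping.keys (frag_extend (\<lambda>k. frag_of (f k)) x) \<subseteq> carrier P \<times> carrier Q"
  using assms keys_frag_extend[of "\<lambda>k. frag_of (f k)" x] by (fastforce simp: Pi_iff subset_iff)

lemma frag_extend_null:
  assumes f: "f \<in> carrier P \<times> carrier Q \<rightarrow> carrier P \<times> carrier Q"
    and rel: "\<And>x. x \<in> tensor_rel S P Q \<Longrightarrow> frag_extend (\<lambda>k. frag_of (f k)) x \<in> tensor_null S P Q"
    and x: "x \<in> tensor_null S P Q"
  shows "frag_extend (\<lambda>k. frag_of (f k)) x \<in> tensor_null S P Q"
  using x unfolding tensor_null_def
proof induction
  case one
  show ?case by simp (metis generate.one one_free_Abelian_group)
next
  case (incl h)
  then show ?case using rel by (simp add: tensor_null_def)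
next
  case (inv h)
  have "- frag_extend (\<lambda>k. frag_of (f k)) h \<in> tensor_null S P Q"
    using subgroup.m_inv_closed[OF tensor_null_subgroup rel[OF inv]]
      frag_extend_closed[OF f tensor_rel_closed[OF inv]] by simp
  then show ?case using tensor_rel_closed[OF inv] by (simp add: frag_extend_minus tensor_null_def)
next
  case (eng h1 h2)
  then show ?case using generate.eng[OF eng.IH] by (simp add: frag_extend_add)
qed

lemma frag_extend_class:
  assumes f: "f \<in> carrier P \<times> carrier Q \<rightarrow> carrier P \<times> carrier Q"
    and rel: "\<And>x. x \<in> tensor_rel S P Q \<Longrightarrow> frag_extend (\<lambda>k. frag_of (f k)) x \<in> tensor_null S P Q"
    and x: "Poly_Mapping.keys x \<subseteq> carrier P \<times> carrier Q"
  shows "(\<Union>y\<in>tensor_class S P Q x. tensor_class S P Q (frag_extend (\<lambda>k. frag_of (f k)) y)) =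
    tensor_class S P Q (frag_extend (\<lambda>k. frag_of (f k)) x)"
proof -
  have *: "tensor_class S P Q (frag_extend (\<lambda>k. frag_of (f k)) y) =
      tensor_class S P Q (frag_extend (\<lambda>k. frag_of (f k)) x)" if "y \<in> tensor_class S P Q x" for y
  proof -
    have "\<exists>n\<in>tensor_null S P Q. y = n + x"
      using that by (simp add: tensor_class_def r_coset_def)
    then obtain n where n: "n \<in> tensor_null S P Q" "y = n + x" by blast
    have nk: "Poly_Mapping.keys n \<subseteq> carrier P \<times> carrier Q"
      using subgroup.mem_carrier[OF tensor_null_subgroup n(1)] by simp
    show ?thesis
      unfolding n(2) using frag_extend_null[OF f rel n(1)] nk x
      by (intro tensor_class_cong frag_extend_closed[OF f] subset_trans[OF keys_add]) (auto simp: frag_extend_add)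
  qed
  have "x \<in> tensor_class S P Q x"
    using group.rcos_self[OF group_free_Abelian_group _ tensor_null_subgroup] x by (simp add: tensor_class_def)
  then show ?thesis using * by blast
qed

lemma tensor_rel_null: "x \<in> tensor_rel S P Q \<Longrightarrow> x \<in> tensor_null S P Q"
  unfolding tensor_null_def by (rule generate.incl)

lemma tensor_lact:
  assumes r: "r \<in> carrier S" and x: "Poly_Mapping.keys x \<subseteq> carrier P \<times> carrier Q"
  shows "r \<triangleright>\<^bsub>tensor S P Q\<^esub> tensor_class S P Q x = tensor_class S P Q (frag_extend (\<lambda>(p, q). frag_of (r \<triangleright>\<^bsub>P\<^esub> p, q)) x)"
proof -
  let ?f = "\<lambda>(p, q). (r \<triangleright>\<^bsub>P\<^esub> p, q)"
  have e: "(\<lambda>(p, q). frag_of (r \<triangleright>\<^bsub>P\<^esub> p, q)) = (\<lambda>k. frag_of (?f k))" by auto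
  have f: "?f \<in> carrier P \<times> carrier Q \<rightarrow> carrier P \<times> carrier Q" using r P.lact_closed by auto
  have "frag_extend (\<lambda>k. frag_of (?f k)) x \<in> tensor_null S P Q" if "x \<in> tensor_rel S P Q" for x
    using that
  proof cases
    case (add_l p p' q)
    then show ?thesis using r tensor_rel.add_l[of "r \<triangleright>\<^bsub>P\<^esub> p" P "r \<triangleright>\<^bsub>P\<^esub> p'" q Q S]
      by (intro tensor_rel_null) (simp add: frag_extend_diff frag_extend_add P.lact_add P.lact_closed)
  next
    case (add_r p q q')
    then show ?thesis using r tensor_rel.add_r[of "r \<triangleright>\<^bsub>P\<^esub> p" P q Q q' S]
      by (intro tensor_rel_null) (simp add: frag_extend_diff frag_extend_add P.lact_closed)
  next
    case (balanced p s q)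
    then show ?thesis using r tensor_rel.balanced[of "r \<triangleright>\<^bsub>P\<^esub> p" P s S q Q]
      by (intro tensor_rel_null) (simp add: frag_extend_diff P.lact_ract P.lact_closed)
  qed
  from frag_extend_class[OF f this x] show ?thesis
    by (simp add: tensor_def Let_def e)
qed

lemma tensor_ract:
  assumes r: "r \<in> carrier S" and x: "Poly_Mapping.keys x \<subseteq> carrier P \<times> carrier Q"
  shows "tensor_class S P Q x \<triangleleft>\<^bsub>tensor S P Q\<^esub> r = tensor_class S P Q (frag_extend (\<lambda>(p, q). frag_of (p, q \<triangleleft>\<^bsub>Q\<^esub> r)) x)"
proof -
  let ?f = "\<lambda>(p, q). (p, q \<triangleleft>\<^bsub>Q\<^esub> r)"
  have e: "(\<lambda>(p, q). frag_of (p, q \<triangleleft>\<^bsub>Q\<^esub> r)) = (\<lambda>k. frag_of (?f k))" by auto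
  have f: "?f \<in> carrier P \<times> carrier Q \<rightarrow> carrier P \<times> carrier Q" using r Q.ract_closed by auto
  have "frag_extend (\<lambda>k. frag_of (?f k)) x \<in> tensor_null S P Q" if "x \<in> tensor_rel S P Q" for x
    using that
  proof cases
    case (add_l p p' q)
    then show ?thesis using r tensor_rel.add_l[of p P p' "q \<triangleleft>\<^bsub>Q\<^esub> r" Q S]
      by (intro tensor_rel_null) (simp add: frag_extend_diff frag_extend_add Q.ract_closed)
  next
    case (add_r p q q')
    then show ?thesis using r tensor_rel.add_r[of p P "q \<triangleleft>\<^bsub>Q\<^esub> r" Q "q' \<triangleleft>\<^bsub>Q\<^esub> r" S]
      by (intro tensor_rel_null) (simp add: frag_extend_diff frag_extend_add Q.ract_add Q.ract_closed)
  next
    case (balanced p s q)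
    then show ?thesis using r tensor_rel.balanced[of p P s S "q \<triangleleft>\<^bsub>Q\<^esub> r" Q]
      by (intro tensor_rel_null) (simp add: frag_extend_diff Q.lact_ract Q.ract_closed)
  qed
  from frag_extend_class[OF f this x] show ?thesis
    by (simp add: tensor_def Let_def e)
qed

end


section \<open>Universal property of the Cuntz--Pimsner ring\<close>

context covariant_representation
begin

lemmas sigma = rng_homD[OF sigma_hom]

lemma TP_c: "p \<in> carrier P \<Longrightarrow> T\<^sub>P p \<in> carrier B" and TQ_c: "q \<in> carrier Q \<Longrightarrow> T\<^sub>Q q \<in> carrier B"
  using TP_closed TQ_closed by auto

lemma TP_additive: "T\<^sub>P \<zero>\<^bsub>P\<^esub> = \<zero>\<^bsub>B\<^esub>" "p \<in> carrier P \<Longrightarrow> T\<^sub>P (\<ominus>\<^bsub>P\<^esub> p) = \<ominus>\<^bsub>B\<^esub> T\<^sub>P p"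
  using additive_zero_minus[OF P.M.abelian_group_axioms B.abelian_group_axioms TP_c TP_add] by auto

lemma TQ_additive: "T\<^sub>Q \<zero>\<^bsub>Q\<^esub> = \<zero>\<^bsub>B\<^esub>" "q \<in> carrier Q \<Longrightarrow> T\<^sub>Q (\<ominus>\<^bsub>Q\<^esub> q) = \<ominus>\<^bsub>B\<^esub> T\<^sub>Q q"
  using additive_zero_minus[OF Q.M.abelian_group_axioms B.abelian_group_axioms TQ_c TQ_add] by auto

lemma pi_graph_TQ:
  assumes "(\<Theta>, b) \<in> pi_graph S P Q \<psi> B T\<^sub>P T\<^sub>Q" and x: "x \<in> carrier Q"
  shows "b \<otimes>\<^bsub>B\<^esub> T\<^sub>Q x = T\<^sub>Q (\<Theta> x)"
  using B.rng_axioms TP_closed TQ_closed assms(1)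
proof (induction rule: pi_graph_induct[consumes 4, case_names zero theta minus add])
  case zero
  then show ?case using x TQ_additive TQ_c by simp
next
  case (theta q p)
  then show ?case using x
    by (simp add: theta_Q_def TQ_ract psi_closed sigma_psi TP_c TQ_c B.m_assoc)
next
  case (minus \<Theta> b)
  then have "\<Theta> x \<in> carrier Q" using x by (auto simp: End_group_def)
  then show ?case using minus x TQ_additive TQ_c by (simp add: B.l_minus)
next
  case (add \<Theta> b \<Theta>' b')
  then have "\<Theta> x \<in> carrier Q" "\<Theta>' x \<in> carrier Q" using x by (auto simp: End_group_def)
  then show ?case using add x TQ_c TQ_add by (simp add: B.l_distr)
qed

lemma pi_graph_finite:
  assumes "(\<Theta>, b) \<in> pi_graph S P Q \<psi> B T\<^sub>P T\<^sub>Q"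
  shows "\<exists>G. finite G \<and> G \<subseteq> carrier P \<and>
    (\<forall>c\<in>carrier B. (\<forall>p\<in>G. T\<^sub>P p \<otimes>\<^bsub>B\<^esub> c = T\<^sub>P p) \<longrightarrow> b \<otimes>\<^bsub>B\<^esub> c = b)"
  using B.rng_axioms TP_closed TQ_closed assms(1)
proof (induction rule: pi_graph_induct[consumes 4, case_names zero theta minus add])
  case zero
  show ?case by (intro exI[of _ "{}"]) auto
next
  case (theta q p)
  then show ?case 
    by (intro exI[of _ "{p}"]) (auto simp: TP_c TQ_c B.m_assoc)
next
  case (minus \<Theta> b)
  then obtain G where "finite G \<and> G \<subseteq> carrier P \<and>
    (\<forall>c\<in>carrier B. (\<forall>p\<in>G. T\<^sub>P p \<otimes>\<^bsub>B\<^esub> c = T\<^sub>P p) \<longrightarrow> b \<otimes>\<^bsub>B\<^esub> c = b)" by blast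
  then show ?case using minus by (intro exI[of _ G]) (simp add: B.l_minus)
next
  case (add \<Theta> b \<Theta>' b')
  then obtain G G' where G: "finite G" "G \<subseteq> carrier P"
    "\<forall>c\<in>carrier B. (\<forall>p\<in>G. T\<^sub>P p \<otimes>\<^bsub>B\<^esub> c = T\<^sub>P p) \<longrightarrow> b \<otimes>\<^bsub>B\<^esub> c = b"
    "finite G'" "G' \<subseteq> carrier P"
    "\<forall>c\<in>carrier B. (\<forall>p\<in>G'. T\<^sub>P p \<otimes>\<^bsub>B\<^esub> c = T\<^sub>P p) \<longrightarrow> b' \<otimes>\<^bsub>B\<^esub> c = b'" by metis
  then show ?case using add by (intro exI[of _ "G \<union> G'"]) (simp add: B.l_distr)
qed

lemma finite_rank_P_TP:
  assumes "\<Phi> \<in> finite_rank_P S P Q \<psi>"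
  shows "\<exists>c\<in>carrier B. (\<forall>y\<in>carrier P. \<Phi> y \<in> carrier P \<and> T\<^sub>P (\<Phi> y) = T\<^sub>P y \<otimes>\<^bsub>B\<^esub> c) \<and>
    (\<forall>b\<in>carrier B. (\<forall>q\<in>carrier Q. b \<otimes>\<^bsub>B\<^esub> T\<^sub>Q q = \<zero>\<^bsub>B\<^esub>) \<longrightarrow> b \<otimes>\<^bsub>B\<^esub> c = \<zero>\<^bsub>B\<^esub>)"
proof -
  have th: "theta_P S P Q \<psi> p q y \<in> carrier P \<and>
      T\<^sub>P (theta_P S P Q \<psi> p q y) = T\<^sub>P y \<otimes>\<^bsub>B\<^esub> (T\<^sub>Q q \<otimes>\<^bsub>B\<^esub> T\<^sub>P p)"
    if "p \<in> carrier P" "q \<in> carrier Q" "y \<in> carrier P" for p q y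
    using that by (simp add: theta_P_def TP_lact psi_closed sigma_psi TP_c TQ_c B.m_assoc P.lact_closed)
  have z: "b \<otimes>\<^bsub>B\<^esub> (T\<^sub>Q q \<otimes>\<^bsub>B\<^esub> T\<^sub>P p) = \<zero>\<^bsub>B\<^esub>"
    if "p \<in> carrier P" "q \<in> carrier Q" "b \<in> carrier B" "\<forall>q\<in>carrier Q. b \<otimes>\<^bsub>B\<^esub> T\<^sub>Q q = \<zero>\<^bsub>B\<^esub>" for b p q
    using that by (simp add: TP_c TQ_c flip: B.m_assoc)
  show ?thesis
    using assms unfolding finite_rank_P_def
  proof induction
    case one
    show ?case by (intro bexI[of _ "\<zero>\<^bsub>B\<^esub>"]) (auto simp: TP_additive TP_c)
  next
    case (incl h)
    then obtain q p where h: "q \<in> carrier Q" "p \<in> carrier P" "h = theta_P S P Q \<psi> p q" by blast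
    then show ?case
      by (intro bexI[of _ "T\<^sub>Q q \<otimes>\<^bsub>B\<^esub> T\<^sub>P p"]) (auto simp: th z TP_c TQ_c)
  next
    case (inv h)
    then obtain q p where h: "q \<in> carrier Q" "p \<in> carrier P" "h = theta_P S P Q \<psi> p q" by blast
    let ?t = "T\<^sub>Q q \<otimes>\<^bsub>B\<^esub> T\<^sub>P p"
    have t: "?t \<in> carrier B" using h by (simp add: TP_c TQ_c)
    have i: "inv\<^bsub>End_group P\<^esub> h = (\<lambda>y\<in>carrier P. \<ominus>\<^bsub>P\<^esub> theta_P S P Q \<psi> p q y)"
      unfolding h(3) by (rule P.M.End_group_inv[OF theta_P_End[OF h(1,2)]])
    show ?case
    proof (intro bexI[of _ "\<ominus>\<^bsub>B\<^esub> ?t"] conjI ballI impI)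
      fix y assume y: "y \<in> carrier P"
      note t' = th[OF h(2,1) y]
      show "(inv\<^bsub>End_group P\<^esub> h) y \<in> carrier P"
        unfolding i using y t' by simp
      show "T\<^sub>P ((inv\<^bsub>End_group P\<^esub> h) y) = T\<^sub>P y \<otimes>\<^bsub>B\<^esub> (\<ominus>\<^bsub>B\<^esub> ?t)"
        unfolding i using y t t' by (simp only: restrict_apply if_True TP_additive(2) B.r_minus TP_c)
    next
      fix b assume "b \<in> carrier B" "\<forall>q\<in>carrier Q. b \<otimes>\<^bsub>B\<^esub> T\<^sub>Q q = \<zero>\<^bsub>B\<^esub>"
      then show "b \<otimes>\<^bsub>B\<^esub> (\<ominus>\<^bsub>B\<^esub> ?t) = \<zero>\<^bsub>B\<^esub>"
        using z[OF h(2,1)] t by (simp add: B.r_minus)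
    qed (use t in simp)
  next
    case (eng h1 h2)
    obtain c1 where c1: "c1 \<in> carrier B"
      "\<And>y. y \<in> carrier P \<Longrightarrow> h1 y \<in> carrier P"
      "\<And>y. y \<in> carrier P \<Longrightarrow> T\<^sub>P (h1 y) = T\<^sub>P y \<otimes>\<^bsub>B\<^esub> c1"
      "\<And>b. b \<in> carrier B \<Longrightarrow> \<forall>q\<in>carrier Q. b \<otimes>\<^bsub>B\<^esub> T\<^sub>Q q = \<zero>\<^bsub>B\<^esub> \<Longrightarrow> b \<otimes>\<^bsub>B\<^esub> c1 = \<zero>\<^bsub>B\<^esub>"
      using eng.IH(1) by blast
    obtain c2 where c2: "c2 \<in> carrier B"
      "\<And>y. y \<in> carrier P \<Longrightarrow> h2 y \<in> carrier P"
      "\<And>y. y \<in> carrier P \<Longrightarrow> T\<^sub>P (h2 y) = T\<^sub>P y \<otimes>\<^bsub>B\<^esub> c2"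
      "\<And>b. b \<in> carrier B \<Longrightarrow> \<forall>q\<in>carrier Q. b \<otimes>\<^bsub>B\<^esub> T\<^sub>Q q = \<zero>\<^bsub>B\<^esub> \<Longrightarrow> b \<otimes>\<^bsub>B\<^esub> c2 = \<zero>\<^bsub>B\<^esub>"
      using eng.IH(2) by blast
    show ?case
    proof (intro bexI[of _ "c1 \<oplus>\<^bsub>B\<^esub> c2"] conjI ballI impI)
      fix y assume y: "y \<in> carrier P"
      show "(h1 \<otimes>\<^bsub>End_group P\<^esub> h2) y \<in> carrier P"
        using y c1(2) c2(2) by simp
      show "T\<^sub>P ((h1 \<otimes>\<^bsub>End_group P\<^esub> h2) y) = T\<^sub>P y \<otimes>\<^bsub>B\<^esub> (c1 \<oplus>\<^bsub>B\<^esub> c2)"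
        using y c1(1-3) c2(1-3) by (simp add: TP_add TP_c B.r_distr)
    next
      fix b assume "b \<in> carrier B" "\<forall>q\<in>carrier Q. b \<otimes>\<^bsub>B\<^esub> T\<^sub>Q q = \<zero>\<^bsub>B\<^esub>"
      then show "b \<otimes>\<^bsub>B\<^esub> (c1 \<oplus>\<^bsub>B\<^esub> c2) = \<zero>\<^bsub>B\<^esub>"
        using c1(1) c2(1) c1(4)[of b] c2(4)[of b] by (simp add: B.r_distr)
    qed (use c1 c2 in simp)
  qed
qed

lemma pi_graph_zero_unique:
  assumes FS: "condition_FS S P Q \<psi>" and g: "(\<lambda>x\<in>carrier Q. \<zero>\<^bsub>Q\<^esub>, b) \<in> pi_graph S P Q \<psi> B T\<^sub>P T\<^sub>Q"
  shows "b = \<zero>\<^bsub>B\<^esub>"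
proof -
  have b: "b \<in> carrier B" using pi_graph_closed[OF B.rng_axioms TP_closed TQ_closed g] by simp
  obtain G where G: "finite G" "G \<subseteq> carrier P"
    "\<forall>c\<in>carrier B. (\<forall>p\<in>G. T\<^sub>P p \<otimes>\<^bsub>B\<^esub> c = T\<^sub>P p) \<longrightarrow> b \<otimes>\<^bsub>B\<^esub> c = b"
    using pi_graph_finite[OF g] by blast
  obtain \<Phi> where \<Phi>: "\<Phi> \<in> finite_rank_P S P Q \<psi>" "\<forall>p\<in>G. \<Phi> p = p"
    using FS G(1,2) unfolding condition_FS_def by (metis empty_subsetI finite.emptyI)
  obtain c where c: "c \<in> carrier B" "\<forall>y\<in>carrier P. \<Phi> y \<in> carrier P \<and> T\<^sub>P (\<Phi> y) = T\<^sub>P y \<otimes>\<^bsub>B\<^esub> c"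
    "\<forall>b\<in>carrier B. (\<forall>q\<in>carrier Q. b \<otimes>\<^bsub>B\<^esub> T\<^sub>Q q = \<zero>\<^bsub>B\<^esub>) \<longrightarrow> b \<otimes>\<^bsub>B\<^esub> c = \<zero>\<^bsub>B\<^esub>"
    using finite_rank_P_TP[OF \<Phi>(1)] by blast
  have "b \<otimes>\<^bsub>B\<^esub> T\<^sub>Q q = \<zero>\<^bsub>B\<^esub>" if "q \<in> carrier Q" for q
    using pi_graph_TQ[OF g that] that TQ_additive(1) by simp
  then have "b \<otimes>\<^bsub>B\<^esub> c = \<zero>\<^bsub>B\<^esub>" using c(3) b by blast
  moreover have "b \<otimes>\<^bsub>B\<^esub> c = b"
  proof -
    have "T\<^sub>P p \<otimes>\<^bsub>B\<^esub> c = T\<^sub>P p" if "p \<in> G" for p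
      using c(2) \<Phi>(2) G(2) that by (metis subsetD)
    then show ?thesis using G(3) c(1) by blast
  qed
  ultimately show ?thesis by simp
qed

lemma pi_graph_unique:
  assumes FS: "condition_FS S P Q \<psi>"
    and g: "(\<Theta>, b) \<in> pi_graph S P Q \<psi> B T\<^sub>P T\<^sub>Q" "(\<Theta>, b') \<in> pi_graph S P Q \<psi> B T\<^sub>P T\<^sub>Q"
  shows "b = b'"
proof -
  note cl = B.rng_axioms TP_closed TQ_closed
  have b: "b \<in> carrier B" "b' \<in> carrier B" "\<Theta> \<in> carrier (End_group Q)"
    using pi_graph_closed[OF cl] g by auto
  have "(\<lambda>x\<in>carrier Q. \<Theta> x \<oplus>\<^bsub>Q\<^esub> (\<lambda>x\<in>carrier Q. \<ominus>\<^bsub>Q\<^esub> \<Theta> x) x) = (\<lambda>x\<in>carrier Q. \<zero>\<^bsub>Q\<^esub>)"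
  proof (rule restrict_ext)
    fix x assume x: "x \<in> carrier Q"
    then have "\<Theta> x \<in> carrier Q" using b(3) by (auto simp: End_group_def)
    with x show "\<Theta> x \<oplus>\<^bsub>Q\<^esub> (\<lambda>x\<in>carrier Q. \<ominus>\<^bsub>Q\<^esub> \<Theta> x) x = \<zero>\<^bsub>Q\<^esub>" by (simp add: Q.M.r_neg)
  qed
  then have "(\<lambda>x\<in>carrier Q. \<zero>\<^bsub>Q\<^esub>, b \<oplus>\<^bsub>B\<^esub> \<ominus>\<^bsub>B\<^esub> b') \<in> pi_graph S P Q \<psi> B T\<^sub>P T\<^sub>Q"
    using pi_graph_add[OF cl g(1) pi_graph_minus[OF cl g(2)]] by simp
  then have "b \<oplus>\<^bsub>B\<^esub> \<ominus>\<^bsub>B\<^esub> b' = \<zero>\<^bsub>B\<^esub>" by (rule pi_graph_zero_unique[OF FS])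
  then have "b \<oplus>\<^bsub>B\<^esub> \<ominus>\<^bsub>B\<^esub> b' \<oplus>\<^bsub>B\<^esub> b' = b'" using b by simp
  then show ?thesis using b by (simp add: B.a_assoc B.l_neg)
qed

lemma induced_pi_eq:
  "condition_FS S P Q \<psi> \<Longrightarrow> (\<Theta>, b) \<in> pi_graph S P Q \<psi> B T\<^sub>P T\<^sub>Q \<Longrightarrow> induced_pi \<Theta> = b"
  unfolding induced_pi_def using pi_graph_unique by blast

end

context ring_system
begin

lemma cp_gens_closed:
  "r \<in> carrier S \<Longrightarrow> gen (Sig r) \<in> carrier (cp_free S P Q)"
  "p \<in> carrier P \<Longrightarrow> gen (TP p) \<in> carrier (cp_free S P Q)"
  "q \<in> carrier Q \<Longrightarrow> gen (TQ q) \<in> carrier (cp_free S P Q)"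
  by (rule gen_closed; simp add: cp_gens_def)+

lemma cp_free_rng: "rng (cp_free S P Q)"
  by (rule nonunital_algebra.axioms[OF free_alg_nonunital_algebra])

lemma cp_rel_closed:
  assumes "K \<subseteq> carrier S"
  shows "cp_rel S P Q \<psi> K \<subseteq> carrier (cp_free S P Q)"
proof
  fix x assume "x \<in> cp_rel S P Q \<psi> K"
  then show "x \<in> carrier (cp_free S P Q)"
  proof cases
    case (pi_Delta x b)
    have "b \<in> carrier (cp_free S P Q)"
      by (rule pi_graph_closed(2)[OF cp_free_rng _ _ pi_Delta(3)]) (auto intro: cp_gens_closed simp del: free_alg_simps)
    then show ?thesis using pi_Delta assms
      by (auto intro!: free_alg_diff_closed cp_gens_closed simp del: free_alg_simps)
  qed (auto intro!: free_alg_diff_closed free_alg_add_closed free_alg_mult_closed cp_gens_closed psi_closed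
       P.lact_closed P.ract_closed Q.lact_closed Q.ract_closed simp del: free_alg_simps)
qed

lemma cp_quotient: "K \<subseteq> carrier S \<Longrightarrow>
   alg_quotient (cp_free S P Q) (alg_ideal (cp_free S P Q) (cp_rel S P Q \<psi> K))"
  by (rule nonunital_algebra.alg_ideal_quotient[OF free_alg_nonunital_algebra cp_rel_closed])

abbreviation (input) cp_class where
  "cp_class K \<equiv> presented_class (cp_gens S P Q) (cp_rel S P Q \<psi> K)"

lemma free_alg_a_minus:
  "f \<in> carrier (free_alg X :: ('r::{comm_ring,comm_monoid_mult}, _) module) \<Longrightarrow> g \<in> carrier (free_alg X :: ('r, _) module) \<Longrightarrow> f \<ominus>\<^bsub>free_alg X :: ('r, _) module\<^esub> g = f - g"
proof -
  assume fg: "f \<in> carrier (free_alg X :: ('r, _) module)" "g \<in> carrier (free_alg X :: ('r, _) module)"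
  interpret F: nonunital_algebra "free_alg X :: ('r, _) module" by (rule free_alg_nonunital_algebra)
  have "\<ominus>\<^bsub>free_alg X :: ('r, _) module\<^esub> g = - g"
    using fg free_alg_uminus_closed[of g X] by (intro F.add.inv_equality) (auto simp del: free_alg_simps(4))
  then show ?thesis by (simp add: a_minus_def)
qed

lemma cp_class_eq:
  assumes K: "K \<subseteq> carrier S" and "f - g \<in> cp_rel S P Q \<psi> K" "f \<in> carrier (cp_free S P Q)" "g \<in> carrier (cp_free S P Q)"
  shows "cp_class K f = cp_class K g"
  unfolding presented_class_def
  using alg_quotient.class_eq_iff[OF cp_quotient[OF K], of f g] assms alg_ideal.incl[of "f - g"]
  by (simp add: free_alg_a_minus del: free_alg_simps)

lemma cp_class_hom: "K \<subseteq> carrier S \<Longrightarrow> cp_class K \<in> rng_hom (cp_free S P Q) (cp_ring S P Q \<psi> K)"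
  using alg_quotient.quot_add[OF cp_quotient] alg_quotient.quot_mult[OF cp_quotient] alg_quotient.quot_carrier[OF cp_quotient]
  by (auto simp: rng_hom_def presented_class_def cp_ring_def presented_alg_def simp del: free_alg_simps)

lemma cp_ring_rng: "K \<subseteq> carrier S \<Longrightarrow> rng (cp_ring S P Q \<psi> K)"
  using nonunital_algebra.axioms(1)[OF alg_quotient.quot_nonunital_algebra[OF cp_quotient]]
  by (simp add: cp_ring_def presented_alg_def)

theorem cp_ring_covariant:
  assumes K: "K \<subseteq> carrier S"
  shows "covariant_representation S P Q \<psi> (cp_ring S P Q \<psi> K)
    (\<lambda>r. cp_class K (gen (Sig r))) (\<lambda>p. cp_class K (gen (TP p))) (\<lambda>q. cp_class K (gen (TQ q)))"
proof -
  note h = rng_homD[OF cp_class_hom[OF K], unfolded free_alg_simps(1-3)]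
  note [simp] = cp_gens_closed
  note [simp del] = free_alg_simps
  note cl = free_alg_add_closed free_alg_mult_closed cp_gens_closed psi_closed
       P.lact_closed P.ract_closed Q.lact_closed Q.ract_closed
  note eq = cp_class_eq[OF K cp_rel.sigma_add] cp_class_eq[OF K cp_rel.sigma_mult]
     cp_class_eq[OF K cp_rel.TP_add] cp_class_eq[OF K cp_rel.TQ_add] cp_class_eq[OF K cp_rel.TP_lact] cp_class_eq[OF K cp_rel.TP_ract]
    cp_class_eq[OF K cp_rel.TQ_lact] cp_class_eq[OF K cp_rel.TQ_ract] cp_class_eq[OF K cp_rel.sigma_psi]
  show ?thesis
    by (intro covariant_representation.intro ring_system_axioms cp_ring_rng[OF K] covariant_representation_axioms.intro)
       (auto simp: rng_hom_def eq cl h)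
qed

theorem cp_ring_covariant_pi:
  assumes K: "K \<subseteq> carrier S" and FS: "condition_FS S P Q \<psi>" and c: "psi_compatible S P Q \<psi> K" and x: "x \<in> K"
  shows "covariant_representation.induced_pi S P Q \<psi> (cp_ring S P Q \<psi> K)
     (\<lambda>p. cp_class K (gen (TP p))) (\<lambda>q. cp_class K (gen (TQ q))) (left_mult Q x) = cp_class K (gen (Sig x))"
proof -
  have T: "(\<lambda>p. gen (TP p)) \<in> carrier P \<rightarrow> carrier (cp_free S P Q)" "(\<lambda>q. gen (TQ q)) \<in> carrier Q \<rightarrow> carrier (cp_free S P Q)"
    using cp_gens_closed by (auto simp del: free_alg_simps)
  have "left_mult Q x \<in> finite_rank_Q S P Q \<psi>" using c x by (auto simp: psi_compatible_def)
  then obtain b where b: "(left_mult Q x, b) \<in> pi_graph S P Q \<psi> (cp_free S P Q) (\<lambda>p. gen (TP p)) (\<lambda>q. gen (TQ q))"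
    using pi_graph_total[OF cp_free_rng T] by blast
  have bc: "b \<in> carrier (cp_free S P Q)" using pi_graph_closed[OF cp_free_rng T b] by simp
  have "cp_class K b = cp_class K (gen (Sig x))"
    using x K bc cp_rel.pi_Delta[OF x b] cp_gens_closed by (intro cp_class_eq) (auto simp del: free_alg_simps)
  moreover have "(left_mult Q x, cp_class K b) \<in> pi_graph S P Q \<psi> (cp_ring S P Q \<psi> K)
      (\<lambda>p. cp_class K (gen (TP p))) (\<lambda>q. cp_class K (gen (TQ q)))"
    by (rule pi_graph_image[OF cp_free_rng cp_ring_rng[OF K] cp_class_hom[OF K] T _ _ b]) auto
  ultimately show ?thesis
    using covariant_representation.induced_pi_eq[OF cp_ring_covariant[OF K] FS] by simp
qed

end

lemma rng_int_algebra:
  assumes "rng B"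
  shows "nonunital_algebra \<lparr>carrier = carrier B, mult = mult B, one = one B, ring.zero = ring.zero B, add = add B,
     smult = \<lambda>(k::int) x. add_pow B k x\<rparr>" (is "nonunital_algebra ?A")
proof -
  interpret rng B by fact
  have m: "[k] \<cdot>\<^bsub>B\<^esub> x \<otimes>\<^bsub>B\<^esub> y = [k] \<cdot>\<^bsub>B\<^esub> (x \<otimes>\<^bsub>B\<^esub> y)" "y \<otimes>\<^bsub>B\<^esub> [k] \<cdot>\<^bsub>B\<^esub> x = [k] \<cdot>\<^bsub>B\<^esub> (y \<otimes>\<^bsub>B\<^esub> x)"
    if xy: "x \<in> carrier B" "y \<in> carrier B" for k :: int and x y
  proof -
    have 1: "group_hom (add_monoid B) (add_monoid B) (\<lambda>x. x \<otimes>\<^bsub>B\<^esub> y)"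
      and 2: "group_hom (add_monoid B) (add_monoid B) (\<lambda>x. y \<otimes>\<^bsub>B\<^esub> x)"
      using xy by (auto intro!: group_hom.intro group_hom_axioms.intro a_group simp: hom_def l_distr r_distr)
    show "[k] \<cdot>\<^bsub>B\<^esub> x \<otimes>\<^bsub>B\<^esub> y = [k] \<cdot>\<^bsub>B\<^esub> (x \<otimes>\<^bsub>B\<^esub> y)" "y \<otimes>\<^bsub>B\<^esub> [k] \<cdot>\<^bsub>B\<^esub> x = [k] \<cdot>\<^bsub>B\<^esub> (y \<otimes>\<^bsub>B\<^esub> x)"
      using group_hom.hom_int_pow[OF 1, of x k] group_hom.hom_int_pow[OF 2, of x k] xy by (simp_all add: add_pow_def)
  qed
  show ?thesis
  proof (intro nonunital_algebra.intro rng.intro rng_axioms.intro nonunital_algebra_axioms.intro)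
    show "abelian_group ?A"
      by (rule abelian_groupI) (auto simp: a_ac intro: bexI[of _ "\<ominus>\<^bsub>B\<^esub> _"] l_neg)
  qed (auto simp: m m_assoc l_distr r_distr add.int_pow_mult add.int_pow_distrib add.int_pow_pow mult.commute)
qed

context covariant_representation
begin

theorem cp_ring_universal:
  assumes K: "K \<subseteq> carrier S" and FS: "condition_FS S P Q \<psi>"
    and pi: "\<And>x. x \<in> K \<Longrightarrow> induced_pi (left_mult Q x) = \<sigma> x"
  shows "\<exists>h \<in> rng_hom (cp_ring S P Q \<psi> K) B.
     (\<forall>r\<in>carrier S. h (cp_class K (gen (Sig r))) = \<sigma> r) \<and>
     (\<forall>p\<in>carrier P. h (cp_class K (gen (TP p))) = T\<^sub>P p) \<and>
     (\<forall>q\<in>carrier Q. h (cp_class K (gen (TQ q))) = T\<^sub>Q q)"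
proof -
  define A where "A = \<lparr>carrier = carrier B, mult = mult B, one = one B, ring.zero = ring.zero B, add = add B,
     smult = \<lambda>(k::int) x. add_pow B k x\<rparr>"
  have A_simps: "carrier A = carrier B" "mult A = mult B" "ring.zero A = ring.zero B" "add A = add B" by (auto simp: A_def)
  interpret A: nonunital_algebra A unfolding A_def by (rule rng_int_algebra[OF B.rng_axioms])
  define g where "g = case_cp_gen \<sigma> T\<^sub>P T\<^sub>Q"
  have g: "g \<in> cp_gens S P Q \<rightarrow> carrier A"
    by (auto simp: g_def cp_gens_def A_simps sigma TP_c TQ_c)
  define e where "e = alg_eval A g"
  have e: "e \<in> rng_hom (cp_free S P Q) B"
    using A.alg_eval_hom[OF g] by (simp add: e_def rng_hom_def A_simps del: free_alg_simps)
  note eh = rng_homD[OF e, unfolded free_alg_simps(1-3)]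
  have eg: "r \<in> carrier S \<Longrightarrow> e (gen (Sig r)) = \<sigma> r" "p \<in> carrier P \<Longrightarrow> e (gen (TP p)) = T\<^sub>P p"
    "q \<in> carrier Q \<Longrightarrow> e (gen (TQ q)) = T\<^sub>Q q" for r p q
    unfolding e_def by (subst A.alg_eval_gen[OF g]; simp add: cp_gens_def g_def)+
  have ez: "e 0 = \<zero>\<^bsub>B\<^esub>" 
    using additive_zero_minus(1)[OF rng.axioms(1)[OF cp_free_rng] B.abelian_group_axioms rng_homD(1,2)[OF e]] by simp
  have ed: "e (x - y) = \<zero>\<^bsub>B\<^esub>" if "x \<in> carrier (cp_free S P Q)" "y \<in> carrier (cp_free S P Q)" "e x = e y" for x y
  proof -
    have "e ((x - y) + y) = e (x - y) \<oplus>\<^bsub>B\<^esub> e y"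
      using that by (intro eh(2) free_alg_diff_closed)
    then show ?thesis using that eh(1) free_alg_diff_closed[of x _ y]
      by (simp add: B.add.r_cancel_one' del: free_alg_simps)
  qed
  have T: "(\<lambda>p. gen (TP p)) \<in> carrier P \<rightarrow> carrier (cp_free S P Q)" "(\<lambda>q. gen (TQ q)) \<in> carrier Q \<rightarrow> carrier (cp_free S P Q)"
    using cp_gens_closed by (auto simp del: free_alg_simps)
  have rel: "e n = \<zero>\<^bsub>B\<^esub>" if "n \<in> cp_rel S P Q \<psi> K" for n
    using that
  proof cases
    case (pi_Delta x b)
    have bc: "b \<in> carrier (cp_free S P Q)" using pi_graph_closed[OF cp_free_rng T pi_Delta(3)] by simp
    have "(left_mult Q x, e b) \<in> pi_graph S P Q \<psi> B T\<^sub>P T\<^sub>Q"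
      by (rule pi_graph_image[OF cp_free_rng B.rng_axioms e T _ _ pi_Delta(3)]) (auto simp: eg)
    then have "induced_pi (left_mult Q x) = e b" by (rule induced_pi_eq[OF FS])
    then show ?thesis unfolding pi_Delta(1) using bc pi_Delta(2) K pi[of x]
      by (intro ed) (auto simp: eg cp_gens_closed subset_iff simp del: free_alg_simps)
  qed (auto intro!: ed simp: eg eh sigma TP_add TQ_add TP_lact TP_ract TQ_lact TQ_ract sigma_psi
        free_alg_add_closed free_alg_mult_closed cp_gens_closed psi_closed
       P.lact_closed P.ract_closed Q.lact_closed Q.ract_closed simp del: free_alg_simps)
  interpret N: alg_quotient "cp_free S P Q" "alg_ideal (cp_free S P Q) (cp_rel S P Q \<psi> K)"
    by (rule cp_quotient[OF K])
  have "e n = \<zero>\<^bsub>B\<^esub> \<and> n \<in> carrier (cp_free S P Q)" if "n \<in> alg_ideal (cp_free S P Q) (cp_rel S P Q \<psi> K)" for n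
    using that
  proof induction
    case (smult x r)
    then have "e (r \<odot>\<^bsub>cp_free S P Q\<^esub> x) = r \<odot>\<^bsub>A\<^esub> \<zero>\<^bsub>A\<^esub>"
      using A.alg_eval_smult[OF g] by (simp add: e_def A_simps del: free_alg_simps)
    then show ?case using smult A.smult_zero N.smult_closed by (simp add: A_simps del: free_alg_simps)
  qed (use cp_rel_closed[OF K] in \<open>auto simp: ez rel eh free_alg_add_closed free_alg_mult_closed N.zero_closed[unfolded free_alg_simps(2)] simp del: free_alg_simps(4)\<close>)
  then have "\<exists>k\<in>rng_hom (quot_alg (cp_free S P Q) (alg_ideal (cp_free S P Q) (cp_rel S P Q \<psi> K))) B.
    \<forall>x\<in>carrier (cp_free S P Q). k (alg_ideal (cp_free S P Q) (cp_rel S P Q \<psi> K) +>\<^bsub>cp_free S P Q\<^esub> x) = e x"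
    by (intro N.quot_universal[OF e B.rng_axioms]) blast
  then obtain k where k: "k \<in> rng_hom (cp_ring S P Q \<psi> K) B" "\<forall>x\<in>carrier (cp_free S P Q). k (cp_class K x) = e x"
    unfolding cp_ring_def presented_alg_def presented_class_def by blast
  then show ?thesis using cp_gens_closed by (intro bexI[of _ k]) (auto simp: eg simp del: free_alg_simps)
qed

end

lemma free_alg_int_hom_unique:
  fixes X :: "'g set"
  assumes B: "rng B" and h: "h \<in> rng_hom (free_alg X :: (int, _) module) B" "h' \<in> rng_hom (free_alg X :: (int, _) module) B"
    and g: "\<And>x. x \<in> X \<Longrightarrow> h (gen x) = h' (gen x)" and f: "f \<in> carrier (free_alg X :: (int, _) module)"
  shows "h f = h' f"
proof -
  have F: "rng (free_alg X :: (int, _) module)"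
    by (rule nonunital_algebra.axioms(1)[OF free_alg_nonunital_algebra])
  note H = rng_homD[OF h(1), unfolded free_alg_simps(1-3)] rng_homD[OF h(2), unfolded free_alg_simps(1-3)]
  have z: "h 0 = \<zero>\<^bsub>B\<^esub>" "h' 0 = \<zero>\<^bsub>B\<^esub>"
    using additive_zero_minus(1)[OF rng.axioms(1)[OF F] rng.axioms(1)[OF B] rng_homD(1,2)[OF h(1)]]
      additive_zero_minus(1)[OF rng.axioms(1)[OF F] rng.axioms(1)[OF B] rng_homD(1,2)[OF h(2)]] by simp_all
  interpret B: rng B by (rule B)
  have word: "h (Poly_Mapping.single (Word xs) 1) = h' (Poly_Mapping.single (Word xs) 1)"
    if "xs \<noteq> []" "set xs \<subseteq> X" for xs
    using that
  proof (induction xs)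
    case (Cons x xs)
    show ?case
    proof (cases "xs = []")
      case True
      then show ?thesis using Cons.prems g by (simp add: gen_def)
    next
      case False
      have e: "Poly_Mapping.single (Word (x # xs)) 1 = (gen x * Poly_Mapping.single (Word xs) 1 :: 'g word \<Rightarrow>\<^sub>0 int)"
        by (simp add: gen_def mult_single plus_word_def)
      have "gen x \<in> carrier (free_alg X :: (int, _) module)"
        "Poly_Mapping.single (Word xs) 1 \<in> carrier (free_alg X :: (int, _) module)"
        using Cons.prems False gen_closed[of x X] by (auto simp: gen_def)
      then show ?thesis unfolding e
        using Cons False g by (simp add: H del: free_alg_simps)
    qed
  qed simp
  show ?thesis using f
  proof (induction rule: free_alg_induct)
    case zero
    show ?case by (simp add: z)
  next
    case (add f1 f2)
    then show ?case by (simp add: H del: free_alg_simps)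
  next
    case (single w c)
    have cl: "Poly_Mapping.single w d \<in> carrier (free_alg X :: (int, _) module)" for d
      using single by auto
    have s: "h (Poly_Mapping.single w 1) = h' (Poly_Mapping.single w 1)"
      using word[of "letters w"] single by simp
    have st: "h (Poly_Mapping.single w (d + 1)) = h (Poly_Mapping.single w d) \<oplus>\<^bsub>B\<^esub> h (Poly_Mapping.single w 1)"
      "h' (Poly_Mapping.single w (d + 1)) = h' (Poly_Mapping.single w d) \<oplus>\<^bsub>B\<^esub> h' (Poly_Mapping.single w 1)" for d
      by (simp_all add: single_add H cl del: free_alg_simps)
    show ?case
    proof (induction c rule: int_induct[of _ 0])
      case base
      then show ?case by (simp add: z)
    next
      case (step1 i)
      then show ?case by (simp add: st s)
    next
      case (step2 i)
      have "h (Poly_Mapping.single w (i - 1)) \<oplus>\<^bsub>B\<^esub> h' (Poly_Mapping.single w 1) =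
        h' (Poly_Mapping.single w (i - 1)) \<oplus>\<^bsub>B\<^esub> h' (Poly_Mapping.single w 1)"
        using st[of "i - 1"] step2 s by simp
      then show ?case using H(1,4)[OF cl] B.add.right_cancel by auto
    qed
  qed
qed

theorem (in ring_system) cp_ring_hom_unique:
  assumes K: "K \<subseteq> carrier S" and B: "rng B"
    and h: "h \<in> rng_hom (cp_ring S P Q \<psi> K) B" "h' \<in> rng_hom (cp_ring S P Q \<psi> K) B"
    and g: "\<And>r. r \<in> carrier S \<Longrightarrow> h (cp_class K (gen (Sig r))) = h' (cp_class K (gen (Sig r)))"
      "\<And>p. p \<in> carrier P \<Longrightarrow> h (cp_class K (gen (TP p))) = h' (cp_class K (gen (TP p)))"
      "\<And>q. q \<in> carrier Q \<Longrightarrow> h (cp_class K (gen (TQ q))) = h' (cp_class K (gen (TQ q)))"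
    and x: "x \<in> carrier (cp_ring S P Q \<psi> K)"
  shows "h x = h' x"
proof -
  note c = rng_homD[OF cp_class_hom[OF K], unfolded free_alg_simps(1-3)]
  obtain f where f: "f \<in> carrier (cp_free S P Q)" "x = cp_class K f"
    using x alg_quotient.quot_carrier[OF cp_quotient[OF K]]
    by (auto simp: cp_ring_def presented_alg_def presented_class_def simp del: free_alg_simps)
  have "k \<circ> cp_class K \<in> rng_hom (cp_free S P Q) B" if "k \<in> rng_hom (cp_ring S P Q \<psi> K) B" for k
    using rng_homD[OF that] c by (auto simp: rng_hom_def simp del: free_alg_simps(4))
  from free_alg_int_hom_unique[OF B this[OF h(1)] this[OF h(2)] _ f(1)]
  show ?thesis using g f(2) by (auto simp: cp_gens_def)
qed

end

theory Submission
  imports Defs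
begin

text \<open>
  Write \<open>L\<^sub>n\<close> for the component of degree \<open>n\<close> of the algebra \<open>L\<close> of the system. The subring is
  \<open>S = L\<^sub>0\<close>, the bimodules are \<open>J = L\<^bsub>-1\<^esub>\<close> and \<open>I = L\<^sub>1\<close>, the map \<open>\<psi>\<close> is the multiplication of
  \<open>L\<close>, and the greatest faithful \<open>\<psi>\<close>-compatible ideal is the additive span \<open>K\<close> of
  \<open>L\<^sub>1 L\<^bsub>-1\<^esub>\<close>. With this large \<open>S\<close> nothing has to be known about which of the generators of \<open>L\<close>
  vanish; for \<open>S = span {p\<^sub>A}\<close> one would have to know that \<open>r p\<^sub>A \<noteq> 0\<close> whenever \<open>r \<noteq> 0\<close> and \<open>A \<noteq> \<emptyset>\<close>.

  The argument is about an arbitrary graded ring \<open>L\<close> (locale \<open>semisaturated_graded_rng\<close>) such that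
  \<open>L\<^sub>n\<close> is spanned by \<open>L\<^sub>1 L\<^bsub>n-1\<^esub>\<close> for \<open>n > 0\<close> and by \<open>L\<^bsub>n+1\<^esub> L\<^bsub>-1\<^esub>\<close> for \<open>n < 0\<close>, and such that finitely
  many elements of \<open>L\<^sub>1\<close> and of \<open>L\<^bsub>-1\<^esub>\<close> have a common unit \<open>e \<in> K\<close>, acting on the left of the former
  and on the right of the latter. A finite rank operator on \<open>L\<^sub>1\<close> is then the same as
  left multiplication by an element of \<open>K\<close>, and (FS) is the existence of the local units. If
  \<open>x\<close> lies in a faithful compatible ideal, then \<open>x\<close> acts on \<open>L\<^sub>1\<close> like some \<open>y \<in> K\<close>; multiplying by
  a local unit of \<open>y\<close> shows that \<open>y\<close> lies in the ideal too, so \<open>x = y\<close> by faithfulness. Hence \<open>K\<close> is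
  the greatest such ideal.

  The identity is a covariant representation on \<open>L\<close>, so it induces \<open>h : O \<rightarrow> L\<close> on the
  Cuntz--Pimsner ring. In \<open>O\<close> the products \<open>T\<^sub>P(p) T\<^sub>Q(q)\<close> and \<open>T\<^sub>Q(q) T\<^sub>P(p)\<close> both
  lie in \<open>\<sigma>(S)\<close>, so each word in the generators equals a single \<open>\<sigma>(r)\<close>, a product of \<open>T\<^sub>Q\<close>s or
  a product of \<open>T\<^sub>P\<close>s (\<open>reduced_word\<close>). Therefore \<open>O\<^sub>0 = \<sigma>(S)\<close>, where \<open>h\<close> is injective, and if
  \<open>h x = 0\<close> with \<open>x\<close> of degree \<open>n > 0\<close>, then \<open>T\<^sub>P(p) x = 0\<close> for all \<open>p\<close> by induction, so that
  \<open>\<sigma>(e) x = 0\<close> for all \<open>e \<in> K\<close> and \<open>x = 0\<close> by local units (\<open>h_inj_pos\<close>, and \<open>h_inj_neg\<close> for \<open>n < 0\<close>).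
  As \<open>h\<close> respects the gradings and that of \<open>L\<close> is direct, \<open>h\<close> is injective; it is onto because
  \<open>L\<^sub>n\<close> is spanned by products from \<open>L\<^sub>1\<close> or from \<open>L\<^bsub>-1\<^esub>\<close>.

  For the algebra of a generalized Boolean dynamical system, directness of the grading is a fact about
  homogeneous relations (\<open>hcomp_independent\<close>), the spanning property follows from the normal form
  \<open>s \<dots> s p s\<^sup>* \<dots> s\<^sup>*\<close> of words (\<open>normal_form_word\<close>), and local units are built from the commuting
  idempotents \<open>s\<^bsub>\<alpha>,B\<^esub> s\<^sup>*\<^bsub>\<alpha>,B\<^esub>\<close> (\<open>unit_for_edges\<close>).
\<close>

section \<open>Homogeneous elements of presented algebras\<close>

lemma (in abelian_group) additive_hom_finsum:
  assumes H: "abelian_group H" and c: "\<And>x. x \<in> carrier G \<Longrightarrow> h x \<in> carrier H"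
    and a: "\<And>x y. x \<in> carrier G \<Longrightarrow> y \<in> carrier G \<Longrightarrow> h (x \<oplus> y) = h x \<oplus>\<^bsub>H\<^esub> h y"
    and N: "finite N" and f: "f \<in> N \<rightarrow> carrier G"
  shows "h (\<Oplus>n\<in>N. f n) = (\<Oplus>\<^bsub>H\<^esub>n\<in>N. h (f n))"
proof -
  interpret H: abelian_group H by (rule H)
  show ?thesis using N f
  proof (induction N)
    case empty
    show ?case using additive_zero_minus(1)[OF abelian_group_axioms H c a] by simp
  next
    case (insert n N)
    then have "(\<Oplus>n\<in>N. f n) \<in> carrier G" "f n \<in> carrier G" by (auto intro!: finsum_closed)
    moreover have "(\<lambda>n. h (f n)) \<in> N \<rightarrow> carrier H" using insert.prems c by auto
    ultimately show ?case using insert by (simp add: a c)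
  qed
qed

text \<open>
  Homogeneity of degree \<open>n\<close> for the grading of the free algebra in which the generator \<open>x\<close> has
  degree \<open>d x\<close>; the zero element is homogeneous of every degree.
\<close>

definition homog :: "('g \<Rightarrow> int) \<Rightarrow> int \<Rightarrow> ('g word \<Rightarrow>\<^sub>0 'r::zero) \<Rightarrow> bool" where
  "homog d n f \<longleftrightarrow> (\<forall>w\<in>Poly_Mapping.keys f. sum_list (map d (letters w)) = n)"

lemma homog_zero [simp]: "homog d n 0"
  by (simp add: homog_def)

lemma homog_gen: "d x = n \<Longrightarrow> homog d n (gen x)"
  by (simp add: homog_def gen_def)

lemma homog_single: "sum_list (map d (letters w)) = n \<Longrightarrow> homog d n (Poly_Mapping.single w c)"
  by (simp add: homog_def)

lemma homog_add: "homog d n f \<Longrightarrow> homog d n g \<Longrightarrow> homog d n (f + g)"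
  using keys_add[of f g] by (auto simp: homog_def)

lemma homog_diff: "homog d n f \<Longrightarrow> homog d n g \<Longrightarrow> homog d n (f - g)"
  for f g :: "_ \<Rightarrow>\<^sub>0 'r::ab_group_add"
  using keys_diff[of f g] by (auto simp: homog_def)

lemma homog_sum: "(\<And>i. i \<in> I \<Longrightarrow> homog d n (f i)) \<Longrightarrow> homog d n (\<Sum>i\<in>I. f i)"
  by (induction I rule: infinite_finite_induct) (auto intro: homog_add)

lemma homog_mult: "homog d m f \<Longrightarrow> homog d n g \<Longrightarrow> homog d (m + n) (f * g)"
  using keys_mult[of f g] by (fastforce simp: homog_def plus_word_def)

text \<open>
  The component of degree \<open>n\<close> of an element of the free algebra.
\<close>

definition homog_part :: "('g \<Rightarrow> int) \<Rightarrow> int \<Rightarrow> ('g word \<Rightarrow>\<^sub>0 'r::comm_monoid_add) \<Rightarrow> ('g word \<Rightarrow>\<^sub>0 'r)" where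
  "homog_part d n f = (\<Sum>w\<in>{w \<in> Poly_Mapping.keys f. sum_list (map d (letters w)) = n}.
     Poly_Mapping.single w (Poly_Mapping.lookup f w))"

lemma lookup_homog_part:
  "Poly_Mapping.lookup (homog_part d n f) w =
    (if sum_list (map d (letters w)) = n then Poly_Mapping.lookup f w else 0)"
  by (auto simp: homog_part_def lookup_sum lookup_single when_def in_keys_iff sum.delta)

lemma homog_part_add: "homog_part d n (f + g) = homog_part d n f + homog_part d n g"
  by (rule poly_mapping_eqI) (simp add: lookup_homog_part lookup_add)

lemma homog_part_zero [simp]: "homog_part d n 0 = 0"
  by (rule poly_mapping_eqI) (simp add: lookup_homog_part)

lemma homog_part_sum: "homog_part d n (\<Sum>i\<in>I. f i) = (\<Sum>i\<in>I. homog_part d n (f i))"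
  by (induction I rule: infinite_finite_induct) (auto simp: homog_part_add)

lemma homog_part_single:
  "homog_part d n (Poly_Mapping.single w c) =
    (if sum_list (map d (letters w)) = n then Poly_Mapping.single w c else 0)"
  by (rule poly_mapping_eqI) (simp add: lookup_homog_part lookup_single when_def)

lemma homog_part_homog: "homog d m f \<Longrightarrow> homog_part d n f = (if m = n then f else 0)"
  by (rule poly_mapping_eqI) (auto simp: lookup_homog_part homog_def in_keys_iff)

lemma keys_homog_part:
  "Poly_Mapping.keys (homog_part d n f) = {w \<in> Poly_Mapping.keys f. sum_list (map d (letters w)) = n}"
  by (auto simp: in_keys_iff lookup_homog_part split: if_splits)

lemma homog_homog_part: "homog d n (homog_part d n f)"
  by (simp add: homog_def keys_homog_part)

lemma homog_part_mult_left:
  fixes f :: "'g word \<Rightarrow>\<^sub>0 'r::comm_ring"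
  shows "homog_part d n (Poly_Mapping.single w c * f) =
    Poly_Mapping.single w c * homog_part d (n - sum_list (map d (letters w))) f"
proof -
  have "homog_part d n (Poly_Mapping.single w c * (\<Sum>v\<in>Poly_Mapping.keys f. Poly_Mapping.single v (Poly_Mapping.lookup f v))) =
    Poly_Mapping.single w c * homog_part d (n - sum_list (map d (letters w)))
      (\<Sum>v\<in>Poly_Mapping.keys f. Poly_Mapping.single v (Poly_Mapping.lookup f v))"
    unfolding sum_distrib_left homog_part_sum
    by (rule sum.cong) (auto simp: mult_single homog_part_single plus_word_def)
  then show ?thesis unfolding poly_mapping_sum_single[of f, symmetric] .
qed

lemma homog_part_mult_right:
  fixes f :: "'g word \<Rightarrow>\<^sub>0 'r::comm_ring"
  shows "homog_part d n (f * Poly_Mapping.single w c) =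
    homog_part d (n - sum_list (map d (letters w))) f * Poly_Mapping.single w c"
proof -
  have "homog_part d n ((\<Sum>v\<in>Poly_Mapping.keys f. Poly_Mapping.single v (Poly_Mapping.lookup f v)) * Poly_Mapping.single w c) =
    homog_part d (n - sum_list (map d (letters w)))
      (\<Sum>v\<in>Poly_Mapping.keys f. Poly_Mapping.single v (Poly_Mapping.lookup f v)) * Poly_Mapping.single w c"
    unfolding sum_distrib_right homog_part_sum
    by (rule sum.cong) (auto simp: mult_single homog_part_single plus_word_def)
  then show ?thesis unfolding poly_mapping_sum_single[of f, symmetric] .
qed

lemma sum_homog_part:
  assumes "finite N" "(\<lambda>w. sum_list (map d (letters w))) ` Poly_Mapping.keys f \<subseteq> N"
  shows "(\<Sum>n\<in>N. homog_part d n f) = f"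
  by (rule poly_mapping_eqI)
    (use assms in \<open>auto simp: lookup_sum lookup_homog_part sum.delta in_keys_iff image_subset_iff\<close>)

lemma free_alg_zero_closed: "0 \<in> carrier (free_alg X)"
  by simp

lemma free_alg_sum_closed:
  "(\<And>i. i \<in> I \<Longrightarrow> f i \<in> carrier (free_alg X)) \<Longrightarrow> (\<Sum>i\<in>I. f i) \<in> carrier (free_alg X)"
  by (induction I rule: infinite_finite_induct)
    (simp_all add: free_alg_zero_closed free_alg_add_closed del: free_alg_simps(4))

text \<open>
  Generators \<open>X\<close> and relations \<open>Rel\<close>; \<open>F\<close> is the free algebra, \<open>G\<close> the presented algebra and \<open>cls\<close>
  the projection from \<open>F\<close> to \<open>G\<close>.
\<close>

locale presentation =
  fixes X :: "'g set" and Rel :: "('g word \<Rightarrow>\<^sub>0 'r::{comm_ring, comm_monoid_mult}) set"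
  assumes Rel_closed: "Rel \<subseteq> carrier (free_alg X :: ('r, _) module)"
begin

abbreviation "F \<equiv> free_alg X :: ('r, 'g word \<Rightarrow>\<^sub>0 'r) module"
abbreviation "G \<equiv> presented_alg X Rel"
abbreviation "cls \<equiv> presented_class X Rel"

sublocale N: alg_quotient F "alg_ideal F Rel"
  by (rule nonunital_algebra.alg_ideal_quotient[OF free_alg_nonunital_algebra Rel_closed])

sublocale G: nonunital_algebra G
  unfolding presented_alg_def by (rule N.quot_nonunital_algebra)

declare free_alg_simps(4) [simp del]

lemma cls_closed [simp]: "f \<in> carrier F \<Longrightarrow> cls f \<in> carrier G"
  by (auto simp: presented_class_def presented_alg_def N.quot_carrier)

lemma carrier_cls: "carrier G = cls ` carrier F"
  by (auto simp: presented_class_def presented_alg_def N.quot_carrier)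

lemma cls_add: "f \<in> carrier F \<Longrightarrow> g \<in> carrier F \<Longrightarrow> cls (f + g) = cls f \<oplus>\<^bsub>G\<^esub> cls g"
  using N.quot_add[of f g] by (simp add: presented_class_def presented_alg_def)

lemma cls_mult: "f \<in> carrier F \<Longrightarrow> g \<in> carrier F \<Longrightarrow> cls (f * g) = cls f \<otimes>\<^bsub>G\<^esub> cls g"
  using N.quot_mult[of f g] by (simp add: presented_class_def presented_alg_def)

lemma cls_smult: "f \<in> carrier F \<Longrightarrow> cls (r \<odot>\<^bsub>F\<^esub> f) = r \<odot>\<^bsub>G\<^esub> cls f"
  using N.quot_smult[of f r] by (simp add: presented_class_def presented_alg_def)

lemma cls_zero: "cls 0 = \<zero>\<^bsub>G\<^esub>"
  using N.quot_zero by (simp add: presented_class_def presented_alg_def)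

lemmas zero_F [simp] = free_alg_zero_closed[of X]

lemma cls_eq_iff:
  "f \<in> carrier F \<Longrightarrow> g \<in> carrier F \<Longrightarrow> cls f = cls g \<longleftrightarrow> f - g \<in> alg_ideal F Rel"
proof -
  assume fg: "f \<in> carrier F" "g \<in> carrier F"
  have "\<ominus>\<^bsub>F\<^esub> g = - g"
    using fg free_alg_uminus_closed[of g X] by (intro N.add.inv_equality) auto
  then show ?thesis
    using N.class_eq_iff[OF fg] by (simp add: presented_class_def a_minus_def)
qed

lemma cls_eq: "f - g \<in> Rel \<Longrightarrow> f \<in> carrier F \<Longrightarrow> g \<in> carrier F \<Longrightarrow> cls f = cls g"
  by (simp add: cls_eq_iff alg_ideal.incl)

lemma cls_sum: "finite I \<Longrightarrow> (\<And>i. i \<in> I \<Longrightarrow> f i \<in> carrier F) \<Longrightarrow>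
    cls (\<Sum>i\<in>I. f i) = (\<Oplus>\<^bsub>G\<^esub>i\<in>I. cls (f i))"
  by (induction I rule: finite_induct) (auto simp: cls_zero cls_add free_alg_sum_closed)

lemma cls_single:
  "ws \<noteq> [] \<Longrightarrow> set ws \<subseteq> X \<Longrightarrow>
    cls (Poly_Mapping.single (Word ws) c) = c \<odot>\<^bsub>G\<^esub> word_prod G (\<lambda>x. cls (gen x)) ws"
proof -
  assume ws: "ws \<noteq> []" "set ws \<subseteq> X"
  then have "cls (Poly_Mapping.single (Word ws) 1) = word_prod G (\<lambda>x. cls (gen x)) ws"
  proof (induction ws)
    case (Cons x xs)
    show ?case
    proof (cases xs)
      case Nil
      then show ?thesis by (simp add: gen_def)
    next
      case (Cons y ys)
      have e: "Poly_Mapping.single (Word (x # xs)) (1::'r) = gen x * Poly_Mapping.single (Word xs) 1"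
        by (simp add: gen_def mult_single plus_word_def)
      have "gen x \<in> carrier F" "Poly_Mapping.single (Word xs) 1 \<in> carrier F"
        using Cons.prems Cons gen_closed[of x X] by (auto simp: free_alg_simps(4))
      then show ?thesis unfolding e using Cons.IH Cons.prems Cons by (simp add: cls_mult)
    qed
  qed simp
  moreover have "Poly_Mapping.single (Word ws) c = c \<odot>\<^bsub>F\<^esub> Poly_Mapping.single (Word ws) 1"
    by (simp add: free_alg_smult mult_single)
  moreover have "Poly_Mapping.single (Word ws) 1 \<in> carrier F"
    using ws by (auto simp: free_alg_simps(4))
  ultimately show ?thesis by (simp add: cls_smult)
qed

lemma word_prod_G_closed:
  "ws \<noteq> [] \<Longrightarrow> set ws \<subseteq> X \<Longrightarrow> word_prod G (\<lambda>x. cls (gen x)) ws \<in> carrier G"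
  by (rule G.word_prod_closed[of _ X]) (auto intro!: cls_closed gen_closed)

context
  fixes d :: "'g \<Rightarrow> int"
begin

abbreviation "hcomp \<equiv> presented_component X Rel d"

lemma hcomp_iff: "x \<in> hcomp n \<longleftrightarrow> (\<exists>f\<in>carrier F. homog d n f \<and> x = cls f)"
  by (auto simp: presented_component_def homog_def)

lemma hcomp_closed: "x \<in> hcomp n \<Longrightarrow> x \<in> carrier G"
  by (auto simp: hcomp_iff)

lemma hcomp_smult: "x \<in> hcomp n \<Longrightarrow> c \<odot>\<^bsub>G\<^esub> x \<in> hcomp n"
proof -
  assume "x \<in> hcomp n"
  then obtain f where f: "f \<in> carrier F" "homog d n f" "x = cls f" by (auto simp: hcomp_iff)
  then have "homog d n (c \<odot>\<^bsub>F\<^esub> f)"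
    using homog_mult[of d 0 "Poly_Mapping.single 0 c" n f]
    by (simp add: free_alg_smult homog_single zero_word_def)
  then show ?thesis using f by (auto simp: hcomp_iff cls_smult[symmetric])
qed

lemma hcomp_zero: "\<zero>\<^bsub>G\<^esub> \<in> hcomp n"
  unfolding hcomp_iff cls_zero[symmetric] by (rule bexI[of _ 0]) auto

lemma hcomp_add: "x \<in> hcomp n \<Longrightarrow> y \<in> hcomp n \<Longrightarrow> x \<oplus>\<^bsub>G\<^esub> y \<in> hcomp n"
  unfolding hcomp_iff
proof (elim bexE conjE)
  fix f g assume "f \<in> carrier F" "g \<in> carrier F" "homog d n f" "homog d n g" "x = cls f" "y = cls g"
  then show "\<exists>f\<in>carrier F. homog d n f \<and> x \<oplus>\<^bsub>G\<^esub> y = cls f"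
    by (intro bexI[of _ "f + g"]) (simp_all add: cls_add homog_add free_alg_add_closed)
qed

lemma hcomp_mult: "x \<in> hcomp m \<Longrightarrow> y \<in> hcomp n \<Longrightarrow> x \<otimes>\<^bsub>G\<^esub> y \<in> hcomp (m + n)"
  unfolding hcomp_iff
proof (elim bexE conjE)
  fix f g assume "f \<in> carrier F" "g \<in> carrier F" "homog d m f" "homog d n g" "x = cls f" "y = cls g"
  then show "\<exists>f\<in>carrier F. homog d (m + n) f \<and> x \<otimes>\<^bsub>G\<^esub> y = cls f"
    by (intro bexI[of _ "f * g"]) (simp_all add: cls_mult homog_mult free_alg_mult_closed)
qed

lemma hcomp_subgroup: "additive_subgroup (hcomp n) G"
proof (intro additive_subgroup.intro G.add.subgroupI)
  show "\<ominus>\<^bsub>G\<^esub> x \<in> hcomp n" if "x \<in> hcomp n" for x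
    using hcomp_smult[OF that, of "- 1"] hcomp_closed[OF that] by (simp add: G.smult_minus_one)
  show "hcomp n \<noteq> {}" using hcomp_zero by blast
qed (use hcomp_closed hcomp_add in auto)

lemma hcomp_gen: "x \<in> X \<Longrightarrow> cls (gen x) \<in> hcomp (d x)"
  unfolding hcomp_iff by (intro bexI[of _ "gen x"] conjI homog_gen refl gen_closed)

text \<open>
  Additively, a component is generated by the scalar multiples of words of that degree.
\<close>

lemma hcomp_induct [consumes 1, case_names zero word add]:
  assumes x: "x \<in> hcomp n"
    and z: "P \<zero>\<^bsub>G\<^esub>"
    and s: "\<And>ws c. ws \<noteq> [] \<Longrightarrow> set ws \<subseteq> X \<Longrightarrow> sum_list (map d ws) = n \<Longrightarrow>
      P (c \<odot>\<^bsub>G\<^esub> word_prod G (\<lambda>x. cls (gen x)) ws)"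
    and a: "\<And>x y. x \<in> hcomp n \<Longrightarrow> y \<in> hcomp n \<Longrightarrow> P x \<Longrightarrow> P y \<Longrightarrow> P (x \<oplus>\<^bsub>G\<^esub> y)"
  shows "P x"
proof -
  obtain f where f: "f \<in> carrier F" "homog d n f" "x = cls f" using x by (auto simp: hcomp_iff)
  let ?s = "\<lambda>w. Poly_Mapping.single w (Poly_Mapping.lookup f w)"
  have w: "letters w \<noteq> [] \<and> set (letters w) \<subseteq> X \<and> sum_list (map d (letters w)) = n \<and> ?s w \<in> carrier F"
    if "w \<in> Poly_Mapping.keys f" for w
    using f that by (auto simp: free_alg_simps(4) homog_def split: if_splits)
  have "P (cls (\<Sum>w\<in>W. ?s w)) \<and> cls (\<Sum>w\<in>W. ?s w) \<in> hcomp n"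
    if "finite W" "W \<subseteq> Poly_Mapping.keys f" for W
    using that
  proof (induction W)
    case (insert v W)
    have v: "v \<in> Poly_Mapping.keys f" and W: "W \<subseteq> Poly_Mapping.keys f" using insert by auto
    have "P (cls (?s v))"
      using s[of "letters v" "Poly_Mapping.lookup f v"] cls_single[of "letters v" "Poly_Mapping.lookup f v"] w[OF v] by simp
    moreover have "cls (?s v) \<in> hcomp n"
      using w[OF v] homog_single[of d v n] by (auto simp: hcomp_iff)
    moreover have "cls (\<Sum>w\<in>insert v W. ?s w) = cls (?s v) \<oplus>\<^bsub>G\<^esub> cls (\<Sum>w\<in>W. ?s w)"
      using insert w[OF v] free_alg_sum_closed[of W ?s] w W by (simp add: cls_add subset_iff)
    ultimately show ?case using insert W a hcomp_add by auto
  qed (use z cls_zero hcomp_zero in auto)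
  from this[of "Poly_Mapping.keys f"] show ?thesis
    using poly_mapping_sum_single[of f] f(3) by simp
qed

lemma homog_part_closed: "f \<in> carrier F \<Longrightarrow> homog_part d n f \<in> carrier F"
  by (simp add: free_alg_simps(4) keys_homog_part)

lemma hcomp_decomposition:
  assumes "x \<in> carrier G"
  obtains N a where "finite N" "\<And>n. a n \<in> hcomp n" "x = (\<Oplus>\<^bsub>G\<^esub>n\<in>N. a n)"
proof -
  obtain f where f: "f \<in> carrier F" "x = cls f" using assms by (auto simp: carrier_cls)
  let ?N = "(\<lambda>w. sum_list (map d (letters w))) ` Poly_Mapping.keys f"
  have "x = (\<Oplus>\<^bsub>G\<^esub>n\<in>?N. cls (homog_part d n f))"
    using f sum_homog_part[of ?N d f] cls_sum[of ?N "\<lambda>n. homog_part d n f"] homog_part_closed by auto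
  moreover have "cls (homog_part d n f) \<in> hcomp n" for n
    unfolding hcomp_iff by (intro bexI[of _ "homog_part d n f"] conjI homog_homog_part refl homog_part_closed f)
  ultimately show ?thesis by (intro that[of ?N "\<lambda>n. cls (homog_part d n f)"]) auto
qed

text \<open>
  Homogeneous relations generate a homogeneous ideal, so that the sum of the components is direct.
\<close>

lemma homog_part_ideal:
  assumes R: "\<And>r. r \<in> Rel \<Longrightarrow> \<exists>n. homog d n r" and f: "f \<in> alg_ideal F Rel"
  shows "homog_part d n f \<in> alg_ideal F Rel"
  using f
proof (induction arbitrary: n)
  case zero
  show ?case using alg_ideal.zero[of F Rel] by simp
next
  case (incl x)
  then obtain m where m: "homog d m x" using R by blast
  then show ?case using incl alg_ideal.incl[of x Rel F] alg_ideal.zero[of F Rel]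
    by (auto simp: homog_part_homog)
next
  case (add x y)
  then show ?case using alg_ideal.add[of "homog_part d n x" F Rel "homog_part d n y"]
    by (simp add: homog_part_add)
next
  case (smult x r)
  have "homog_part d n (r \<odot>\<^bsub>F\<^esub> x) = r \<odot>\<^bsub>F\<^esub> homog_part d n x"
    by (simp add: free_alg_smult homog_part_mult_left zero_word_def)
  then show ?case using alg_ideal.smult[OF smult.IH] by metis
next
  case (lmult a x)
  from lmult(1) show ?case unfolding free_alg_simps(1)
  proof (induction rule: free_alg_induct)
    case zero
    show ?case using alg_ideal.zero[of F Rel] by simp
  next
    case (single w c)
    have "Poly_Mapping.single w c \<in> carrier F" using single by (simp add: free_alg_simps(4))
    from alg_ideal.lmult[OF this lmult.IH] show ?case by (simp add: homog_part_mult_left)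
  next
    case (add f g)
    then show ?case using alg_ideal.add[OF add(3,4)] by (simp add: distrib_right homog_part_add)
  qed
next
  case (rmult x a)
  from rmult(2) show ?case unfolding free_alg_simps(1)
  proof (induction rule: free_alg_induct)
    case zero
    show ?case using alg_ideal.zero[of F Rel] by simp
  next
    case (single w c)
    have "Poly_Mapping.single w c \<in> carrier F" using single by (simp add: free_alg_simps(4))
    from alg_ideal.rmult[OF rmult.IH this] show ?case by (simp add: homog_part_mult_right)
  next
    case (add f g)
    then show ?case using alg_ideal.add[OF add(3,4)] by (simp add: distrib_left homog_part_add)
  qed
qed

lemma hcomp_independent:
  assumes R: "\<And>r. r \<in> Rel \<Longrightarrow> \<exists>n. homog d n r"
    and N: "finite N" and a: "\<And>n. n \<in> N \<Longrightarrow> a n \<in> hcomp n"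
    and sum: "(\<Oplus>\<^bsub>G\<^esub>n\<in>N. a n) = \<zero>\<^bsub>G\<^esub>" and m: "m \<in> N"
  shows "a m = \<zero>\<^bsub>G\<^esub>"
proof -
  obtain f where f: "\<And>n. n \<in> N \<Longrightarrow> f n \<in> carrier F \<and> homog d n (f n) \<and> a n = cls (f n)"
    using a unfolding hcomp_iff by metis
  have "cls (\<Sum>n\<in>N. f n) = (\<Oplus>\<^bsub>G\<^esub>n\<in>N. cls (f n))"
    using f N by (intro cls_sum) auto
  also have "\<dots> = (\<Oplus>\<^bsub>G\<^esub>n\<in>N. a n)" using f by (intro G.finsum_cong') auto
  also have "\<dots> = cls 0" using sum cls_zero by simp
  finally have "(\<Sum>n\<in>N. f n) \<in> alg_ideal F Rel"
    using f free_alg_sum_closed[of N f] by (simp add: cls_eq_iff)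
  from homog_part_ideal[OF R this, of m]
  have "(\<Sum>n\<in>N. homog_part d m (f n)) \<in> alg_ideal F Rel" by (simp only: homog_part_sum)
  moreover have "(\<Sum>n\<in>N. homog_part d m (f n)) = (\<Sum>n\<in>N. if n = m then f n else 0)"
  proof (rule sum.cong[OF refl])
    fix n assume "n \<in> N"
    then have "homog d n (f n)" using f by blast
    then show "homog_part d m (f n) = (if n = m then f n else 0)" by (rule homog_part_homog)
  qed
  moreover have "\<dots> = f m" using sum.delta[OF N, of m f] m by (simp only: if_True)
  ultimately have "f m \<in> alg_ideal F Rel" by (simp only:)
  then have "cls (f m) = cls 0" using f[OF m] by (subst cls_eq_iff) auto
  then show ?thesis using f[OF m] by (simp only: cls_zero)
qed

end
end


section \<open>Maps out of the tensor product\<close>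

text \<open>
  A balanced bimodule map \<open>\<beta> : P \<times> Q \<rightarrow> S\<close> factors through the tensor product.
\<close>

lemma balanced_map_ring_system:
  assumes P: "bimodule S P" and Q: "bimodule S Q"
    and closed: "\<And>p q. p \<in> carrier P \<Longrightarrow> q \<in> carrier Q \<Longrightarrow> \<beta> p q \<in> carrier S"
    and add_l: "\<And>p p' q. p \<in> carrier P \<Longrightarrow> p' \<in> carrier P \<Longrightarrow> q \<in> carrier Q \<Longrightarrow>
      \<beta> (p \<oplus>\<^bsub>P\<^esub> p') q = \<beta> p q \<oplus>\<^bsub>S\<^esub> \<beta> p' q"
    and add_r: "\<And>p q q'. p \<in> carrier P \<Longrightarrow> q \<in> carrier Q \<Longrightarrow> q' \<in> carrier Q \<Longrightarrow>
      \<beta> p (q \<oplus>\<^bsub>Q\<^esub> q') = \<beta> p q \<oplus>\<^bsub>S\<^esub> \<beta> p q'"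
    and balanced: "\<And>p r q. p \<in> carrier P \<Longrightarrow> r \<in> carrier S \<Longrightarrow> q \<in> carrier Q \<Longrightarrow>
      \<beta> (p \<triangleleft>\<^bsub>P\<^esub> r) q = \<beta> p (r \<triangleright>\<^bsub>Q\<^esub> q)"
    and left: "\<And>r p q. r \<in> carrier S \<Longrightarrow> p \<in> carrier P \<Longrightarrow> q \<in> carrier Q \<Longrightarrow>
      \<beta> (r \<triangleright>\<^bsub>P\<^esub> p) q = r \<otimes>\<^bsub>S\<^esub> \<beta> p q"
    and right: "\<And>r p q. r \<in> carrier S \<Longrightarrow> p \<in> carrier P \<Longrightarrow> q \<in> carrier Q \<Longrightarrow>
      \<beta> p (q \<triangleleft>\<^bsub>Q\<^esub> r) = \<beta> p q \<otimes>\<^bsub>S\<^esub> r"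
  obtains \<psi> where "ring_system S P Q \<psi>"
    and "\<And>p q. p \<in> carrier P \<Longrightarrow> q \<in> carrier Q \<Longrightarrow> \<psi> (pure_tensor S P Q p q) = \<beta> p q"
proof -
  interpret P: bimodule S P by (rule P)
  interpret Q: bimodule S Q by (rule Q)
  \<comment> \<open>The system with the zero map gives access to the bimodule operations of the tensor product.\<close>
  interpret Z: ring_system S P Q "\<lambda>_. \<zero>\<^bsub>S\<^esub>"
    by (intro ring_system.intro P Q P.S.rng_axioms ring_system_axioms.intro)
       (auto simp: bimodule_hom_def regular_bimodule_def)
  let ?FA = "free_Abelian_group (carrier P \<times> carrier Q)"
  obtain h where h: "h \<in> hom ?FA (add_monoid S)"
    and h_of: "\<And>x. x \<in> carrier P \<times> carrier Q \<Longrightarrow> h (frag_of x) = (\<lambda>(p, q). \<beta> p q) x"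
    by (rule comm_group.free_Abelian_group_universal[OF P.S.a_comm_group, of "\<lambda>(p, q). \<beta> p q" "carrier P \<times> carrier Q"])
       (use closed in auto)
  interpret h: group_hom ?FA "add_monoid S" h
    using h P.S.a_group by (intro group_hom.intro group_hom_axioms.intro) auto
  have h_cl: "h x \<in> carrier S" if "Poly_Mapping.keys x \<subseteq> carrier P \<times> carrier Q" for x
    using h.hom_closed[of x] that by simp
  have h_add: "h (x + y) = h x \<oplus>\<^bsub>S\<^esub> h y"
    if "Poly_Mapping.keys x \<subseteq> carrier P \<times> carrier Q" "Poly_Mapping.keys y \<subseteq> carrier P \<times> carrier Q" for x y
    using h.hom_mult[of x y] that by simp
  have h_zero: "h 0 = \<zero>\<^bsub>S\<^esub>" using h.hom_one by simp
  have h_minus: "h (- x) = \<ominus>\<^bsub>S\<^esub> h x" if "Poly_Mapping.keys x \<subseteq> carrier P \<times> carrier Q" for x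
    using h.hom_inv[of x] that by (simp add: a_inv_def)
  have h_diff: "h (x - y) = h x \<ominus>\<^bsub>S\<^esub> h y"
    if "Poly_Mapping.keys x \<subseteq> carrier P \<times> carrier Q" "Poly_Mapping.keys y \<subseteq> carrier P \<times> carrier Q" for x y
    using h_add[of x "- y"] h_minus[of y] that by (simp add: a_minus_def)
  have keys2: "Poly_Mapping.keys (frag_of x + frag_of y) \<subseteq> carrier P \<times> carrier Q"
    if "x \<in> carrier P \<times> carrier Q" "y \<in> carrier P \<times> carrier Q" for x y
    using that by (intro subset_trans[OF keys_add]) auto
  have h_rel: "h x = \<zero>\<^bsub>S\<^esub>" if "x \<in> tensor_rel S P Q" for x
    using that
  proof cases
    case (add_l p p' q)
    then show ?thesis using keys2
      by (simp add: h_diff h_add h_of assms(4) closed P.S.r_neg a_minus_def)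
  next
    case (add_r p q q')
    then show ?thesis using keys2
      by (simp add: h_diff h_add h_of assms(5) closed P.S.r_neg a_minus_def)
  next
    case (balanced p r q)
    then show ?thesis
      by (simp add: h_diff h_of assms(6) closed P.S.r_neg a_minus_def P.ract_closed Q.lact_closed)
  qed
  have h_null: "h x = \<zero>\<^bsub>S\<^esub>" if "x \<in> tensor_null S P Q" for x
  proof -
    have "subgroup (kernel ?FA (add_monoid S) h) ?FA" by (rule h.subgroup_kernel)
    moreover have "tensor_rel S P Q \<subseteq> kernel ?FA (add_monoid S) h"
      using h_rel Z.tensor_rel_closed by (auto simp: kernel_def)
    ultimately have "tensor_null S P Q \<subseteq> kernel ?FA (add_monoid S) h"
      unfolding tensor_null_def by (intro group.generate_subgroup_incl[OF group_free_Abelian_group])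
    then show ?thesis using that by (auto simp: kernel_def)
  qed
  define \<psi> where "\<psi> X = the_elem (h ` X)" for X
  have psi: "\<psi> (tensor_class S P Q x) = h x" if x: "Poly_Mapping.keys x \<subseteq> carrier P \<times> carrier Q" for x
  proof -
    have "h y = h x" if "y \<in> tensor_class S P Q x" for y
    proof -
      from that obtain n where n: "n \<in> tensor_null S P Q" "y = n + x"
        by (auto simp: tensor_class_def r_coset_def)
      then have "Poly_Mapping.keys n \<subseteq> carrier P \<times> carrier Q"
        using subgroup.mem_carrier[OF Z.tensor_null_subgroup n(1)] by simp
      then show ?thesis using n x h_cl[OF x] by (simp add: h_add h_null)
    qed
    moreover have "x \<in> tensor_class S P Q x"
      using group.rcos_self[OF group_free_Abelian_group _ Z.tensor_null_subgroup] x by (simp add: tensor_class_def)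
    ultimately have "h ` tensor_class S P Q x = {h x}" by blast
    then show ?thesis by (simp add: \<psi>_def)
  qed
  have obt: "\<exists>x. Poly_Mapping.keys x \<subseteq> carrier P \<times> carrier Q \<and> t = tensor_class S P Q x"
    if "t \<in> carrier (tensor S P Q)" for t
  proof -
    have "t \<in> carrier (?FA Mod tensor_null S P Q)" using that by (simp add: tensor_def Let_def)
    then obtain x where "x \<in> carrier ?FA" "t = tensor_null S P Q #>\<^bsub>?FA\<^esub> x"
      by (auto simp: FactGroup_def RCOSETS_def)
    then show ?thesis by (intro exI[of _ x]) (simp add: tensor_class_def)
  qed
  have act: "h (frag_extend (\<lambda>k. frag_of (f k)) x) = g (h x)"
    if f: "f \<in> carrier P \<times> carrier Q \<rightarrow> carrier P \<times> carrier Q"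
      and g: "\<And>a b. a \<in> carrier S \<Longrightarrow> b \<in> carrier S \<Longrightarrow> g (a \<ominus>\<^bsub>S\<^esub> b) = g a \<ominus>\<^bsub>S\<^esub> g b"
        "g \<zero>\<^bsub>S\<^esub> = \<zero>\<^bsub>S\<^esub>"
      and e: "\<And>k. k \<in> carrier P \<times> carrier Q \<Longrightarrow> h (frag_of (f k)) = g (h (frag_of k))"
      and x: "Poly_Mapping.keys x \<subseteq> carrier P \<times> carrier Q" for f g x
  proof -
    have "Poly_Mapping.keys x \<subseteq> carrier P \<times> carrier Q \<and> h (frag_extend (\<lambda>k. frag_of (f k)) x) = g (h x)"
      using x
    proof (induction rule: frag_induction)
      case zero
      then show ?case by (simp add: h_zero g)
    next
      case (one k)
      then show ?case using e by simp
    next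
      case (diff a b)
      then show ?case
        using Z.frag_extend_closed[OF f] h_cl keys_diff[of a b]
        by (auto simp: frag_extend_diff h_diff g)
    qed
    then show ?thesis by simp
  qed
  have actl: "h (frag_extend (\<lambda>(p, q). frag_of (r \<triangleright>\<^bsub>P\<^esub> p, q)) x) = r \<otimes>\<^bsub>S\<^esub> h x"
    if r: "r \<in> carrier S" and x: "Poly_Mapping.keys x \<subseteq> carrier P \<times> carrier Q" for r x
  proof -
    have "(\<lambda>(p, q). (r \<triangleright>\<^bsub>P\<^esub> p, q)) \<in> carrier P \<times> carrier Q \<rightarrow> carrier P \<times> carrier Q"
      using r P.lact_closed by auto
    from act[OF this, of "\<lambda>a. r \<otimes>\<^bsub>S\<^esub> a" x] show ?thesis using r x
      by (auto simp: h_of left P.lact_closed P.S.r_distr P.S.r_minus a_minus_def case_prod_unfold)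
  qed
  have actr: "h (frag_extend (\<lambda>(p, q). frag_of (p, q \<triangleleft>\<^bsub>Q\<^esub> r)) x) = h x \<otimes>\<^bsub>S\<^esub> r"
    if r: "r \<in> carrier S" and x: "Poly_Mapping.keys x \<subseteq> carrier P \<times> carrier Q" for r x
  proof -
    have "(\<lambda>(p, q). (p, q \<triangleleft>\<^bsub>Q\<^esub> r)) \<in> carrier P \<times> carrier Q \<rightarrow> carrier P \<times> carrier Q"
      using r Q.ract_closed by auto
    from act[OF this, of "\<lambda>a. a \<otimes>\<^bsub>S\<^esub> r" x] show ?thesis using r x
      by (auto simp: h_of right Q.ract_closed P.S.l_distr P.S.l_minus a_minus_def case_prod_unfold)
  qed
  have kl: "Poly_Mapping.keys (frag_extend (\<lambda>(p, q). frag_of (r \<triangleright>\<^bsub>P\<^esub> p, q)) x) \<subseteq> carrier P \<times> carrier Q"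
    if "r \<in> carrier S" "Poly_Mapping.keys x \<subseteq> carrier P \<times> carrier Q" for r x
  proof -
    have "(\<lambda>(p, q). (r \<triangleright>\<^bsub>P\<^esub> p, q)) \<in> carrier P \<times> carrier Q \<rightarrow> carrier P \<times> carrier Q"
      using that(1) P.lact_closed by auto
    from Z.frag_extend_closed[OF this that(2)] show ?thesis by (simp add: case_prod_unfold)
  qed
  have kr: "Poly_Mapping.keys (frag_extend (\<lambda>(p, q). frag_of (p, q \<triangleleft>\<^bsub>Q\<^esub> r)) x) \<subseteq> carrier P \<times> carrier Q"
    if "r \<in> carrier S" "Poly_Mapping.keys x \<subseteq> carrier P \<times> carrier Q" for r x
  proof -
    have "(\<lambda>(p, q). (p, q \<triangleleft>\<^bsub>Q\<^esub> r)) \<in> carrier P \<times> carrier Q \<rightarrow> carrier P \<times> carrier Q"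
      using that(1) Q.ract_closed by auto
    from Z.frag_extend_closed[OF this that(2)] show ?thesis by (simp add: case_prod_unfold)
  qed
  have "\<psi> \<in> bimodule_hom S (tensor S P Q) (regular_bimodule S)"
    unfolding bimodule_hom_def
  proof (intro CollectI conjI ballI Pi_I)
    fix t u r assume "t \<in> carrier (tensor S P Q)"
    then obtain x where x: "Poly_Mapping.keys x \<subseteq> carrier P \<times> carrier Q" "t = tensor_class S P Q x"
      using obt by blast
    show "\<psi> t \<in> carrier (regular_bimodule S)"
      using x h_cl by (simp add: psi regular_bimodule_def)
    show "\<psi> (t \<oplus>\<^bsub>tensor S P Q\<^esub> u) = \<psi> t \<oplus>\<^bsub>regular_bimodule S\<^esub> \<psi> u" if u: "u \<in> carrier (tensor S P Q)"
    proof -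
      obtain y where y: "Poly_Mapping.keys y \<subseteq> carrier P \<times> carrier Q" "u = tensor_class S P Q y"
        using obt[OF u] by blast
      then have "Poly_Mapping.keys (x + y) \<subseteq> carrier P \<times> carrier Q"
        using x keys_add[of x y] by blast
      then show ?thesis using x y
        by (simp add: Z.tensor_add psi h_add regular_bimodule_def)
    qed
    show "\<psi> (r \<triangleright>\<^bsub>tensor S P Q\<^esub> t) = r \<triangleright>\<^bsub>regular_bimodule S\<^esub> \<psi> t" if "r \<in> carrier S"
      using that x kl by (simp add: Z.tensor_lact psi actl regular_bimodule_def)
    show "\<psi> (t \<triangleleft>\<^bsub>tensor S P Q\<^esub> r) = \<psi> t \<triangleleft>\<^bsub>regular_bimodule S\<^esub> r" if "r \<in> carrier S"
      using that x kr by (simp add: Z.tensor_ract psi actr regular_bimodule_def)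
  qed
  then have "ring_system S P Q \<psi>"
    by (intro ring_system.intro P Q P.S.rng_axioms ring_system_axioms.intro)
  moreover have "\<psi> (pure_tensor S P Q p q) = \<beta> p q" if "p \<in> carrier P" "q \<in> carrier Q" for p q
    using that by (simp add: psi h_of)
  ultimately show ?thesis by (rule that)
qed


section \<open>Graded rings as Cuntz--Pimsner rings\<close>

lemma (in abelian_group) eq_if_minus_zero:
  assumes "x \<in> carrier G" "y \<in> carrier G" "x \<ominus> y = \<zero>" shows "x = y"
proof -
  have "x = (x \<ominus> y) \<oplus> y" using assms(1,2) by (simp add: a_minus_def a_assoc l_neg)
  then show ?thesis using assms by simp
qed

text \<open>
  The additive span of the products \<open>u v\<close> with \<open>u \<in> U\<close> and \<open>v \<in> V\<close>, encoded as a generated subgroup.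
\<close>

definition span_prod :: "('a, 'm) ring_scheme \<Rightarrow> 'a set \<Rightarrow> 'a set \<Rightarrow> 'a set" where
  "span_prod R U V = generate (add_monoid R) {u \<otimes>\<^bsub>R\<^esub> v | u v. u \<in> U \<and> v \<in> V}"

lemma (in rng) span_prod_subgroup:
  assumes "U \<subseteq> carrier R" "V \<subseteq> carrier R" shows "additive_subgroup (span_prod R U V) R"
  unfolding span_prod_def using assms
  by (intro additive_subgroup.intro add.generate_is_subgroup) auto

lemma (in rng) span_prod_mem: "u \<in> U \<Longrightarrow> v \<in> V \<Longrightarrow> u \<otimes> v \<in> span_prod R U V"
  unfolding span_prod_def by (rule generate.incl) blast

lemma (in rng) span_prod_induct [consumes 3, case_names zero prod add]:
  assumes U: "additive_subgroup U R" and V: "additive_subgroup V R" and x: "x \<in> span_prod R U V"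
    and z: "P \<zero>" and p: "\<And>u v. u \<in> U \<Longrightarrow> v \<in> V \<Longrightarrow> P (u \<otimes> v)"
    and a: "\<And>x y. x \<in> span_prod R U V \<Longrightarrow> y \<in> span_prod R U V \<Longrightarrow> P x \<Longrightarrow> P y \<Longrightarrow> P (x \<oplus> y)"
  shows "P x"
  using x unfolding span_prod_def
proof induction
  case one
  then show ?case using z by simp
next
  case (incl h)
  then show ?case using p by auto
next
  case (inv h)
  then obtain u v where h: "u \<in> U" "v \<in> V" "h = u \<otimes> v" by auto
  interpret U: additive_subgroup U R by (rule U)
  interpret V: additive_subgroup V R by (rule V)
  have c: "u \<in> carrier R" "v \<in> carrier R" using h U.a_subset V.a_subset by auto
  \<comment> \<open>The set of products is closed under negation, so no separate case for it is needed.\<close>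
  have "inv\<^bsub>add_monoid R\<^esub> h = (\<ominus> u) \<otimes> v"
    using h c by (simp add: l_minus flip: a_inv_def)
  moreover have "\<ominus> u \<in> U" using h(1) U.a_inv_closed by blast
  ultimately show ?case using p h(2) by simp
next
  case (eng h1 h2)
  then show ?case using a by (simp add: span_prod_def)
qed

text \<open>
  A \<open>\<int>\<close>-graded ring \<open>L\<close> with components \<open>A n\<close> that is generated by its components of degree
  \<open>0\<close>, \<open>1\<close> and \<open>-1\<close> in the strong sense of \<open>A_pos\<close> and \<open>A_neg\<close>, and that has local units for
  \<open>A 1\<close> and \<open>A (-1)\<close> in the span of \<open>A 1 A (-1)\<close>.
\<close>

locale semisaturated_graded_rng = rng L for L :: "('a, 'm) ring_scheme" (structure) +
  fixes A :: "int \<Rightarrow> 'a set"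
  assumes A_subgroup: "additive_subgroup (A n) L"
    and A_mult: "\<lbrakk>x \<in> A m; y \<in> A n\<rbrakk> \<Longrightarrow> x \<otimes> y \<in> A (m + n)"
    and A_decomposition:
      "x \<in> carrier L \<Longrightarrow> \<exists>N a. finite N \<and> (\<forall>n. a n \<in> A n) \<and> x = (\<Oplus>n\<in>N. a n)"
    and A_independent:
      "\<lbrakk>finite N; \<And>n. n \<in> N \<Longrightarrow> a n \<in> A n; (\<Oplus>n\<in>N. a n) = \<zero>; m \<in> N\<rbrakk> \<Longrightarrow> a m = \<zero>"
    and A_pos: "n > 0 \<Longrightarrow> A n \<subseteq> span_prod L (A 1) (A (n - 1))"
    and A_neg: "n < 0 \<Longrightarrow> A n \<subseteq> span_prod L (A (n + 1)) (A (- 1))"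
    and local_units: "\<lbrakk>finite F; F \<subseteq> A 1; finite G; G \<subseteq> A (- 1)\<rbrakk> \<Longrightarrow>
      \<exists>e\<in>span_prod L (A 1) (A (- 1)). (\<forall>q\<in>F. e \<otimes> q = q) \<and> (\<forall>p\<in>G. p \<otimes> e = p)"
begin

lemma A_carrier: "x \<in> A n \<Longrightarrow> x \<in> carrier L"
  using additive_subgroup.a_subset[OF A_subgroup] by blast

lemma A_closed: "\<zero> \<in> A n" "x \<in> A n \<Longrightarrow> y \<in> A n \<Longrightarrow> x \<oplus> y \<in> A n" "x \<in> A n \<Longrightarrow> \<ominus> x \<in> A n"
  using additive_subgroup.zero_closed[OF A_subgroup] additive_subgroup.a_closed[OF A_subgroup]
    additive_subgroup.a_inv_closed[OF A_subgroup] by auto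

lemma A_mult_simps:
  "x \<in> A 0 \<Longrightarrow> y \<in> A n \<Longrightarrow> x \<otimes> y \<in> A n"
  "x \<in> A n \<Longrightarrow> y \<in> A 0 \<Longrightarrow> x \<otimes> y \<in> A n"
  "x \<in> A 1 \<Longrightarrow> y \<in> A (- 1) \<Longrightarrow> x \<otimes> y \<in> A 0"
  "x \<in> A (- 1) \<Longrightarrow> y \<in> A 1 \<Longrightarrow> x \<otimes> y \<in> A 0"
  using A_mult[of x 0 y n] A_mult[of x n y 0] A_mult[of x 1 y "-1"] A_mult[of x "-1" y 1] by auto

abbreviation "S \<equiv> L\<lparr>carrier := A 0\<rparr>"

text \<open>
  The component of degree \<open>n\<close> as a bimodule over the component of degree \<open>0\<close>.
\<close>

definition comp_bimodule :: "int \<Rightarrow> ('a, 'a) bimodule" where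
  "comp_bimodule n = \<lparr>carrier = A n, mult = mult L, one = \<one>, ring.zero = \<zero>, add = add L,
     lact = mult L, ract = mult L\<rparr>"

abbreviation "Q \<equiv> comp_bimodule 1"
abbreviation "P \<equiv> comp_bimodule (- 1)"

lemma comp_bimodule_simps [simp]:
  "carrier (comp_bimodule n) = A n" "\<zero>\<^bsub>comp_bimodule n\<^esub> = \<zero>"
  "x \<oplus>\<^bsub>comp_bimodule n\<^esub> y = x \<oplus> y"
  "r \<triangleright>\<^bsub>comp_bimodule n\<^esub> x = r \<otimes> x" "x \<triangleleft>\<^bsub>comp_bimodule n\<^esub> r = x \<otimes> r"
  by (simp_all add: comp_bimodule_def)

lemma rng_S: "rng S"
proof (intro rng.intro abelian_groupI rng_axioms.intro)
  show "\<exists>y\<in>carrier S. y \<oplus>\<^bsub>S\<^esub> x = \<zero>\<^bsub>S\<^esub>" if "x \<in> carrier S" for x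
    using that by (intro bexI[of _ "\<ominus> x"]) (auto simp: A_carrier A_closed l_neg)
qed (auto simp: A_carrier A_closed A_mult_simps a_ac m_assoc l_distr r_distr)

lemma bimodule_comp: "bimodule S (comp_bimodule n)"
proof (intro bimodule.intro rng_S bimodule_axioms.intro abelian_groupI)
  show "\<exists>y\<in>carrier (comp_bimodule n). y \<oplus>\<^bsub>comp_bimodule n\<^esub> x = \<zero>\<^bsub>comp_bimodule n\<^esub>"
    if "x \<in> carrier (comp_bimodule n)" for x
    using that by (intro bexI[of _ "\<ominus> x"]) (auto simp: A_carrier A_closed l_neg)
qed (auto simp: A_carrier A_closed A_mult_simps a_ac m_assoc l_distr r_distr)

text \<open>
  The map \<open>P \<otimes>\<^sub>S Q \<rightarrow> S\<close> induced by the multiplication of \<open>L\<close>.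
\<close>

definition \<psi> :: "('a \<times> 'a \<Rightarrow>\<^sub>0 int) set \<Rightarrow> 'a" where
  "\<psi> = (SOME \<psi>. ring_system S P Q \<psi> \<and>
     (\<forall>p\<in>A (- 1). \<forall>q\<in>A 1. \<psi> (pure_tensor S P Q p q) = p \<otimes> q))"

lemma psi_spec: "ring_system S P Q \<psi> \<and>
     (\<forall>p\<in>A (- 1). \<forall>q\<in>A 1. \<psi> (pure_tensor S P Q p q) = p \<otimes> q)"
proof -
  obtain \<psi>' where "ring_system S P Q \<psi>'"
    "\<And>p q. p \<in> carrier P \<Longrightarrow> q \<in> carrier Q \<Longrightarrow> \<psi>' (pure_tensor S P Q p q) = p \<otimes> q"
    by (rule balanced_map_ring_system[OF bimodule_comp bimodule_comp, of "- 1" 1 "\<lambda>p q. p \<otimes> q"])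
       (auto simp: A_mult_simps A_carrier l_distr r_distr m_assoc)
  then have "\<exists>\<psi>. ring_system S P Q \<psi> \<and>
     (\<forall>p\<in>A (- 1). \<forall>q\<in>A 1. \<psi> (pure_tensor S P Q p q) = p \<otimes> q)" by auto
  then show ?thesis unfolding \<psi>_def by (rule someI_ex)
qed

sublocale sys: ring_system S P Q \<psi>
  using psi_spec by blast

lemma psi_pure: "p \<in> A (- 1) \<Longrightarrow> q \<in> A 1 \<Longrightarrow> \<psi> (pure_tensor S P Q p q) = p \<otimes> q"
  using psi_spec by blast

text \<open>
  The ideal of \<open>S\<close> that turns out to be the greatest faithful \<open>\<psi>\<close>-compatible one.
\<close>

definition K :: "'a set" where
  "K = span_prod L (A 1) (A (- 1))"

lemmas K_induct [consumes 1, case_names zero prod add] =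
  span_prod_induct[OF A_subgroup A_subgroup, of _ 1 "- 1", folded K_def]

lemma K_A0: "x \<in> K \<Longrightarrow> x \<in> A 0"
  by (induction rule: K_induct) (auto intro: A_closed A_mult_simps)

lemma K_carrier: "x \<in> K \<Longrightarrow> x \<in> carrier L"
  using K_A0 A_carrier by blast

lemma K_subgroup: "additive_subgroup K L"
  unfolding K_def span_prod_def
  by (intro additive_subgroup.intro add.generate_is_subgroup) (auto intro: A_carrier)

lemma K_prod: "q \<in> A 1 \<Longrightarrow> p \<in> A (- 1) \<Longrightarrow> q \<otimes> p \<in> K"
  unfolding K_def span_prod_def by (rule generate.incl) blast

lemma K_closed: "\<zero> \<in> K" "x \<in> K \<Longrightarrow> y \<in> K \<Longrightarrow> x \<oplus> y \<in> K" "x \<in> K \<Longrightarrow> \<ominus> x \<in> K"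
  using additive_subgroup.zero_closed[OF K_subgroup] additive_subgroup.a_closed[OF K_subgroup]
    additive_subgroup.a_inv_closed[OF K_subgroup] by auto

lemma S_additive_subgroup: "additive_subgroup H S \<longleftrightarrow> H \<subseteq> A 0 \<and> additive_subgroup H L"
proof -
  have e: "add_monoid S = (add_monoid L)\<lparr>carrier := A 0\<rparr>" by simp
  have A0: "subgroup (A 0) (add_monoid L)" using A_subgroup[of 0] by (simp add: additive_subgroup_def)
  show ?thesis
    unfolding additive_subgroup_def e
    using add.incl_subgroup[OF A0, of H] add.subgroup_incl[OF _ A0, of H] subgroup.subset[of H] by fastforce
qed

lemma K_ideal: "rng_ideal K S"
  unfolding rng_ideal_def S_additive_subgroup
proof (intro conjI ballI)
  show "r \<otimes>\<^bsub>S\<^esub> x \<in> K" if "x \<in> K" "r \<in> carrier S" for x r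
    using that(1)
  proof (induction rule: K_induct)
    case (prod q p)
    then show ?case using that(2) K_prod[of "r \<otimes> q" p] by (simp add: A_mult_simps A_carrier m_assoc)
  qed (use that(2) in \<open>auto simp: K_closed A_carrier K_carrier r_distr\<close>)
  show "x \<otimes>\<^bsub>S\<^esub> r \<in> K" if "x \<in> K" "r \<in> carrier S" for x r
    using that(1)
  proof (induction rule: K_induct)
    case (prod q p)
    then show ?case using that(2) K_prod[of q "p \<otimes> r"] by (simp add: A_mult_simps A_carrier m_assoc)
  qed (use that(2) in \<open>auto simp: K_closed A_carrier K_carrier l_distr\<close>)
qed (auto simp: K_A0 K_subgroup)

lemma left_mult_hom: "group_hom (add_monoid S) (End_group Q) (left_mult Q)"
  using abelian_group.a_group[OF rng.axioms(1)[OF rng_S]] sys.Q.M.End_group_group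
  by (intro group_hom.intro group_hom_axioms.intro)
     (auto simp: hom_def left_mult_def End_group_def A_mult_simps A_carrier l_distr r_distr A_closed intro!: restrict_ext)

lemma right_mult_hom: "group_hom (add_monoid S) (End_group P) (\<lambda>x. \<lambda>y\<in>A (- 1). y \<otimes> x)"
  using abelian_group.a_group[OF rng.axioms(1)[OF rng_S]] sys.P.M.End_group_group
  by (intro group_hom.intro group_hom_axioms.intro)
     (auto simp: hom_def End_group_def A_mult_simps A_carrier l_distr r_distr A_closed intro!: restrict_ext)

lemma theta_Q_eq: "q \<in> A 1 \<Longrightarrow> p \<in> A (- 1) \<Longrightarrow> theta_Q S P Q \<psi> q p = left_mult Q (q \<otimes> p)"
  unfolding theta_Q_def left_mult_def by (rule ext) (simp add: restrict_def psi_pure m_assoc A_carrier)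

lemma theta_P_eq: "q \<in> A 1 \<Longrightarrow> p \<in> A (- 1) \<Longrightarrow> theta_P S P Q \<psi> p q = (\<lambda>y\<in>A (- 1). y \<otimes> (q \<otimes> p))"
  unfolding theta_P_def by (rule ext) (simp add: restrict_def psi_pure m_assoc A_carrier)

lemma K_generate_S: "K = generate (add_monoid S) {q \<otimes> p | q p. q \<in> A 1 \<and> p \<in> A (- 1)}"
proof -
  have A0: "subgroup (A 0) (add_monoid L)" using A_subgroup[of 0] by (simp add: additive_subgroup_def)
  have "{q \<otimes> p | q p. q \<in> A 1 \<and> p \<in> A (- 1)} \<subseteq> A 0" by (auto intro: A_mult_simps)
  from add.generate_consistent[OF this A0] show ?thesis by (simp add: K_def span_prod_def)
qed

text \<open>
  Since \<open>\<theta>\<^bsub>q,p\<^esub>\<close> is left multiplication by \<open>q p\<close>, the finite rank operators on \<open>Q\<close> are the left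
  multiplications by elements of \<open>K\<close>; dually, those on \<open>P\<close> are the right multiplications.
\<close>

lemma finite_rank_Q_eq: "finite_rank_Q S P Q \<psi> = left_mult Q ` K"
proof -
  have "left_mult Q ` K = generate (End_group Q) (left_mult Q ` {q \<otimes> p | q p. q \<in> A 1 \<and> p \<in> A (- 1)})"
    unfolding K_generate_S by (rule group_hom.generate_img[OF left_mult_hom, symmetric]) (auto intro: A_mult_simps)
  also have "left_mult Q ` {q \<otimes> p | q p. q \<in> A 1 \<and> p \<in> A (- 1)} =
      {theta_Q S P Q \<psi> q p | q p. q \<in> carrier Q \<and> p \<in> carrier P}"
    by (auto simp: theta_Q_eq image_iff) (metis theta_Q_eq)+
  finally show ?thesis unfolding finite_rank_Q_def by (rule sym)
qed

lemma finite_rank_P_eq: "finite_rank_P S P Q \<psi> = (\<lambda>x. \<lambda>y\<in>A (- 1). y \<otimes> x) ` K"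
proof -
  have "(\<lambda>x. \<lambda>y\<in>A (- 1). y \<otimes> x) ` K =
     generate (End_group P) ((\<lambda>x. \<lambda>y\<in>A (- 1). y \<otimes> x) ` {q \<otimes> p | q p. q \<in> A 1 \<and> p \<in> A (- 1)})"
    unfolding K_generate_S by (rule group_hom.generate_img[OF right_mult_hom, symmetric]) (auto intro: A_mult_simps)
  also have "(\<lambda>x. \<lambda>y\<in>A (- 1). y \<otimes> x) ` {q \<otimes> p | q p. q \<in> A 1 \<and> p \<in> A (- 1)} =
      {theta_P S P Q \<psi> p q | p q. p \<in> carrier P \<and> q \<in> carrier Q}"
    by (auto simp: theta_P_eq image_iff) (metis theta_P_eq)+
  finally show ?thesis unfolding finite_rank_P_def by (rule sym)
qed

lemma local_units_K:
  "\<lbrakk>finite F; F \<subseteq> A 1; finite G; G \<subseteq> A (- 1)\<rbrakk> \<Longrightarrow>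
    \<exists>e\<in>K. (\<forall>q\<in>F. e \<otimes> q = q) \<and> (\<forall>p\<in>G. p \<otimes> e = p)"
  using local_units by (simp add: K_def)

lemma FS: "condition_FS S P Q \<psi>"
  unfolding condition_FS_def
proof (intro allI impI, elim conjE)
  fix F G assume "finite F" "F \<subseteq> carrier Q" "finite G" "G \<subseteq> carrier P"
  then obtain e where e: "e \<in> K" "\<forall>q\<in>F. e \<otimes> q = q" "\<forall>p\<in>G. p \<otimes> e = p" "F \<subseteq> A 1" "G \<subseteq> A (- 1)"
    using local_units_K[of F G] by auto
  show "\<exists>\<Theta>\<in>finite_rank_Q S P Q \<psi>. \<exists>\<Phi>\<in>finite_rank_P S P Q \<psi>. (\<forall>q\<in>F. \<Theta> q = q) \<and> (\<forall>p\<in>G. \<Phi> p = p)"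
    unfolding finite_rank_Q_eq finite_rank_P_eq
    using e by (intro bexI[of _ "left_mult Q e"] bexI[of _ "\<lambda>y\<in>A (- 1). y \<otimes> e"] imageI)
      (auto simp: left_mult_def subset_iff)
qed

lemma left_mult_zero_iff: "left_mult Q r = \<one>\<^bsub>End_group Q\<^esub> \<longleftrightarrow> (\<forall>q\<in>A 1. r \<otimes> q = \<zero>)"
proof
  assume z: "left_mult Q r = \<one>\<^bsub>End_group Q\<^esub>"
  show "\<forall>q\<in>A 1. r \<otimes> q = \<zero>"
  proof
    fix q assume "q \<in> A 1"
    then show "r \<otimes> q = \<zero>" using fun_cong[OF z, of q] by (simp add: left_mult_def)
  qed
qed (auto simp: left_mult_def intro!: restrict_ext)

lemma K_right_unit: "x \<in> K \<Longrightarrow> \<exists>G. finite G \<and> G \<subseteq> A (- 1) \<and>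
    (\<forall>e\<in>A 0. (\<forall>p\<in>G. p \<otimes> e = p) \<longrightarrow> x \<otimes> e = x)"
proof (induction rule: K_induct)
  case zero
  show ?case by (intro exI[of _ "{}"]) (auto simp: A_carrier)
next
  case (prod q p)
  then show ?case by (intro exI[of _ "{p}"]) (auto simp: A_carrier m_assoc)
next
  case (add x y)
  then obtain G G' where "finite G" "G \<subseteq> A (- 1)" "\<forall>e\<in>A 0. (\<forall>p\<in>G. p \<otimes> e = p) \<longrightarrow> x \<otimes> e = x"
    "finite G'" "G' \<subseteq> A (- 1)" "\<forall>e\<in>A 0. (\<forall>p\<in>G'. p \<otimes> e = p) \<longrightarrow> y \<otimes> e = y" by metis
  then show ?case using add(1,2)
    by (intro exI[of _ "G \<union> G'"]) (auto simp: A_carrier K_carrier l_distr)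
qed

lemma K_right_unit_obtain:
  assumes "x \<in> K" obtains e where "e \<in> K" "x \<otimes> e = x"
proof -
  obtain G where "finite G" "G \<subseteq> A (- 1)" "\<forall>e\<in>A 0. (\<forall>p\<in>G. p \<otimes> e = p) \<longrightarrow> x \<otimes> e = x"
    using K_right_unit[OF assms] by blast
  then show ?thesis using local_units_K[of "{}" G] K_A0 that by (metis empty_subsetI finite.emptyI)
qed

lemma annihilates_K:
  assumes r: "r \<in> A 0" and q: "\<forall>q\<in>A 1. r \<otimes> q = \<zero>" and x: "x \<in> K"
  shows "r \<otimes> x = \<zero>"
  using x
proof (induction rule: K_induct)
  case (prod u v)
  then have "r \<otimes> (u \<otimes> v) = (r \<otimes> u) \<otimes> v" using r by (simp add: A_carrier m_assoc)
  then show ?case using prod q by (simp add: A_carrier)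
qed (use r in \<open>auto simp: A_carrier K_carrier r_distr\<close>)

lemma K_greatest: "greatest_faithful_compatible S P Q \<psi> K"
  unfolding greatest_faithful_compatible_def
proof (intro conjI allI impI)
  show "rng_ideal K S" by (rule K_ideal)
  show "psi_compatible S P Q \<psi> K" by (simp add: psi_compatible_def finite_rank_Q_eq)
  have "x = \<zero>" if x: "x \<in> K" "\<forall>q\<in>A 1. x \<otimes> q = \<zero>" for x
  proof -
    obtain e where "e \<in> K" "x \<otimes> e = x" using K_right_unit_obtain[OF x(1)] by blast
    then show ?thesis using annihilates_K[OF K_A0[OF x(1)] x(2), of e] by simp
  qed
  then show "faithful_ideal S Q K"
    unfolding faithful_ideal_def left_mult_zero_iff using K_closed(1) A_closed(1) A_carrier by auto
next
  fix K' assume K': "rng_ideal K' S \<and> psi_compatible S P Q \<psi> K' \<and> faithful_ideal S Q K'"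
  then interpret K': additive_subgroup K' L
    using S_additive_subgroup by (auto simp: rng_ideal_def)
  show "K' \<subseteq> K"
  proof
    fix x assume x: "x \<in> K'"
    have xA: "x \<in> A 0" using x K' S_additive_subgroup[of K'] by (auto simp: rng_ideal_def)
    have "left_mult Q x \<in> left_mult Q ` K"
      using x K' by (auto simp: psi_compatible_def finite_rank_Q_eq)
    then obtain y where y: "y \<in> K" "left_mult Q x = left_mult Q y" by blast
    have yA: "y \<in> A 0" using y(1) by (rule K_A0)
    have "x \<otimes> q = y \<otimes> q" if "q \<in> A 1" for q
      using fun_cong[OF y(2), of q] that by (simp add: left_mult_def)
    then have d: "\<forall>q\<in>A 1. (x \<ominus> y) \<otimes> q = \<zero>"
      using xA yA by (simp add: A_carrier a_minus_def l_distr l_minus r_neg)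
    have dA: "x \<ominus> y \<in> A 0" using xA yA by (simp add: a_minus_def A_closed)
    obtain e where e: "e \<in> K" "y \<otimes> e = y" using K_right_unit_obtain[OF y(1)] by blast
    have eA: "e \<in> A 0" using e(1) by (rule K_A0)
    \<comment> \<open>As \<open>y e = y\<close>, this forces \<open>y = x e\<close>, so that \<open>y\<close> belongs to the ideal \<open>K'\<close>.\<close>
    have "(x \<ominus> y) \<otimes> e = \<zero>" by (rule annihilates_K[OF dA d e(1)])
    then have "x \<otimes> e \<ominus> y = \<zero>"
      using xA yA eA e(2) by (simp add: a_minus_def l_distr l_minus A_carrier)
    then have "x \<otimes> e = y"
      by (rule eq_if_minus_zero[OF m_closed[OF A_carrier[OF xA] A_carrier[OF eA]] A_carrier[OF yA]])
    moreover have "x \<otimes>\<^bsub>S\<^esub> e \<in> K'"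
      using K' x eA unfolding rng_ideal_def by simp
    ultimately have "y \<in> K'" by simp
    then have "x \<ominus> y \<in> K'" unfolding a_minus_def by (intro K'.a_closed K'.a_inv_closed x)
    then have "x \<ominus> y \<in> K' \<inter> {r \<in> carrier S. left_mult Q r = \<one>\<^bsub>End_group Q\<^esub>}"
      unfolding left_mult_zero_iff using d dA by simp
    moreover have "K' \<inter> {r \<in> carrier S. left_mult Q r = \<one>\<^bsub>End_group Q\<^esub>} = {\<zero>}"
      using K' unfolding faithful_ideal_def by simp
    ultimately have "x \<ominus> y = \<zero>" by blast
    then have "x = y" by (rule eq_if_minus_zero[OF A_carrier[OF xA] A_carrier[OF yA]])
    then show "x \<in> K" using y(1) by simp
  qed
qed

end


section \<open>Words in the Cuntz--Pimsner ring and the isomorphism\<close>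

lemma additive_subgroup_int_smult:
  fixes A :: "(int, 'a, 'm) module_scheme" (structure)
  assumes A: "nonunital_algebra A" and H: "additive_subgroup H A" and x: "x \<in> H"
  shows "k \<odot> x \<in> H"
proof -
  interpret nonunital_algebra A by (rule A)
  interpret H: additive_subgroup H A by (rule H)
  have xc: "x \<in> carrier A" using x H.a_subset by blast
  show ?thesis
  proof (induction k rule: int_induct[of _ 0])
    case base
    show ?case using xc by (simp add: zero_smult H.zero_closed)
  next
    case (step1 i)
    then show ?case using xc x H.a_closed by (simp add: smult_l_distr)
  next
    case (step2 i)
    have "(i - 1) \<odot> x = i \<odot> x \<oplus> \<ominus> x"
      using smult_l_distr[OF xc, of i "- 1"] smult_minus_one[OF xc] by simp
    then show ?case using step2 x H.a_closed H.a_inv_closed by simp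
  qed
qed

context semisaturated_graded_rng
begin

lemma id_covariant: "covariant_representation S P Q \<psi> L (\<lambda>x. x) (\<lambda>x. x) (\<lambda>x. x)"
  by (intro covariant_representation.intro sys.ring_system_axioms rng_axioms covariant_representation_axioms.intro)
     (auto simp: rng_hom_def A_carrier psi_pure)

lemma K_sub: "K \<subseteq> carrier S"
  using K_A0 by auto

abbreviation "C \<equiv> cp_ring S P Q \<psi> K"

sublocale C: presentation "cp_gens S P Q" "cp_rel S P Q \<psi> K"
  rewrites "presented_alg (cp_gens S P Q) (cp_rel S P Q \<psi> K) = C"
  by (rule presentation.intro[OF sys.cp_rel_closed[OF K_sub]]) (simp add: cp_ring_def)

abbreviation "C_comp \<equiv> cp_component S P Q \<psi> K"

lemma C_comp_eq: "C_comp = C.hcomp cp_deg"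
  by (simp add: cp_component_def)

text \<open>
  The images of the generators in the Cuntz--Pimsner ring.
\<close>

definition "sg = (\<lambda>r. C.cls (gen (Sig r)))"
definition "tp = (\<lambda>p. C.cls (gen (TP p)))"
definition "tq = (\<lambda>q. C.cls (gen (TQ q)))"

lemma cls_gen: "C.cls (gen (Sig r)) = sg r" "C.cls (gen (TP p)) = tp p" "C.cls (gen (TQ q)) = tq q"
  by (simp_all add: sg_def tp_def tq_def)

lemma cp_gens_iff: "x \<in> cp_gens S P Q \<longleftrightarrow>
    (\<exists>r\<in>A 0. x = Sig r) \<or> (\<exists>p\<in>A (- 1). x = TP p) \<or> (\<exists>q\<in>A 1. x = TQ q)"
  by (auto simp: cp_gens_def)

lemma C_comp_closed: "x \<in> C_comp n \<Longrightarrow> x \<in> carrier C"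
  unfolding C_comp_eq by (rule C.hcomp_closed)

interpretation cov: covariant_representation S P Q \<psi> C sg tp tq
  unfolding sg_def tp_def tq_def by (rule sys.cp_ring_covariant[OF K_sub])

lemma C_closed [simp]:
  "r \<in> A 0 \<Longrightarrow> sg r \<in> carrier C" "p \<in> A (- 1) \<Longrightarrow> tp p \<in> carrier C" "q \<in> A 1 \<Longrightarrow> tq q \<in> carrier C"
  using cov.sigma(1) cov.TP_c cov.TQ_c by auto

lemma C_mult:
  "r \<in> A 0 \<Longrightarrow> t \<in> A 0 \<Longrightarrow> sg r \<otimes>\<^bsub>C\<^esub> sg t = sg (r \<otimes> t)"
  "r \<in> A 0 \<Longrightarrow> p \<in> A (- 1) \<Longrightarrow> sg r \<otimes>\<^bsub>C\<^esub> tp p = tp (r \<otimes> p)"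
  "r \<in> A 0 \<Longrightarrow> p \<in> A (- 1) \<Longrightarrow> tp p \<otimes>\<^bsub>C\<^esub> sg r = tp (p \<otimes> r)"
  "r \<in> A 0 \<Longrightarrow> q \<in> A 1 \<Longrightarrow> sg r \<otimes>\<^bsub>C\<^esub> tq q = tq (r \<otimes> q)"
  "r \<in> A 0 \<Longrightarrow> q \<in> A 1 \<Longrightarrow> tq q \<otimes>\<^bsub>C\<^esub> sg r = tq (q \<otimes> r)"
  "p \<in> A (- 1) \<Longrightarrow> q \<in> A 1 \<Longrightarrow> tp p \<otimes>\<^bsub>C\<^esub> tq q = sg (p \<otimes> q)"
  using cov.sigma(3)[of r t] cov.TP_lact[of r p] cov.TP_ract[of r p] cov.TQ_lact[of r q] cov.TQ_ract[of r q]
    cov.sigma_psi[of p q] by (auto simp: psi_pure)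

text \<open>
  This is the covariance relation of \<open>K\<close>, read off on the element \<open>q p\<close>.
\<close>

lemma tq_tp: 
  assumes "q \<in> A 1" "p \<in> A (- 1)"
  shows "tq q \<otimes>\<^bsub>C\<^esub> tp p = sg (q \<otimes> p)"
proof -
  have T: "tp \<in> carrier P \<rightarrow> carrier C" "tq \<in> carrier Q \<rightarrow> carrier C" by auto
  have "cov.induced_pi (left_mult Q (q \<otimes> p)) = sg (q \<otimes> p)"
    unfolding sg_def tp_def tq_def using K_greatest
    by (intro sys.cp_ring_covariant_pi[OF K_sub FS _ K_prod[OF assms]])
      (simp add: greatest_faithful_compatible_def)
  moreover have "cov.induced_pi (left_mult Q (q \<otimes> p)) = tq q \<otimes>\<^bsub>C\<^esub> tp p"
    using sys.pi_graph_theta[OF C.G.rng_axioms T, of q p] assms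
    by (intro cov.induced_pi_eq[OF FS]) (simp add: theta_Q_eq)
  ultimately show ?thesis by simp
qed

lemma sg_add: "r \<in> A 0 \<Longrightarrow> t \<in> A 0 \<Longrightarrow> sg (r \<oplus> t) = sg r \<oplus>\<^bsub>C\<^esub> sg t"
  using cov.sigma(2)[of r t] by simp

lemma sg_zero: "sg \<zero> = \<zero>\<^bsub>C\<^esub>"
  using additive_zero_minus(1)[OF rng.axioms(1)[OF rng_S] C.G.abelian_group_axioms cov.sigma(1,2)] by simp

lemma sg_subgroup: "additive_subgroup (sg ` A 0) C"
proof (intro additive_subgroup.intro C.G.add.subgroupI)
  show "\<ominus>\<^bsub>C\<^esub> a \<in> sg ` A 0" if a: "a \<in> sg ` A 0" for a
  proof -
    obtain r where r: "r \<in> A 0" "a = sg r" using a by blast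
    have "sg (\<ominus> r) \<oplus>\<^bsub>C\<^esub> a = \<zero>\<^bsub>C\<^esub>"
      using r A_carrier[of r 0] A_closed(3)[of r 0] by (simp add: sg_zero l_neg flip: sg_add)
    then have "\<ominus>\<^bsub>C\<^esub> a = sg (\<ominus> r)"
      using r A_closed(3)[of r 0] by (intro C.G.minus_equality) auto
    then show ?thesis using r A_closed(3)[of r 0] by blast
  qed
  show "a \<oplus>\<^bsub>C\<^esub> b \<in> sg ` A 0" if a: "a \<in> sg ` A 0" "b \<in> sg ` A 0" for a b
    using a A_closed(2) by (auto simp flip: sg_add)
qed (use A_closed(1) in auto)

text \<open>
  The normal forms of words in the generators, together with their degree: a single
  \<open>\<sigma>(r)\<close>, or a nonempty product of \<open>T\<^sub>Q\<close>s, or a nonempty product of \<open>T\<^sub>P\<close>s.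
\<close>

inductive reduced :: "int \<Rightarrow> ((('a, 'a, 'a) cp_gen word \<Rightarrow>\<^sub>0 int) set) \<Rightarrow> bool" where
  sg: "r \<in> A 0 \<Longrightarrow> reduced 0 (sg r)"
| tq1: "q \<in> A 1 \<Longrightarrow> reduced 1 (tq q)"
| tq: "\<lbrakk>q \<in> A 1; reduced n y; n > 0\<rbrakk> \<Longrightarrow> reduced (n + 1) (tq q \<otimes>\<^bsub>C\<^esub> y)"
| tp1: "p \<in> A (- 1) \<Longrightarrow> reduced (- 1) (tp p)"
| tp: "\<lbrakk>p \<in> A (- 1); reduced n y; n < 0\<rbrakk> \<Longrightarrow> reduced (n - 1) (tp p \<otimes>\<^bsub>C\<^esub> y)"

lemma reduced_closed: "reduced n y \<Longrightarrow> y \<in> carrier C"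
  by (induction rule: reduced.induct) auto

lemma reduced_sg_mult:
  assumes r: "r \<in> A 0" and y: "reduced n y" shows "reduced n (sg r \<otimes>\<^bsub>C\<^esub> y)"
  using y
proof cases
  case (tq q m z)
  have "sg r \<otimes>\<^bsub>C\<^esub> y = tq (r \<otimes> q) \<otimes>\<^bsub>C\<^esub> z"
    using tq r reduced_closed[OF tq(4)] by (simp add: C_mult flip: C.G.m_assoc)
  then show ?thesis using tq r reduced.tq[of "r \<otimes> q" m z] by (simp add: A_mult_simps)
next
  case (tp p m z)
  have "sg r \<otimes>\<^bsub>C\<^esub> y = tp (r \<otimes> p) \<otimes>\<^bsub>C\<^esub> z"
    using tp r reduced_closed[OF tp(4)] by (simp add: C_mult flip: C.G.m_assoc)
  then show ?thesis using tp r reduced.tp[of "r \<otimes> p" m z] by (simp add: A_mult_simps)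
qed (use r in \<open>auto simp: C_mult A_mult_simps intro: reduced.intros\<close>)

lemma reduced_tq_mult:
  assumes q: "q \<in> A 1" and y: "reduced n y" shows "reduced (n + 1) (tq q \<otimes>\<^bsub>C\<^esub> y)"
  using y
proof cases
  case (sg r)
  then show ?thesis using q reduced.tq1[of "q \<otimes> r"] by (simp add: C_mult A_mult_simps)
next
  case (tp1 p)
  then show ?thesis using q reduced.sg[of "q \<otimes> p"] by (simp add: tq_tp A_mult_simps)
next
  case (tp p m z)
  have "tq q \<otimes>\<^bsub>C\<^esub> y = sg (q \<otimes> p) \<otimes>\<^bsub>C\<^esub> z"
    using tp q reduced_closed[OF tp(4)] by (simp add: tq_tp flip: C.G.m_assoc)
  then show ?thesis using tp q reduced_sg_mult[of "q \<otimes> p" m z] by (simp add: A_mult_simps)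
next
  case tq1
  show ?thesis by (rule reduced.tq[OF q y]) (simp add: tq1)
next
  case tq
  show ?thesis by (rule reduced.tq[OF q y]) (use tq in simp)
qed

lemma reduced_tp_mult:
  assumes p: "p \<in> A (- 1)" and y: "reduced n y" shows "reduced (n - 1) (tp p \<otimes>\<^bsub>C\<^esub> y)"
  using y
proof cases
  case (sg r)
  then show ?thesis using p reduced.tp1[of "p \<otimes> r"] by (simp add: C_mult A_mult_simps)
next
  case (tq1 q)
  then show ?thesis using p reduced.sg[of "p \<otimes> q"] by (simp add: C_mult A_mult_simps)
next
  case (tq q m z)
  have "tp p \<otimes>\<^bsub>C\<^esub> y = sg (p \<otimes> q) \<otimes>\<^bsub>C\<^esub> z"
    using tq p reduced_closed[OF tq(4)] by (simp add: C_mult flip: C.G.m_assoc)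
  then show ?thesis using tq p reduced_sg_mult[of "p \<otimes> q" m z] by (simp add: A_mult_simps)
next
  case tp1
  show ?thesis by (rule reduced.tp[OF p y]) (simp add: tp1)
next
  case tp
  show ?thesis by (rule reduced.tp[OF p y]) (use tp in simp)
qed

lemma reduced_word:
  "ws \<noteq> [] \<Longrightarrow> set ws \<subseteq> cp_gens S P Q \<Longrightarrow>
    reduced (sum_list (map cp_deg ws)) (word_prod C (\<lambda>x. C.cls (gen x)) ws)"
proof (induction ws)
  case (Cons x xs)
  then have x: "x \<in> cp_gens S P Q" by simp
  show ?case
  proof (cases xs)
    case Nil
    then show ?thesis using x
      by (auto simp: cp_gens_iff cls_gen intro: reduced.intros)
  next
    case (Cons z zs)
    then have "reduced (sum_list (map cp_deg xs)) (word_prod C (\<lambda>x. C.cls (gen x)) xs)"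
      using Cons.IH Cons.prems by simp
    from reduced_sg_mult[OF _ this] reduced_tq_mult[OF _ this] reduced_tp_mult[OF _ this]
    show ?thesis using x Cons
      by (auto simp: cp_gens_iff cls_gen algebra_simps)
  qed
qed simp

lemma C_comp_zero:
  assumes "x \<in> C_comp 0" shows "x \<in> sg ` A 0"
  using assms unfolding C_comp_eq
proof (induction rule: C.hcomp_induct)
  case zero
  show ?case by (rule additive_subgroup.zero_closed[OF sg_subgroup])
next
  case (word ws c)
  from reduced_word[OF word(1,2)] word(3)
  have "reduced 0 (word_prod C (\<lambda>x. C.cls (gen x)) ws)" by simp
  then have "word_prod C (\<lambda>x. C.cls (gen x)) ws \<in> sg ` A 0" by cases auto
  then show ?case
    by (rule additive_subgroup_int_smult[OF C.G.nonunital_algebra_axioms sg_subgroup])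
next
  case (add x y)
  then show ?case by (intro additive_subgroup.a_closed[OF sg_subgroup])
qed

lemma reduced_pos:
  "reduced n y \<Longrightarrow> n > 0 \<Longrightarrow> \<exists>q\<in>A 1. \<forall>e\<in>A 0. e \<otimes> q = q \<longrightarrow> sg e \<otimes>\<^bsub>C\<^esub> y = y"
proof (induction rule: reduced.cases)
  case (tq1 q)
  then show ?case by (intro bexI[of _ q]) (auto simp: C_mult)
next
  case (tq q m z)
  then show ?case using reduced_closed[OF tq(4)]
    by (intro bexI[of _ q]) (auto simp: C_mult simp flip: C.G.m_assoc)
qed auto

lemma reduced_neg:
  "reduced n y \<Longrightarrow> n < 0 \<Longrightarrow> \<exists>p\<in>A (- 1). \<forall>e\<in>A 0. p \<otimes> e = p \<longrightarrow> y \<otimes>\<^bsub>C\<^esub> sg e = y"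
proof (induction rule: reduced.induct)
  case (tp1 p)
  then show ?case by (intro bexI[of _ p]) (auto simp: C_mult)
next
  case (tp p m z)
  then obtain p' where "p' \<in> A (- 1)" "\<forall>e\<in>A 0. p' \<otimes> e = p' \<longrightarrow> z \<otimes>\<^bsub>C\<^esub> sg e = z" by auto
  then show ?case using reduced_closed[OF tp(2)] tp(1)
    by (intro bexI[of _ p']) (auto simp: C.G.m_assoc)
qed auto

lemma C_comp_pos:
  assumes x: "x \<in> C_comp n" and n: "n > 0"
  shows "\<exists>F. finite F \<and> F \<subseteq> A 1 \<and> (\<forall>e\<in>A 0. (\<forall>q\<in>F. e \<otimes> q = q) \<longrightarrow> sg e \<otimes>\<^bsub>C\<^esub> x = x)"
  using x unfolding C_comp_eq
proof (induction rule: C.hcomp_induct)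
  case zero
  show ?case by (intro exI[of _ "{}"]) auto
next
  case (word ws c)
  let ?w = "word_prod C (\<lambda>x. C.cls (gen x)) ws"
  obtain q where "q \<in> A 1" "\<forall>e\<in>A 0. e \<otimes> q = q \<longrightarrow> sg e \<otimes>\<^bsub>C\<^esub> ?w = ?w"
    using reduced_pos[OF reduced_word[OF word(1,2)]] word(3) n by auto
  then show ?case using C.word_prod_G_closed[OF word(1,2)]
    by (intro exI[of _ "{q}"]) (auto simp: C.G.smult_mult_r)
next
  case (add x y)
  then obtain F F' where "finite F" "F \<subseteq> A 1" "\<forall>e\<in>A 0. (\<forall>q\<in>F. e \<otimes> q = q) \<longrightarrow> sg e \<otimes>\<^bsub>C\<^esub> x = x"
    "finite F'" "F' \<subseteq> A 1" "\<forall>e\<in>A 0. (\<forall>q\<in>F'. e \<otimes> q = q) \<longrightarrow> sg e \<otimes>\<^bsub>C\<^esub> y = y" by metis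
  then show ?case using C.hcomp_closed[OF add(1)] C.hcomp_closed[OF add(2)]
    by (intro exI[of _ "F \<union> F'"]) (auto simp: C.G.r_distr)
qed

lemma C_comp_neg:
  assumes x: "x \<in> C_comp n" and n: "n < 0"
  shows "\<exists>F. finite F \<and> F \<subseteq> A (- 1) \<and> (\<forall>e\<in>A 0. (\<forall>p\<in>F. p \<otimes> e = p) \<longrightarrow> x \<otimes>\<^bsub>C\<^esub> sg e = x)"
  using x unfolding C_comp_eq
proof (induction rule: C.hcomp_induct)
  case zero
  show ?case by (intro exI[of _ "{}"]) auto
next
  case (word ws c)
  let ?w = "word_prod C (\<lambda>x. C.cls (gen x)) ws"
  obtain p where "p \<in> A (- 1)" "\<forall>e\<in>A 0. p \<otimes> e = p \<longrightarrow> ?w \<otimes>\<^bsub>C\<^esub> sg e = ?w"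
    using reduced_neg[OF reduced_word[OF word(1,2)]] word(3) n by auto
  then show ?case using C.word_prod_G_closed[OF word(1,2)]
    by (intro exI[of _ "{p}"]) (auto simp: C.G.smult_mult_l)
next
  case (add x y)
  then obtain F F' where "finite F" "F \<subseteq> A (- 1)" "\<forall>e\<in>A 0. (\<forall>p\<in>F. p \<otimes> e = p) \<longrightarrow> x \<otimes>\<^bsub>C\<^esub> sg e = x"
    "finite F'" "F' \<subseteq> A (- 1)" "\<forall>e\<in>A 0. (\<forall>p\<in>F'. p \<otimes> e = p) \<longrightarrow> y \<otimes>\<^bsub>C\<^esub> sg e = y" by metis
  then show ?case using C.hcomp_closed[OF add(1)] C.hcomp_closed[OF add(2)]
    by (intro exI[of _ "F \<union> F'"]) (auto simp: C.G.l_distr)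
qed

lemma gen_C_comp:
  "r \<in> A 0 \<Longrightarrow> sg r \<in> C_comp 0" "q \<in> A 1 \<Longrightarrow> tq q \<in> C_comp 1" "p \<in> A (- 1) \<Longrightarrow> tp p \<in> C_comp (- 1)"
  using C.hcomp_gen[of "Sig r" cp_deg] C.hcomp_gen[of "TQ q" cp_deg] C.hcomp_gen[of "TP p" cp_deg]
  by (auto simp: cp_gens_iff cls_gen C_comp_eq)

lemma C_comp_mult: "x \<in> C_comp m \<Longrightarrow> y \<in> C_comp n \<Longrightarrow> x \<otimes>\<^bsub>C\<^esub> y \<in> C_comp (m + n)"
  unfolding C_comp_eq by (rule C.hcomp_mult)

text \<open>
  An element killed by all \<open>T\<^sub>P(p)\<close> on the left, or by all \<open>T\<^sub>Q(q)\<close> on the right, is killed by \<open>\<sigma>(K)\<close>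
  on that side.
\<close>

lemma K_annihilates:
  assumes x: "x \<in> carrier C" and e: "e \<in> K"
  shows "(\<forall>p\<in>A (- 1). tp p \<otimes>\<^bsub>C\<^esub> x = \<zero>\<^bsub>C\<^esub>) \<Longrightarrow> sg e \<otimes>\<^bsub>C\<^esub> x = \<zero>\<^bsub>C\<^esub>"
    and "(\<forall>q\<in>A 1. x \<otimes>\<^bsub>C\<^esub> tq q = \<zero>\<^bsub>C\<^esub>) \<Longrightarrow> x \<otimes>\<^bsub>C\<^esub> sg e = \<zero>\<^bsub>C\<^esub>"
proof -
  show "sg e \<otimes>\<^bsub>C\<^esub> x = \<zero>\<^bsub>C\<^esub>" if "\<forall>p\<in>A (- 1). tp p \<otimes>\<^bsub>C\<^esub> x = \<zero>\<^bsub>C\<^esub>"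
    using e
  proof (induction rule: K_induct)
    case (prod q p)
    then have "sg (q \<otimes> p) \<otimes>\<^bsub>C\<^esub> x = tq q \<otimes>\<^bsub>C\<^esub> (tp p \<otimes>\<^bsub>C\<^esub> x)"
      using x by (simp add: C.G.m_assoc flip: tq_tp)
    then show ?case using that prod by simp
  qed (use x in \<open>auto simp: sg_zero sg_add K_A0 C.G.l_distr\<close>)
  show "x \<otimes>\<^bsub>C\<^esub> sg e = \<zero>\<^bsub>C\<^esub>" if "\<forall>q\<in>A 1. x \<otimes>\<^bsub>C\<^esub> tq q = \<zero>\<^bsub>C\<^esub>"
    using e
  proof (induction rule: K_induct)
    case (prod q p)
    then have "x \<otimes>\<^bsub>C\<^esub> sg (q \<otimes> p) = (x \<otimes>\<^bsub>C\<^esub> tq q) \<otimes>\<^bsub>C\<^esub> tp p"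
      using x by (simp add: C.G.m_assoc flip: tq_tp)
    then show ?case using that prod by simp
  qed (use x in \<open>auto simp: sg_zero sg_add K_A0 C.G.r_distr\<close>)
qed

context
  fixes h
  assumes h: "h \<in> rng_hom C L"
    and h_sg: "\<And>r. r \<in> A 0 \<Longrightarrow> h (sg r) = r"
    and h_tp: "\<And>p. p \<in> A (- 1) \<Longrightarrow> h (tp p) = p"
    and h_tq: "\<And>q. q \<in> A 1 \<Longrightarrow> h (tq q) = q"
begin

lemma h_zero: "h \<zero>\<^bsub>C\<^esub> = \<zero>"
  by (rule additive_zero_minus(1)[OF C.G.abelian_group_axioms abelian_group_axioms rng_homD(1,2)[OF h]])

lemma h_minus: "x \<in> carrier C \<Longrightarrow> h (\<ominus>\<^bsub>C\<^esub> x) = \<ominus> h x"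
  by (rule additive_zero_minus(2)[OF C.G.abelian_group_axioms abelian_group_axioms rng_homD(1,2)[OF h]])

text \<open>
  Multiplication by \<open>T\<^sub>P(p)\<close> lowers the degree, so that injectivity descends to degree \<open>0\<close>, where it is
  clear because \<open>C\<^sub>0 = \<sigma>(A\<^sub>0)\<close>.
\<close>

lemma h_inj_pos: "x \<in> C_comp (int n) \<Longrightarrow> h x = \<zero> \<Longrightarrow> x = \<zero>\<^bsub>C\<^esub>"
proof (induction n arbitrary: x)
  case 0
  then obtain r where "r \<in> A 0" "x = sg r" using C_comp_zero[of x] by auto
  then show ?case using 0 h_sg sg_zero by simp
next
  case (Suc n)
  have xc: "x \<in> carrier C" by (rule C_comp_closed[OF Suc.prems(1)])
  obtain F where F: "finite F" "F \<subseteq> A 1" "\<forall>e\<in>A 0. (\<forall>q\<in>F. e \<otimes> q = q) \<longrightarrow> sg e \<otimes>\<^bsub>C\<^esub> x = x"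
    using C_comp_pos[OF Suc.prems(1)] by auto
  obtain e where e: "e \<in> K" "\<forall>q\<in>F. e \<otimes> q = q" using local_units_K[of F "{}"] F by auto
  have "tp p \<otimes>\<^bsub>C\<^esub> x = \<zero>\<^bsub>C\<^esub>" if p: "p \<in> A (- 1)" for p
  proof (rule Suc.IH)
    show "tp p \<otimes>\<^bsub>C\<^esub> x \<in> C_comp (int n)"
      using C_comp_mult[OF gen_C_comp(3)[OF p] Suc.prems(1)] by simp
    show "h (tp p \<otimes>\<^bsub>C\<^esub> x) = \<zero>" using p xc Suc.prems(2) by (simp add: rng_homD(3)[OF h] h_tp A_carrier)
  qed
  then have "sg e \<otimes>\<^bsub>C\<^esub> x = \<zero>\<^bsub>C\<^esub>" using K_annihilates(1)[OF xc e(1)] by blast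
  then show ?case using F(3) e K_A0 by auto
qed

lemma h_inj_neg: "x \<in> C_comp (- int n) \<Longrightarrow> h x = \<zero> \<Longrightarrow> x = \<zero>\<^bsub>C\<^esub>"
proof (induction n arbitrary: x)
  case 0
  then show ?case using h_inj_pos[of x 0] by simp
next
  case (Suc n)
  have xc: "x \<in> carrier C" by (rule C_comp_closed[OF Suc.prems(1)])
  obtain F where F: "finite F" "F \<subseteq> A (- 1)" "\<forall>e\<in>A 0. (\<forall>p\<in>F. p \<otimes> e = p) \<longrightarrow> x \<otimes>\<^bsub>C\<^esub> sg e = x"
    using C_comp_neg[OF Suc.prems(1)] by auto
  obtain e where e: "e \<in> K" "\<forall>p\<in>F. p \<otimes> e = p" using local_units_K[of "{}" F] F by auto
  have "x \<otimes>\<^bsub>C\<^esub> tq q = \<zero>\<^bsub>C\<^esub>" if q: "q \<in> A 1" for q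
  proof (rule Suc.IH)
    show "x \<otimes>\<^bsub>C\<^esub> tq q \<in> C_comp (- int n)"
      using C_comp_mult[OF Suc.prems(1) gen_C_comp(2)[OF q]] by simp
    show "h (x \<otimes>\<^bsub>C\<^esub> tq q) = \<zero>" using q xc Suc.prems(2) by (simp add: rng_homD(3)[OF h] h_tq A_carrier)
  qed
  then have "x \<otimes>\<^bsub>C\<^esub> sg e = \<zero>\<^bsub>C\<^esub>" using K_annihilates(2)[OF xc e(1)] by blast
  then show ?case using F(3) e K_A0 by auto
qed

lemma h_inj_comp: "x \<in> C_comp n \<Longrightarrow> h x = \<zero> \<Longrightarrow> x = \<zero>\<^bsub>C\<^esub>"
proof (cases "n \<ge> 0")
  case True
  then show "x \<in> C_comp n \<Longrightarrow> h x = \<zero> \<Longrightarrow> x = \<zero>\<^bsub>C\<^esub>"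
    using h_inj_pos[of x "nat n"] by simp
next
  case False
  then show "x \<in> C_comp n \<Longrightarrow> h x = \<zero> \<Longrightarrow> x = \<zero>\<^bsub>C\<^esub>"
    using h_inj_neg[of x "nat (- n)"] by simp
qed

lemma preimage_subgroup: "additive_subgroup {x \<in> carrier C. h x \<in> A n} C"
proof (intro additive_subgroup.intro C.G.add.subgroupI)
  show "{x \<in> carrier C. h x \<in> A n} \<noteq> {}" using h_zero A_closed(1) C.G.zero_closed by auto
  fix x assume x: "x \<in> {x \<in> carrier C. h x \<in> A n}"
  have "h (\<ominus>\<^bsub>C\<^esub> x) \<in> A n" using x by (simp add: h_minus A_closed(3))
  then have "\<ominus>\<^bsub>C\<^esub> x \<in> {x \<in> carrier C. h x \<in> A n}" using x by simp
  then show "\<ominus>\<^bsub>C\<^esub> x \<in> {x \<in> carrier C. h x \<in> A n}" .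
  fix y assume "y \<in> {x \<in> carrier C. h x \<in> A n}"
  then show "x \<oplus>\<^bsub>C\<^esub> y \<in> {x \<in> carrier C. h x \<in> A n}"
    using x by (simp add: rng_homD(2)[OF h] A_closed(2))
qed simp

lemma h_word: "ws \<noteq> [] \<Longrightarrow> set ws \<subseteq> cp_gens S P Q \<Longrightarrow>
    h (word_prod C (\<lambda>x. C.cls (gen x)) ws) \<in> A (sum_list (map cp_deg ws))"
proof (induction ws)
  case (Cons x xs)
  have x: "C.cls (gen x) \<in> carrier C" "h (C.cls (gen x)) \<in> A (cp_deg x)"
    using Cons.prems h_sg h_tp h_tq C_closed
    by (auto simp: cp_gens_iff cls_gen)
  show ?case
  proof (cases xs)
    case Nil
    then show ?thesis using x by simp
  next
    case (Cons z zs)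
    then show ?thesis using x Cons.IH Cons.prems C.word_prod_G_closed[of xs] A_mult
      by (simp add: rng_homD(3)[OF h])
  qed
qed simp

lemma h_comp: "x \<in> C_comp n \<Longrightarrow> h x \<in> A n"
proof -
  assume "x \<in> C_comp n"
  then have "x \<in> {x \<in> carrier C. h x \<in> A n}"
    unfolding C_comp_eq
  proof (induction rule: C.hcomp_induct)
    case zero
    show ?case by (rule additive_subgroup.zero_closed[OF preimage_subgroup])
  next
    case (word ws c)
    then have "word_prod C (\<lambda>x. C.cls (gen x)) ws \<in> {x \<in> carrier C. h x \<in> A n}"
      using C.word_prod_G_closed h_word by auto
    then show ?case
      by (rule additive_subgroup_int_smult[OF C.G.nonunital_algebra_axioms preimage_subgroup])
  next
    case (add x y)
    then show ?case by (intro additive_subgroup.a_closed[OF preimage_subgroup])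
  qed
  then show ?thesis by simp
qed

lemma span_image:
  assumes UV: "additive_subgroup U L" "additive_subgroup V L"
    and x: "x \<in> span_prod L U V"
    and U: "U \<subseteq> h ` C_comp m" and V: "V \<subseteq> h ` C_comp n"
  shows "x \<in> h ` C_comp (m + n)"
  using UV x
proof (induction rule: span_prod_induct)
  case zero
  show ?case
    by (rule image_eqI[of _ h "\<zero>\<^bsub>C\<^esub>"]) (simp_all add: h_zero C_comp_eq C.hcomp_zero)
next
  case (prod u v)
  from subsetD[OF U prod(1)] obtain a where a: "u = h a" "a \<in> C_comp m" by (rule imageE)
  from subsetD[OF V prod(2)] obtain b where b: "v = h b" "b \<in> C_comp n" by (rule imageE)
  have "u \<otimes> v = h (a \<otimes>\<^bsub>C\<^esub> b)"
    using a b C_comp_closed[OF a(2)] C_comp_closed[OF b(2)] by (simp add: rng_homD(3)[OF h])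
  then show ?case using C_comp_mult[OF a(2) b(2)] by (rule image_eqI)
next
  case (add x y)
  from add(3) obtain a where a: "x = h a" "a \<in> C_comp (m + n)" by (rule imageE)
  from add(4) obtain b where b: "y = h b" "b \<in> C_comp (m + n)" by (rule imageE)
  have "x \<oplus> y = h (a \<oplus>\<^bsub>C\<^esub> b)"
    using a b C_comp_closed[OF a(2)] C_comp_closed[OF b(2)] by (simp add: rng_homD(2)[OF h])
  then show ?case using C.hcomp_add[OF a(2)[unfolded C_comp_eq] b(2)[unfolded C_comp_eq]]
    unfolding C_comp_eq by (rule image_eqI)
qed

lemma A_image:
  shows "A (int n) \<subseteq> h ` C_comp (int n)" "A (- int n) \<subseteq> h ` C_comp (- int n)"
proof -
  have A0: "A 0 \<subseteq> h ` C_comp 0"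
  proof
    fix x assume x: "x \<in> A 0"
    show "x \<in> h ` C_comp 0"
      by (rule image_eqI[of _ h "sg x"]) (simp_all only: h_sg[OF x] gen_C_comp(1)[OF x])
  qed
  have A1: "A 1 \<subseteq> h ` C_comp 1"
  proof
    fix x assume x: "x \<in> A 1"
    show "x \<in> h ` C_comp 1"
      by (rule image_eqI[of _ h "tq x"]) (simp_all only: h_tq[OF x] gen_C_comp(2)[OF x])
  qed
  have Am: "A (- 1) \<subseteq> h ` C_comp (- 1)"
  proof
    fix x assume x: "x \<in> A (- 1)"
    show "x \<in> h ` C_comp (- 1)"
      by (rule image_eqI[of _ h "tp x"]) (simp_all only: h_tp[OF x] gen_C_comp(3)[OF x])
  qed
  show "A (int n) \<subseteq> h ` C_comp (int n)"
  proof (induction n)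
    case (Suc n)
    have "A (int (Suc n)) \<subseteq> span_prod L (A 1) (A (int n))" using A_pos[of "int (Suc n)"] by simp
    then show ?case using span_image[OF A_subgroup A_subgroup _ A1 Suc] by auto
  qed (use A0 in simp)
  show "A (- int n) \<subseteq> h ` C_comp (- int n)"
  proof (induction n)
    case (Suc n)
    have "A (- int (Suc n)) \<subseteq> span_prod L (A (- int n)) (A (- 1))" using A_neg[of "- int (Suc n)"] by simp
    then show ?case using span_image[OF A_subgroup A_subgroup _ Suc Am] by (auto simp: algebra_simps)
  qed (use A0 in simp)
qed

lemma h_image_comp: "h ` C_comp n = A n"
proof
  show "h ` C_comp n \<subseteq> A n" using h_comp by blast
  show "A n \<subseteq> h ` C_comp n"
  proof (cases "n \<ge> 0")
    case True
    then show ?thesis using A_image(1)[of "nat n"] by simp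
  next
    case False
    then show ?thesis using A_image(2)[of "nat (- n)"] by simp
  qed
qed

lemma h_kernel:
  assumes x: "x \<in> carrier C" and z: "h x = \<zero>" shows "x = \<zero>\<^bsub>C\<^esub>"
proof -
  obtain N a where a: "finite N" "\<And>n. a n \<in> C_comp n" "x = (\<Oplus>\<^bsub>C\<^esub>n\<in>N. a n)"
    using C.hcomp_decomposition[OF x, of cp_deg] unfolding C_comp_eq by blast
  have ac: "a n \<in> carrier C" for n by (rule C_comp_closed[OF a(2)])
  have "(\<Oplus>n\<in>N. h (a n)) = \<zero>"
    using C.G.additive_hom_finsum[OF abelian_group_axioms rng_homD(1,2)[OF h] a(1), of a] ac a(3) z by auto
  then have "h (a n) = \<zero>" if "n \<in> N" for n
    using A_independent[of N "\<lambda>n. h (a n)" n] a(1,2) h_comp that by blast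
  then have "a n = \<zero>\<^bsub>C\<^esub>" if "n \<in> N" for n
    using h_inj_comp[OF a(2)] that by blast
  then show ?thesis unfolding a(3) by (simp add: C.G.add.finprod_one_eqI)
qed

lemma h_bij: "bij_betw h (carrier C) (carrier L)"
  unfolding bij_betw_def
proof
  show "inj_on h (carrier C)"
  proof (rule inj_onI)
    fix x y assume xy: "x \<in> carrier C" "y \<in> carrier C" "h x = h y"
    then have "h (x \<ominus>\<^bsub>C\<^esub> y) = \<zero>"
      using rng_homD(1)[OF h xy(2)] by (simp add: a_minus_def rng_homD(2)[OF h] h_minus r_neg)
    then have "x \<ominus>\<^bsub>C\<^esub> y = \<zero>\<^bsub>C\<^esub>" using xy h_kernel[of "x \<ominus>\<^bsub>C\<^esub> y"] by simp
    then show "x = y" by (rule C.G.eq_if_minus_zero[OF xy(1,2)])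
  qed
  show "h ` carrier C = carrier L"
  proof (intro subset_antisym subsetI)
    fix x assume "x \<in> carrier L"
    then obtain N a where a: "finite N" "\<And>n. a n \<in> A n" "x = (\<Oplus>n\<in>N. a n)"
      using A_decomposition[of x] by metis
    have "\<exists>c. c \<in> C_comp n \<and> a n = h c" for n
    proof -
      have "a n \<in> h ` C_comp n" using a(2)[of n] by (simp only: h_image_comp)
      then show ?thesis by (rule imageE) (intro exI conjI)
    qed
    then obtain c where c: "\<And>n. c n \<in> C_comp n \<and> a n = h (c n)"
      by metis
    have cc: "c n \<in> carrier C" for n using c C_comp_closed by blast
    have "x = h (\<Oplus>\<^bsub>C\<^esub>n\<in>N. c n)"
      using C.G.additive_hom_finsum[OF abelian_group_axioms rng_homD(1,2)[OF h] a(1), of c] cc c a(3) by auto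
    moreover have "(\<Oplus>\<^bsub>C\<^esub>n\<in>N. c n) \<in> carrier C" using cc by (intro C.G.finsum_closed) auto
    ultimately show "x \<in> h ` carrier C" by blast
  next
    fix y assume "y \<in> h ` carrier C"
    then show "y \<in> carrier L" by (rule imageE) (simp only: rng_homD(1)[OF h])
  qed
qed

lemma h_graded_isomorphic: "graded_isomorphic L A C C_comp"
proof -
  let ?g = "inv_into (carrier C) h"
  have im: "h ` carrier C = carrier L" and inj: "inj_on h (carrier C)"
    by (rule bij_betw_imp_surj_on[OF h_bij], rule bij_betw_imp_inj_on[OF h_bij])
  have g: "?g x \<in> carrier C" "h (?g x) = x" if "x \<in> carrier L" for x
    by (rule inv_into_into, simp only: im that, rule f_inv_into_f, simp only: im that)
  have gh: "?g (h x) = x" if "x \<in> carrier C" for x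
    by (rule inv_into_f_f[OF inj that])
  have "bij_betw ?g (carrier L) (carrier C)" by (rule bij_betw_inv_into[OF h_bij])
  moreover have "?g \<in> rng_hom L C"
    unfolding rng_hom_def
  proof (intro CollectI conjI ballI Pi_I)
    fix x y assume xy: "x \<in> carrier L" "y \<in> carrier L"
    show "?g (x \<oplus> y) = ?g x \<oplus>\<^bsub>C\<^esub> ?g y"
      using g[OF xy(1)] g[OF xy(2)] gh[of "?g x \<oplus>\<^bsub>C\<^esub> ?g y"] by (simp add: rng_homD(2)[OF h])
    show "?g (x \<otimes> y) = ?g x \<otimes>\<^bsub>C\<^esub> ?g y"
      using g[OF xy(1)] g[OF xy(2)] gh[of "?g x \<otimes>\<^bsub>C\<^esub> ?g y"] by (simp add: rng_homD(3)[OF h])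
  qed (rule g)
  moreover have "?g ` A n = C_comp n" for n
  proof -
    have "?g ` (h ` C_comp n) = C_comp n"
      unfolding image_image using gh[OF C_comp_closed] by (simp cong: image_cong)
    then show ?thesis by (simp only: h_image_comp)
  qed
  ultimately show ?thesis unfolding graded_isomorphic_def by blast
qed

end

theorem graded_isomorphic_cp_ring: "graded_isomorphic L A C C_comp"
proof -
  interpret id: covariant_representation S P Q \<psi> L "\<lambda>x. x" "\<lambda>x. x" "\<lambda>x. x" by (rule id_covariant)
  have T: "(\<lambda>x. x) \<in> carrier P \<rightarrow> carrier L" "(\<lambda>x. x) \<in> carrier Q \<rightarrow> carrier L" by (auto simp: A_carrier)
  \<comment> \<open>For the identity representation \<open>\<pi>\<close> inverts \<open>x \<mapsto> \<Delta> x\<close> on \<open>K\<close>.\<close>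
  have "(left_mult Q x, x) \<in> pi_graph S P Q \<psi> L (\<lambda>x. x) (\<lambda>x. x)" if "x \<in> K" for x
    using that
  proof (induction rule: K_induct)
    case zero
    have "left_mult Q \<zero> = (\<lambda>x\<in>carrier Q. \<zero>\<^bsub>Q\<^esub>)" by (auto simp: left_mult_def A_carrier intro!: restrict_ext)
    then show ?case using sys.pi_graph_zero[OF rng_axioms T] by (simp only:)
  next
    case (prod q p)
    then show ?case using sys.pi_graph_theta[OF rng_axioms T, of q p] by (simp add: theta_Q_eq)
  next
    case (add x y)
    have "left_mult Q (x \<oplus> y) = (\<lambda>q\<in>carrier Q. left_mult Q x q \<oplus>\<^bsub>Q\<^esub> left_mult Q y q)"
      using add(1,2) by (auto simp: left_mult_def A_carrier K_carrier l_distr intro!: restrict_ext)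
    then show ?case using sys.pi_graph_add[OF rng_axioms T add(3,4)] by (simp only:)
  qed
  then have "id.induced_pi (left_mult Q x) = x" if "x \<in> K" for x
    using that by (intro id.induced_pi_eq[OF FS])
  then obtain h where "h \<in> rng_hom C L" "\<forall>r\<in>carrier S. h (sg r) = r"
    "\<forall>p\<in>carrier P. h (tp p) = p" "\<forall>q\<in>carrier Q. h (tq q) = q"
    using id.cp_ring_universal[OF K_sub FS] unfolding sg_def tp_def tq_def by blast
  then show ?thesis by (intro h_graded_isomorphic[of h]) auto
qed

end


section \<open>The algebra of a generalized Boolean dynamical system\<close>

context rng
begin

text \<open>
  For commuting \<open>e\<close> and \<open>f\<close>, the element \<open>e + f - e f\<close> is a unit for everything that \<open>e\<close> or \<open>f\<close> is a
  unit for.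
\<close>

lemma join_of_units:
  assumes c: "e \<in> carrier R" "f \<in> carrier R" "x \<in> carrier R" and ef: "e \<otimes> f = f \<otimes> e"
  shows "e \<otimes> x = x \<or> f \<otimes> x = x \<Longrightarrow> (e \<oplus> f \<ominus> e \<otimes> f) \<otimes> x = x"
    and "x \<otimes> e = x \<or> x \<otimes> f = x \<Longrightarrow> x \<otimes> (e \<oplus> f \<ominus> e \<otimes> f) = x"
    and "e \<otimes> x = x \<otimes> e \<Longrightarrow> f \<otimes> x = x \<otimes> f \<Longrightarrow>
      (e \<oplus> f \<ominus> e \<otimes> f) \<otimes> x = x \<otimes> (e \<oplus> f \<ominus> e \<otimes> f)"
proof -
  have l: "(e \<oplus> f \<ominus> e \<otimes> f) \<otimes> x = e \<otimes> x \<oplus> f \<otimes> x \<ominus> (e \<otimes> f) \<otimes> x"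
    using c by (simp add: a_minus_def l_distr l_minus)
  have r: "x \<otimes> (e \<oplus> f \<ominus> e \<otimes> f) = x \<otimes> e \<oplus> x \<otimes> f \<ominus> x \<otimes> (e \<otimes> f)"
    using c by (simp add: a_minus_def r_distr r_minus)
  have cancel: "a \<oplus> b \<ominus> b = a" "b \<oplus> a \<ominus> b = a" if "a \<in> carrier R" "b \<in> carrier R" for a b
    using that by (simp_all add: a_minus_def a_ac r_neg r_neg1 r_neg2)
  show "(e \<oplus> f \<ominus> e \<otimes> f) \<otimes> x = x" if "e \<otimes> x = x \<or> f \<otimes> x = x"
    using that
  proof
    assume "e \<otimes> x = x"
    then have "(e \<otimes> f) \<otimes> x = f \<otimes> x" using c by (simp add: ef m_assoc)
    then show ?thesis using c \<open>e \<otimes> x = x\<close> by (simp add: l cancel)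
  next
    assume "f \<otimes> x = x"
    then have "(e \<otimes> f) \<otimes> x = e \<otimes> x" using c by (simp add: m_assoc)
    then show ?thesis using c \<open>f \<otimes> x = x\<close> by (simp add: l cancel)
  qed
  show "x \<otimes> (e \<oplus> f \<ominus> e \<otimes> f) = x" if "x \<otimes> e = x \<or> x \<otimes> f = x"
    using that
  proof
    assume "x \<otimes> e = x"
    then have "x \<otimes> (e \<otimes> f) = x \<otimes> f" using c by (simp flip: m_assoc)
    then show ?thesis using c \<open>x \<otimes> e = x\<close> by (simp add: r cancel)
  next
    assume "x \<otimes> f = x"
    then have "x \<otimes> (e \<otimes> f) = x \<otimes> e" using c by (simp add: ef flip: m_assoc)
    then show ?thesis using c \<open>x \<otimes> f = x\<close> by (simp add: r cancel)
  qed
  show "(e \<oplus> f \<ominus> e \<otimes> f) \<otimes> x = x \<otimes> (e \<oplus> f \<ominus> e \<otimes> f)" if "e \<otimes> x = x \<otimes> e" "f \<otimes> x = x \<otimes> f"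
  proof -
    have "(e \<otimes> f) \<otimes> x = e \<otimes> (x \<otimes> f)" using c that(2) by (simp add: m_assoc)
    also have "\<dots> = x \<otimes> (e \<otimes> f)" using c that(1) by (simp flip: m_assoc)
    finally show ?thesis unfolding l r using that by simp
  qed
qed

end

text \<open>
  A generalized Boolean dynamical system with a coefficient ring \<open>R\<close>; the algebra is \<open>G\<close>, its components
  are \<open>A n\<close>.
\<close>

locale gbds_algebra = generalized_boolean_dynamical_system L \<theta> \<I>
  for L :: "'l set" and \<theta> :: "'l \<Rightarrow> 'b::generalized_boolean_algebra \<Rightarrow> 'b" and \<I> +
  fixes R :: "'r::{comm_ring, comm_monoid_mult} itself"
begin

abbreviation "X \<equiv> gbds_gens L \<I>"
abbreviation "Rel \<equiv> gbds_rel L \<theta> \<I> :: (('b, 'l) gbds_gen word \<Rightarrow>\<^sub>0 'r) set"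
abbreviation "G \<equiv> gbds_alg R L \<theta> \<I>"
abbreviation "A \<equiv> gbds_component R L \<theta> \<I>"

lemma ideal_inf: "\<alpha> \<in> L \<Longrightarrow> B \<in> \<I> \<alpha> \<Longrightarrow> inf B B' \<in> \<I> \<alpha>"
  using ideal by (auto simp: gba_ideal_def)

lemma range_mem: "\<alpha> \<in> L \<Longrightarrow> \<theta> \<alpha> B \<in> \<I> \<alpha>"
  using range by blast

lemma gens_closed:
  "gen (Proj B) \<in> carrier (free_alg X :: ('r, _) module)"
  "\<alpha> \<in> L \<Longrightarrow> B \<in> \<I> \<alpha> \<Longrightarrow> gen (Edge \<alpha> B) \<in> carrier (free_alg X :: ('r, _) module)"
  "\<alpha> \<in> L \<Longrightarrow> B \<in> \<I> \<alpha> \<Longrightarrow> gen (Edge_star \<alpha> B) \<in> carrier (free_alg X :: ('r, _) module)"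
  by (rule gen_closed; simp add: gbds_gens_def)+

lemma Rel_closed: "Rel \<subseteq> carrier (free_alg X :: ('r, _) module)"
proof
  fix x :: "('b, 'l) gbds_gen word \<Rightarrow>\<^sub>0 'r" assume "x \<in> Rel"
  then show "x \<in> carrier (free_alg X :: ('r, _) module)"
    by cases (auto intro!: free_alg_diff_closed free_alg_add_closed free_alg_mult_closed gens_closed
      free_alg_sum_closed ideal_inf range_mem free_alg_zero_closed simp: gbds_Delta_def simp del: free_alg_simps)
qed

sublocale U: presentation X Rel
  rewrites "presented_alg X Rel = G"
  by (rule presentation.intro[OF Rel_closed]) (simp add: gbds_alg_def)

lemma A_eq: "A = U.hcomp gbds_deg"
  by (simp add: gbds_component_def)

text \<open>
  The classes of the generators; \<open>t \<alpha> B\<close> is the class of \<open>s\<^sup>*\<^bsub>\<alpha>,B\<^esub>\<close>.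
\<close>

definition "p = (\<lambda>B. U.cls (gen (Proj B)))"
definition "s = (\<lambda>\<alpha> B. U.cls (gen (Edge \<alpha> B)))"
definition "t = (\<lambda>\<alpha> B. U.cls (gen (Edge_star \<alpha> B)))"

lemma cls_gen: "U.cls (gen (Proj B)) = p B" "U.cls (gen (Edge \<alpha> B)) = s \<alpha> B"
    "U.cls (gen (Edge_star \<alpha> B)) = t \<alpha> B"
  by (simp_all add: p_def s_def t_def)

lemma gens_iff: "x \<in> X \<longleftrightarrow> (\<exists>B. x = Proj B) \<or> (\<exists>\<alpha>\<in>L. \<exists>B\<in>\<I> \<alpha>. x = Edge \<alpha> B) \<or>
    (\<exists>\<alpha>\<in>L. \<exists>B\<in>\<I> \<alpha>. x = Edge_star \<alpha> B)"
  by (auto simp: gbds_gens_def)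

lemma A_gens: "p B \<in> A 0" "\<alpha> \<in> L \<Longrightarrow> B \<in> \<I> \<alpha> \<Longrightarrow> s \<alpha> B \<in> A 1"
    "\<alpha> \<in> L \<Longrightarrow> B \<in> \<I> \<alpha> \<Longrightarrow> t \<alpha> B \<in> A (- 1)"
  using U.hcomp_gen[of "Proj B" gbds_deg] U.hcomp_gen[of "Edge \<alpha> B" gbds_deg]
    U.hcomp_gen[of "Edge_star \<alpha> B" gbds_deg]
  by (auto simp: gens_iff cls_gen A_eq)

lemma A_closed: "x \<in> A n \<Longrightarrow> x \<in> carrier G"
  unfolding A_eq by (rule U.hcomp_closed)

lemma closed [simp]: "p B \<in> carrier G" "\<alpha> \<in> L \<Longrightarrow> B \<in> \<I> \<alpha> \<Longrightarrow> s \<alpha> B \<in> carrier G"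
    "\<alpha> \<in> L \<Longrightarrow> B \<in> \<I> \<alpha> \<Longrightarrow> t \<alpha> B \<in> carrier G"
  using A_gens A_closed by blast+

lemma p_p:
  shows "p B \<otimes>\<^bsub>G\<^esub> p B' = p (inf B B')"
proof -
  have "U.cls (gen (Proj (inf B B'))) = U.cls (gen (Proj B) * gen (Proj B'))"
    by (intro U.cls_eq gbds_rel.p_inf free_alg_mult_closed gens_closed free_alg_zero_closed )
  then show ?thesis by (simp only: U.cls_mult gens_closed cls_gen )
qed

lemma p_s:
  assumes ab: "\<alpha> \<in> L" "B \<in> \<I> \<alpha>"
  shows "p B' \<otimes>\<^bsub>G\<^esub> s \<alpha> B = s \<alpha> B \<otimes>\<^bsub>G\<^esub> p (\<theta> \<alpha> B')"
proof -
  have "U.cls (gen (Proj B') * gen (Edge \<alpha> B)) = U.cls (gen (Edge \<alpha> B) * gen (Proj (\<theta> \<alpha> B')))"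
    by (intro U.cls_eq gbds_rel.p_s free_alg_mult_closed gens_closed free_alg_zero_closed ab)
  then show ?thesis by (simp only: U.cls_mult gens_closed cls_gen ab )
qed

lemma t_p:
  assumes ab: "\<alpha> \<in> L" "B \<in> \<I> \<alpha>"
  shows "t \<alpha> B \<otimes>\<^bsub>G\<^esub> p B' = p (\<theta> \<alpha> B') \<otimes>\<^bsub>G\<^esub> t \<alpha> B"
proof -
  have "U.cls (gen (Edge_star \<alpha> B) * gen (Proj B')) = U.cls (gen (Proj (\<theta> \<alpha> B')) * gen (Edge_star \<alpha> B))"
    by (intro U.cls_eq gbds_rel.s_star_p free_alg_mult_closed gens_closed free_alg_zero_closed ab)
  then show ?thesis by (simp only: U.cls_mult gens_closed cls_gen ab )
qed

lemma t_s:
  assumes ab: "\<alpha> \<in> L" "B \<in> \<I> \<alpha>" "\<alpha>' \<in> L" "B' \<in> \<I> \<alpha>'"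
  shows "t \<alpha> B \<otimes>\<^bsub>G\<^esub> s \<alpha>' B' = (if \<alpha> = \<alpha>' then p (inf B B') else \<zero>\<^bsub>G\<^esub>)"
proof -
  have r: "(if \<alpha> = \<alpha>' then gen (Proj (inf B B')) else 0) \<in> carrier (free_alg X :: ('r, _) module)"
    by (simp only: gens_closed free_alg_zero_closed split: if_split) blast
  have "U.cls (gen (Edge_star \<alpha> B) * gen (Edge \<alpha>' B')) =
      U.cls (if \<alpha> = \<alpha>' then gen (Proj (inf B B')) else 0)"
    by (intro U.cls_eq gbds_rel.s_star_s free_alg_mult_closed gens_closed ab r)
  also have "\<dots> = (if \<alpha> = \<alpha>' then p (inf B B') else \<zero>\<^bsub>G\<^esub>)"
    by (simp only: cls_gen U.cls_zero split: if_split) blast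
  finally show ?thesis by (simp only: U.cls_mult gens_closed cls_gen ab)
qed

lemma s_p:
  assumes ab: "\<alpha> \<in> L" "B \<in> \<I> \<alpha>"
  shows "s \<alpha> B \<otimes>\<^bsub>G\<^esub> p B' = s \<alpha> (inf B B')"
proof -
  have "U.cls (gen (Edge \<alpha> B) * gen (Proj B')) = U.cls (gen (Edge \<alpha> (inf B B')))"
    by (intro U.cls_eq gbds_rel.s_p free_alg_mult_closed gens_closed free_alg_zero_closed ideal_inf ab)
  then show ?thesis by (simp only: U.cls_mult gens_closed cls_gen ab ideal_inf )
qed

lemma p_t:
  assumes ab: "\<alpha> \<in> L" "B \<in> \<I> \<alpha>"
  shows "p B' \<otimes>\<^bsub>G\<^esub> t \<alpha> B = t \<alpha> (inf B B')"
proof -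
  have "U.cls (gen (Proj B') * gen (Edge_star \<alpha> B)) = U.cls (gen (Edge_star \<alpha> (inf B B')))"
    by (intro U.cls_eq gbds_rel.p_s_star free_alg_mult_closed gens_closed free_alg_zero_closed ideal_inf ab)
  then show ?thesis by (simp only: U.cls_mult gens_closed cls_gen ab ideal_inf )
qed

lemma Rel_homog: "r \<in> Rel \<Longrightarrow> \<exists>n. homog gbds_deg n r"
proof (induction rule: gbds_rel.cases)
  have m: "homog gbds_deg k (f * g)" if "homog gbds_deg m f" "homog gbds_deg n g" "m + n = k"
    for k m n and f g :: "('b, 'l) gbds_gen word \<Rightarrow>\<^sub>0 'r"
    using homog_mult[OF that(1,2)] that(3) by simp
  { case p_bot then show ?case
      by (intro exI[of _ "0"]) (auto intro!: homog_diff homog_add homog_sum m homog_gen) }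
  { case p_inf then show ?case
      by (intro exI[of _ "0"]) (auto intro!: homog_diff homog_add homog_sum m homog_gen) }
  { case p_sup then show ?case
      by (intro exI[of _ "0"]) (auto intro!: homog_diff homog_add homog_sum m homog_gen) }
  { case p_s then show ?case
      by (intro exI[of _ "1"]) (auto intro!: homog_diff homog_add homog_sum m homog_gen) }
  { case s_star_p then show ?case
      by (intro exI[of _ "- 1"]) (auto intro!: homog_diff homog_add homog_sum m homog_gen) }
  { case s_star_s then show ?case
      by (intro exI[of _ "0"]) (auto intro!: homog_diff homog_add homog_sum m homog_gen) }
  { case s_p then show ?case
      by (intro exI[of _ "1"]) (auto intro!: homog_diff homog_add homog_sum m homog_gen) }
  { case p_s_star then show ?case
      by (intro exI[of _ "- 1"]) (auto intro!: homog_diff homog_add homog_sum m homog_gen) }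
  { case regular then show ?case
      by (intro exI[of _ "0"]) (auto intro!: homog_diff homog_add homog_sum m homog_gen) }
qed

text \<open>
  Products of \<open>m\<close> elements \<open>s \<alpha> B\<close>, one \<open>p B\<close> and \<open>n\<close> elements \<open>t \<alpha> B\<close>, in this order.
\<close>

inductive normal_form :: "nat \<Rightarrow> nat \<Rightarrow> ('r, 'b, 'l) gbds_elem \<Rightarrow> bool" where
  p: "normal_form 0 0 (p B)"
| t: "\<lbrakk>normal_form 0 n x; \<alpha> \<in> L; B \<in> \<I> \<alpha>\<rbrakk> \<Longrightarrow> normal_form 0 (Suc n) (x \<otimes>\<^bsub>G\<^esub> t \<alpha> B)"
| s: "\<lbrakk>normal_form m n x; \<alpha> \<in> L; B \<in> \<I> \<alpha>\<rbrakk> \<Longrightarrow> normal_form (Suc m) n (s \<alpha> B \<otimes>\<^bsub>G\<^esub> x)"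

lemma normal_form_A: "normal_form m n x \<Longrightarrow> x \<in> A (int m - int n)"
proof (induction rule: normal_form.induct)
  case (p B)
  then show ?case using A_gens by simp
next
  case (t n x \<alpha> B)
  then show ?case using U.hcomp_mult[of x gbds_deg "- int n" "t \<alpha> B" "- 1"] A_gens(3)[of \<alpha> B]
    by (simp add: A_eq algebra_simps)
next
  case (s m n x \<alpha> B)
  then show ?case using U.hcomp_mult[of "s \<alpha> B" gbds_deg 1 x "int m - int n"] A_gens(2)[of \<alpha> B]
    by (simp add: A_eq algebra_simps)
qed

lemma normal_form_closed: "normal_form m n x \<Longrightarrow> x \<in> carrier G"
  using normal_form_A A_closed by blast

lemma normal_form_p: "normal_form m n x \<Longrightarrow> normal_form m n (p B \<otimes>\<^bsub>G\<^esub> x)"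
proof (induction arbitrary: B rule: normal_form.induct)
  case (p B')
  then show ?case by (simp add: p_p normal_form.p)
next
  case (t n x \<alpha> B')
  have "p B \<otimes>\<^bsub>G\<^esub> (x \<otimes>\<^bsub>G\<^esub> t \<alpha> B') = (p B \<otimes>\<^bsub>G\<^esub> x) \<otimes>\<^bsub>G\<^esub> t \<alpha> B'"
    using t normal_form_closed[OF t(1)] by (simp add: U.G.m_assoc)
  then show ?case using normal_form.t[OF t.IH t(2,3)] by simp
next
  case (s m n x \<alpha> B')
  have "p B \<otimes>\<^bsub>G\<^esub> (s \<alpha> B' \<otimes>\<^bsub>G\<^esub> x) = s \<alpha> B' \<otimes>\<^bsub>G\<^esub> (p (\<theta> \<alpha> B) \<otimes>\<^bsub>G\<^esub> x)"
    using s normal_form_closed[OF s(1)] by (simp add: p_s flip: U.G.m_assoc)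
  then show ?case using normal_form.s[OF s.IH s(2,3)] by simp
qed

lemma normal_form_t_mult:
  "normal_form m n x \<Longrightarrow> m = 0 \<Longrightarrow> \<alpha> \<in> L \<Longrightarrow> B \<in> \<I> \<alpha> \<Longrightarrow> normal_form 0 (Suc n) (t \<alpha> B \<otimes>\<^bsub>G\<^esub> x)"
proof (induction rule: normal_form.induct)
  case (p B')
  then show ?case using normal_form.t[OF normal_form.p, of \<alpha> B "\<theta> \<alpha> B'"] by (simp add: t_p)
next
  case (t n x \<beta> B')
  have "t \<alpha> B \<otimes>\<^bsub>G\<^esub> (x \<otimes>\<^bsub>G\<^esub> t \<beta> B') = (t \<alpha> B \<otimes>\<^bsub>G\<^esub> x) \<otimes>\<^bsub>G\<^esub> t \<beta> B'"
    using t normal_form_closed[OF t(1)] by (simp add: U.G.m_assoc)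
  then show ?case using normal_form.t[of "Suc n" "t \<alpha> B \<otimes>\<^bsub>G\<^esub> x" \<beta> B'] t by simp
qed simp

text \<open>
  Multiplying a normal form on the left by \<open>p B\<close> or by \<open>t \<alpha> B\<close> yields a normal form or \<open>0\<close>: the former
  moves through the \<open>s\<close>, the latter cancels the first \<open>s\<close> or, if there is none, moves behind the \<open>p\<close>.
\<close>

lemma normal_form_word:
  "ws \<noteq> [] \<Longrightarrow> set ws \<subseteq> X \<Longrightarrow> word_prod G (\<lambda>x. U.cls (gen x)) ws = \<zero>\<^bsub>G\<^esub> \<or>
    (\<exists>m n. normal_form m n (word_prod G (\<lambda>x. U.cls (gen x)) ws) \<and>
      int m - int n = sum_list (map gbds_deg ws))"
proof (induction ws)
  case (Cons x xs)
  let ?w = "word_prod G (\<lambda>x. U.cls (gen x)) xs"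
  let ?W = "word_prod G (\<lambda>x. U.cls (gen x)) (x # xs)"
  have I: "?W = \<zero>\<^bsub>G\<^esub> \<or> (\<exists>m n. normal_form m n ?W \<and> int m - int n = sum_list (map gbds_deg (x # xs)))"
    if "normal_form m n y" "?W = y" "int m - int n = gbds_deg x + sum_list (map gbds_deg xs)" for m n y
    using that by auto
  have "x \<in> X" using Cons.prems by simp
  then consider (P) B where "x = Proj B" | (E) \<alpha> B where "\<alpha> \<in> L" "B \<in> \<I> \<alpha>" "x = Edge \<alpha> B"
    | (E') \<alpha> B where "\<alpha> \<in> L" "B \<in> \<I> \<alpha>" "x = Edge_star \<alpha> B"
    unfolding gens_iff by blast
  note c = this
  show ?case
  proof (cases xs)
    case Nil
    from c show ?thesis
    proof cases
      case P
      show ?thesis by (rule I[OF normal_form.p[of B]]) (simp_all add: Nil P cls_gen)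
    next
      case E
      \<comment> \<open>A single letter becomes a normal form by inserting \<open>p B\<close>.\<close>
      then have "s \<alpha> B \<otimes>\<^bsub>G\<^esub> p B = s \<alpha> B" by (simp add: s_p)
      then have "normal_form 1 0 (s \<alpha> B)" using normal_form.s[OF normal_form.p E(1,2), of B] by simp
      then show ?thesis by (rule I) (simp_all add: Nil E(3) cls_gen)
    next
      case E'
      then have "p B \<otimes>\<^bsub>G\<^esub> t \<alpha> B = t \<alpha> B" by (simp add: p_t)
      then have "normal_form 0 1 (t \<alpha> B)" using normal_form.t[OF normal_form.p E'(1,2), of B] by simp
      then show ?thesis by (rule I) (simp_all add: Nil E'(3) cls_gen)
    qed
  next
    case (Cons y ys)
    have w: "word_prod G (\<lambda>x. U.cls (gen x)) (x # xs) = U.cls (gen x) \<otimes>\<^bsub>G\<^esub> ?w"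
      using Cons by simp
    have xc: "U.cls (gen x) \<in> carrier G" using c by cases (auto simp: cls_gen)
    from Cons Cons.IH Cons.prems have IH: "?w = \<zero>\<^bsub>G\<^esub> \<or>
      (\<exists>m n. normal_form m n ?w \<and> int m - int n = sum_list (map gbds_deg xs))" by simp
    then show ?thesis
    proof
      assume "?w = \<zero>\<^bsub>G\<^esub>"
      then show ?thesis unfolding w using xc by simp
    next
      assume "\<exists>m n. normal_form m n ?w \<and> int m - int n = sum_list (map gbds_deg xs)"
      then obtain m n where nf: "normal_form m n ?w" "int m - int n = sum_list (map gbds_deg xs)"
        by blast
      from c show ?thesis
      proof cases
        case P
        have "normal_form m n (U.cls (gen x) \<otimes>\<^bsub>G\<^esub> ?w)"
          using normal_form_p[OF nf(1)] by (simp only: P cls_gen)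
        then show ?thesis by (rule I[OF _ w]) (simp add: nf(2) P)
      next
        case E
        have "normal_form (Suc m) n (U.cls (gen x) \<otimes>\<^bsub>G\<^esub> ?w)"
          using normal_form.s[OF nf(1) E(1,2)] by (simp only: E(3) cls_gen)
        then show ?thesis by (rule I[OF _ w]) (simp add: nf(2)[symmetric] E(3))
      next
        case E'
        note E' = this
        from nf(1) have "(m = 0 \<or> (\<exists>m' \<beta> B' z. m = Suc m' \<and> normal_form m' n z \<and> \<beta> \<in> L \<and> B' \<in> \<I> \<beta> \<and>
          ?w = s \<beta> B' \<otimes>\<^bsub>G\<^esub> z))" by cases auto
        then show ?thesis
        proof (elim disjE exE conjE)
          assume "m = 0"
          then have "normal_form 0 (Suc n) (U.cls (gen x) \<otimes>\<^bsub>G\<^esub> ?w)"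
            using normal_form_t_mult[OF nf(1) _ E'(1,2)] by (simp only: E'(3) cls_gen)
          then show ?thesis by (rule I[OF _ w]) (simp add: nf(2)[symmetric] E'(3) \<open>m = 0\<close>)
        next
          fix m' \<beta> B' z
          assume z: "m = Suc m'" "normal_form m' n z" "\<beta> \<in> L" "B' \<in> \<I> \<beta>" "?w = s \<beta> B' \<otimes>\<^bsub>G\<^esub> z"
          have zc: "z \<in> carrier G" using z(2) by (rule normal_form_closed)
          have e: "U.cls (gen x) \<otimes>\<^bsub>G\<^esub> ?w = (t \<alpha> B \<otimes>\<^bsub>G\<^esub> s \<beta> B') \<otimes>\<^bsub>G\<^esub> z"
            unfolding z(5) using E' z zc by (simp add: cls_gen U.G.m_assoc)
          show ?thesis
          proof (cases "\<alpha> = \<beta>")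
            case True
            have "normal_form m' n (U.cls (gen x) \<otimes>\<^bsub>G\<^esub> ?w)"
              unfolding e using normal_form_p[OF z(2), of "inf B B'"] True E' z by (simp add: t_s)
            then show ?thesis by (rule I[OF _ w]) (simp add: nf(2)[symmetric] E'(3) z(1))
          next
            case False
            then show ?thesis unfolding w e using E' z zc by (simp add: t_s)
          qed
        qed
      qed
    qed
  qed
qed simp

lemma normal_form_left:
  assumes "normal_form m n x" "m > 0"
  obtains \<alpha> B y where "\<alpha> \<in> L" "B \<in> \<I> \<alpha>" "x = s \<alpha> B \<otimes>\<^bsub>G\<^esub> y" "y \<in> A (int m - int n - 1)"
  using assms
proof cases
  case (s m' y \<alpha> B)
  then show ?thesis using that normal_form_A[OF s(3)] by simp
qed simp_all

lemma normal_form_right: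
  "normal_form m n x \<Longrightarrow> n > 0 \<Longrightarrow>
    \<exists>\<alpha> B y. \<alpha> \<in> L \<and> B \<in> \<I> \<alpha> \<and> x = y \<otimes>\<^bsub>G\<^esub> t \<alpha> B \<and> y \<in> A (int m - int n + 1)"
proof (induction rule: normal_form.induct)
  case (t n x \<alpha> B)
  then show ?case using normal_form_A[OF t(1)] by (intro exI[of _ \<alpha>] exI[of _ B] exI[of _ x]) simp
next
  case (s m n x \<alpha> B)
  then obtain \<beta> B' y where y: "\<beta> \<in> L" "B' \<in> \<I> \<beta>" "x = y \<otimes>\<^bsub>G\<^esub> t \<beta> B'" "y \<in> A (int m - int n + 1)"
    by auto
  have "s \<alpha> B \<otimes>\<^bsub>G\<^esub> y \<in> A (int (Suc m) - int n + 1)"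
    using U.hcomp_mult[of "s \<alpha> B" gbds_deg 1 y "int m - int n + 1"] A_gens(2)[of \<alpha> B] y s
    by (simp add: A_eq algebra_simps)
  moreover have "s \<alpha> B \<otimes>\<^bsub>G\<^esub> x = (s \<alpha> B \<otimes>\<^bsub>G\<^esub> y) \<otimes>\<^bsub>G\<^esub> t \<beta> B'"
    using y s A_closed[OF y(4)] by (simp add: U.G.m_assoc)
  ultimately show ?case using y(1,2) by blast
qed simp

text \<open>
  A normal form of positive degree starts with some \<open>s \<alpha> B\<close>, and one of negative degree ends with
  some \<open>t \<alpha> B\<close>.
\<close>

lemma A_pos_induct [consumes 2, case_names zero prod add]:
  assumes x: "x \<in> A n" and n: "n > 0"
    and z: "P \<zero>\<^bsub>G\<^esub>"
    and s: "\<And>\<alpha> B y. \<alpha> \<in> L \<Longrightarrow> B \<in> \<I> \<alpha> \<Longrightarrow> y \<in> A (n - 1) \<Longrightarrow> P (s \<alpha> B \<otimes>\<^bsub>G\<^esub> y)"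
    and a: "\<And>x y. x \<in> A n \<Longrightarrow> y \<in> A n \<Longrightarrow> P x \<Longrightarrow> P y \<Longrightarrow> P (x \<oplus>\<^bsub>G\<^esub> y)"
  shows "P x"
  using x unfolding A_eq
proof (induction rule: U.hcomp_induct)
  case zero
  show ?case by (rule z)
next
  case (word ws c)
  let ?w = "word_prod G (\<lambda>x. U.cls (gen x)) ws"
  from normal_form_word[OF word(1,2)] show ?case
  proof (elim disjE exE conjE)
    assume "?w = \<zero>\<^bsub>G\<^esub>"
    then show ?thesis using z U.G.smult_zero by simp
  next
    fix k l assume kl: "normal_form k l ?w" "int k - int l = sum_list (map gbds_deg ws)"
    then have "k > 0" using n word(3) by simp
    with kl(1) obtain \<alpha> B y where y: "\<alpha> \<in> L" "B \<in> \<I> \<alpha>" "?w = s \<alpha> B \<otimes>\<^bsub>G\<^esub> y" "y \<in> A (n - 1)"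
      using normal_form_left[OF kl(1)] kl(2) word(3) by metis
    have "c \<odot>\<^bsub>G\<^esub> ?w = s \<alpha> B \<otimes>\<^bsub>G\<^esub> (c \<odot>\<^bsub>G\<^esub> y)"
      unfolding y(3) using y A_closed[OF y(4)] by (simp add: U.G.smult_mult_r)
    moreover have "c \<odot>\<^bsub>G\<^esub> y \<in> A (n - 1)" using y(4) U.hcomp_smult by (simp add: A_eq)
    ultimately show ?thesis using s y(1,2) by simp
  qed
next
  case (add x y)
  then show ?case using a by (simp add: A_eq)
qed

lemma A_neg_induct [consumes 2, case_names zero prod add]:
  assumes x: "x \<in> A n" and n: "n < 0"
    and z: "P \<zero>\<^bsub>G\<^esub>"
    and s: "\<And>\<alpha> B y. \<alpha> \<in> L \<Longrightarrow> B \<in> \<I> \<alpha> \<Longrightarrow> y \<in> A (n + 1) \<Longrightarrow> P (y \<otimes>\<^bsub>G\<^esub> t \<alpha> B)"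
    and a: "\<And>x y. x \<in> A n \<Longrightarrow> y \<in> A n \<Longrightarrow> P x \<Longrightarrow> P y \<Longrightarrow> P (x \<oplus>\<^bsub>G\<^esub> y)"
  shows "P x"
  using x unfolding A_eq
proof (induction rule: U.hcomp_induct)
  case zero
  show ?case by (rule z)
next
  case (word ws c)
  let ?w = "word_prod G (\<lambda>x. U.cls (gen x)) ws"
  from normal_form_word[OF word(1,2)] show ?case
  proof (elim disjE exE conjE)
    assume "?w = \<zero>\<^bsub>G\<^esub>"
    then show ?thesis using z U.G.smult_zero by simp
  next
    fix k l assume kl: "normal_form k l ?w" "int k - int l = sum_list (map gbds_deg ws)"
    then have "l > 0" using n word(3) by simp
    from normal_form_right[OF kl(1) this]
    obtain \<alpha> B y where y: "\<alpha> \<in> L" "B \<in> \<I> \<alpha>" "?w = y \<otimes>\<^bsub>G\<^esub> t \<alpha> B" "y \<in> A (n + 1)"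
      unfolding kl(2) word(3) by blast
    have "c \<odot>\<^bsub>G\<^esub> ?w = (c \<odot>\<^bsub>G\<^esub> y) \<otimes>\<^bsub>G\<^esub> t \<alpha> B"
      unfolding y(3) using y A_closed[OF y(4)] by (simp add: U.G.smult_mult_l)
    moreover have "c \<odot>\<^bsub>G\<^esub> y \<in> A (n + 1)" using y(4) U.hcomp_smult by (simp add: A_eq)
    ultimately show ?thesis using s y(1,2) by simp
  qed
next
  case (add x y)
  then show ?case using a by (simp add: A_eq)
qed

abbreviation "KK \<equiv> span_prod G (A 1) (A (- 1))"

lemma A_subgroup: "additive_subgroup (A n) G"
  unfolding A_eq by (rule U.hcomp_subgroup)

lemma A_mult: "x \<in> A m \<Longrightarrow> y \<in> A n \<Longrightarrow> x \<otimes>\<^bsub>G\<^esub> y \<in> A (m + n)"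
  unfolding A_eq by (rule U.hcomp_mult)

lemma KK_subgroup: "additive_subgroup KK G"
  by (rule U.G.span_prod_subgroup) (blast intro: A_closed)+

lemma KK_A0: "x \<in> KK \<Longrightarrow> x \<in> A 0"
proof (induction rule: U.G.span_prod_induct[OF A_subgroup A_subgroup,
      consumes 1, case_names zero prod add])
  case zero
  show ?case by (rule additive_subgroup.zero_closed[OF A_subgroup])
next
  case (prod u v)
  then show ?case using A_mult[of u 1 v "- 1"] by simp
next
  case (add x y)
  then show ?case by (intro additive_subgroup.a_closed[OF A_subgroup])
qed

lemma KK_mult: "x \<in> KK \<Longrightarrow> r \<in> A 0 \<Longrightarrow> x \<otimes>\<^bsub>G\<^esub> r \<in> KK"
proof (induction rule: U.G.span_prod_induct[OF A_subgroup A_subgroup,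
      consumes 1, case_names zero prod add])
  case zero
  then show ?case using additive_subgroup.zero_closed[OF KK_subgroup] A_closed[of r 0] by simp
next
  case (prod u v)
  then have "v \<otimes>\<^bsub>G\<^esub> r \<in> A (- 1)" using A_mult[of v "- 1" r 0] by simp
  moreover have "(u \<otimes>\<^bsub>G\<^esub> v) \<otimes>\<^bsub>G\<^esub> r = u \<otimes>\<^bsub>G\<^esub> (v \<otimes>\<^bsub>G\<^esub> r)"
    using prod A_closed by (intro U.G.m_assoc) blast+
  ultimately show ?case using U.G.span_prod_mem[OF prod(1)] by simp
next
  case (add x y)
  have "(x \<oplus>\<^bsub>G\<^esub> y) \<otimes>\<^bsub>G\<^esub> r = x \<otimes>\<^bsub>G\<^esub> r \<oplus>\<^bsub>G\<^esub> y \<otimes>\<^bsub>G\<^esub> r"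
    using add(1,2,5) KK_A0 A_closed by (intro U.G.l_distr) blast+
  then show ?case using additive_subgroup.a_closed[OF KK_subgroup add(3,4)] add(5) by simp
qed

lemma range_projections_commute:
  assumes "\<alpha> \<in> L" "B \<in> \<I> \<alpha>" "\<beta> \<in> L" "D \<in> \<I> \<beta>"
  shows "(s \<alpha> B \<otimes>\<^bsub>G\<^esub> t \<alpha> B) \<otimes>\<^bsub>G\<^esub> (s \<beta> D \<otimes>\<^bsub>G\<^esub> t \<beta> D) = (s \<beta> D \<otimes>\<^bsub>G\<^esub> t \<beta> D) \<otimes>\<^bsub>G\<^esub> (s \<alpha> B \<otimes>\<^bsub>G\<^esub> t \<alpha> B)"
proof -
  have e: "(s \<alpha> B \<otimes>\<^bsub>G\<^esub> t \<alpha> B) \<otimes>\<^bsub>G\<^esub> (s \<beta> D \<otimes>\<^bsub>G\<^esub> t \<beta> D) =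
      (if \<alpha> = \<beta> then s \<alpha> (inf B D) \<otimes>\<^bsub>G\<^esub> t \<alpha> (inf B D) else \<zero>\<^bsub>G\<^esub>)"
    if "\<alpha> \<in> L" "B \<in> \<I> \<alpha>" "\<beta> \<in> L" "D \<in> \<I> \<beta>" for \<alpha> B \<beta> D
  proof -
    have "(s \<alpha> B \<otimes>\<^bsub>G\<^esub> t \<alpha> B) \<otimes>\<^bsub>G\<^esub> (s \<beta> D \<otimes>\<^bsub>G\<^esub> t \<beta> D) =
        s \<alpha> B \<otimes>\<^bsub>G\<^esub> ((t \<alpha> B \<otimes>\<^bsub>G\<^esub> s \<beta> D) \<otimes>\<^bsub>G\<^esub> t \<beta> D)"
      using that by (simp add: U.G.m_assoc)
    also have "\<dots> = (if \<alpha> = \<beta> then s \<alpha> (inf B D) \<otimes>\<^bsub>G\<^esub> t \<alpha> (inf B D) else \<zero>\<^bsub>G\<^esub>)"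
    proof (cases "\<alpha> = \<beta>")
      case True
      have "s \<alpha> B \<otimes>\<^bsub>G\<^esub> (p (inf B D) \<otimes>\<^bsub>G\<^esub> t \<alpha> D) =
          s \<alpha> B \<otimes>\<^bsub>G\<^esub> ((p (inf B D) \<otimes>\<^bsub>G\<^esub> p (inf B D)) \<otimes>\<^bsub>G\<^esub> t \<alpha> D)"
        by (simp add: p_p)
      also have "\<dots> = (s \<alpha> B \<otimes>\<^bsub>G\<^esub> p (inf B D)) \<otimes>\<^bsub>G\<^esub> (p (inf B D) \<otimes>\<^bsub>G\<^esub> t \<alpha> D)"
        using that True by (simp add: U.G.m_assoc)
      also have "\<dots> = s \<alpha> (inf B D) \<otimes>\<^bsub>G\<^esub> t \<alpha> (inf B D)"
        using that True by (simp add: s_p p_t inf.absorb2 inf.commute inf.left_commute)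
      finally show ?thesis using True that by (simp add: t_s)
    qed (use that in \<open>simp add: t_s\<close>)
    finally show ?thesis .
  qed
  show ?thesis using e[OF assms] e[OF assms(3,4,1,2)] by (auto simp: inf.commute)
qed

text \<open>
  A common local unit for finitely many generators. The commutation property, which makes
  \<open>join_of_units\<close> applicable at each step, is carried along in the induction.
\<close>

lemma unit_for_edges:
  assumes "finite Z" "Z \<subseteq> Sigma L \<I>"
  shows "\<exists>e\<in>KK. (\<forall>\<alpha>\<in>L. \<forall>B\<in>\<I> \<alpha>. e \<otimes>\<^bsub>G\<^esub> (s \<alpha> B \<otimes>\<^bsub>G\<^esub> t \<alpha> B) = (s \<alpha> B \<otimes>\<^bsub>G\<^esub> t \<alpha> B) \<otimes>\<^bsub>G\<^esub> e) \<and>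
    (\<forall>\<alpha> B. (\<alpha>, B) \<in> Z \<longrightarrow> e \<otimes>\<^bsub>G\<^esub> s \<alpha> B = s \<alpha> B \<and> t \<alpha> B \<otimes>\<^bsub>G\<^esub> e = t \<alpha> B)"
  using assms
proof (induction Z rule: finite_induct)
  case empty
  show ?case by (rule bexI[OF _ additive_subgroup.zero_closed[OF KK_subgroup]]) auto
next
  case (insert z Z)
  obtain \<alpha> B where z: "z = (\<alpha>, B)" by (cases z)
  have ab: "\<alpha> \<in> L" "B \<in> \<I> \<alpha>" using insert.prems z by auto
  have "Z \<subseteq> Sigma L \<I>" using insert.prems by simp
  from insert.IH[OF this] obtain e where e1: "e \<in> KK" and e0:
    "(\<forall>\<alpha>\<in>L. \<forall>B\<in>\<I> \<alpha>. e \<otimes>\<^bsub>G\<^esub> (s \<alpha> B \<otimes>\<^bsub>G\<^esub> t \<alpha> B) = (s \<alpha> B \<otimes>\<^bsub>G\<^esub> t \<alpha> B) \<otimes>\<^bsub>G\<^esub> e) \<and>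
    (\<forall>\<alpha> B. (\<alpha>, B) \<in> Z \<longrightarrow> e \<otimes>\<^bsub>G\<^esub> s \<alpha> B = s \<alpha> B \<and> t \<alpha> B \<otimes>\<^bsub>G\<^esub> e = t \<alpha> B)"
    by (rule bexE)
  note e = e1 conjunct1[OF e0, rule_format] conjunct2[OF e0, rule_format]
  define f where "f = s \<alpha> B \<otimes>\<^bsub>G\<^esub> t \<alpha> B"
  have fK: "f \<in> KK" unfolding f_def by (intro U.G.span_prod_mem A_gens ab)
  have fc: "f \<in> carrier G" and ec: "e \<in> carrier G"
    using A_closed[OF KK_A0[OF fK]] A_closed[OF KK_A0[OF e(1)]] .
  have fs: "f \<otimes>\<^bsub>G\<^esub> s \<alpha> B = s \<alpha> B" and ft: "t \<alpha> B \<otimes>\<^bsub>G\<^esub> f = t \<alpha> B"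
    unfolding f_def using ab
    by (simp_all add: U.G.m_assoc t_s s_p, simp add: t_s p_t flip: U.G.m_assoc)
  have ef: "e \<otimes>\<^bsub>G\<^esub> f = f \<otimes>\<^bsub>G\<^esub> e" unfolding f_def using e(2)[OF ab] .
  let ?g = "e \<oplus>\<^bsub>G\<^esub> f \<ominus>\<^bsub>G\<^esub> e \<otimes>\<^bsub>G\<^esub> f"
  have gK: "?g \<in> KK"
    unfolding a_minus_def using e(1) fK KK_mult[OF e(1) KK_A0[OF fK]]
    by (intro additive_subgroup.a_closed[OF KK_subgroup] additive_subgroup.a_inv_closed[OF KK_subgroup])
  have gc: "?g \<otimes>\<^bsub>G\<^esub> (s \<beta> D \<otimes>\<^bsub>G\<^esub> t \<beta> D) = (s \<beta> D \<otimes>\<^bsub>G\<^esub> t \<beta> D) \<otimes>\<^bsub>G\<^esub> ?g"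
    if "\<beta> \<in> L" "D \<in> \<I> \<beta>" for \<beta> D
  proof (rule U.G.join_of_units(3)[OF ec fc _ ef])
    show "s \<beta> D \<otimes>\<^bsub>G\<^esub> t \<beta> D \<in> carrier G" using that by simp
    show "e \<otimes>\<^bsub>G\<^esub> (s \<beta> D \<otimes>\<^bsub>G\<^esub> t \<beta> D) = (s \<beta> D \<otimes>\<^bsub>G\<^esub> t \<beta> D) \<otimes>\<^bsub>G\<^esub> e" by (rule e(2)[OF that])
    show "f \<otimes>\<^bsub>G\<^esub> (s \<beta> D \<otimes>\<^bsub>G\<^esub> t \<beta> D) = (s \<beta> D \<otimes>\<^bsub>G\<^esub> t \<beta> D) \<otimes>\<^bsub>G\<^esub> f"
      unfolding f_def by (rule range_projections_commute[OF ab that])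
  qed
  have gu: "?g \<otimes>\<^bsub>G\<^esub> s \<beta> D = s \<beta> D \<and> t \<beta> D \<otimes>\<^bsub>G\<^esub> ?g = t \<beta> D" if bd: "(\<beta>, D) \<in> insert z Z" for \<beta> D
  proof -
    have c: "s \<beta> D \<in> carrier G" "t \<beta> D \<in> carrier G" using bd insert.prems by (auto intro: closed)
    have "e \<otimes>\<^bsub>G\<^esub> s \<beta> D = s \<beta> D \<or> f \<otimes>\<^bsub>G\<^esub> s \<beta> D = s \<beta> D"
      "t \<beta> D \<otimes>\<^bsub>G\<^esub> e = t \<beta> D \<or> t \<beta> D \<otimes>\<^bsub>G\<^esub> f = t \<beta> D"
      using bd e(3)[of \<beta> D] fs ft by (auto simp: z)
    then show ?thesis
      by (intro conjI U.G.join_of_units(1)[OF ec fc c(1) ef] U.G.join_of_units(2)[OF ec fc c(2) ef])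
  qed
  show ?case
    by (rule bexI[OF _ gK], rule conjI, intro ballI, erule (1) gc, intro allI impI, erule gu)
qed

lemma pos_edges:
  assumes "x \<in> A 1"
  shows "\<exists>Z. finite Z \<and> (Z \<subseteq> Sigma L \<I>) \<and>
    (\<forall>e\<in>carrier G. (\<forall>\<alpha> B. (\<alpha>, B) \<in> Z \<longrightarrow> e \<otimes>\<^bsub>G\<^esub> s \<alpha> B = s \<alpha> B) \<longrightarrow> e \<otimes>\<^bsub>G\<^esub> x = x)"
  using assms zero_less_one[where 'a = int]
proof (induction rule: A_pos_induct)
  case zero
  show ?case by (intro exI[of _ "{}"]) simp
next
  case (prod \<alpha> B y)
  then show ?case using A_closed[OF prod(3)]
    by (intro exI[of _ "{(\<alpha>, B)}"]) (auto simp flip: U.G.m_assoc)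
next
  case (add x y)
  from add(3) obtain Z where Z: "finite Z" "Z \<subseteq> Sigma L \<I>"
    "\<forall>e\<in>carrier G. (\<forall>\<alpha> B. (\<alpha>, B) \<in> Z \<longrightarrow> e \<otimes>\<^bsub>G\<^esub> s \<alpha> B = s \<alpha> B) \<longrightarrow> e \<otimes>\<^bsub>G\<^esub> x = x"
    by (elim exE conjE)
  from add(4) obtain Z' where Z': "finite Z'" "Z' \<subseteq> Sigma L \<I>"
    "\<forall>e\<in>carrier G. (\<forall>\<alpha> B. (\<alpha>, B) \<in> Z' \<longrightarrow> e \<otimes>\<^bsub>G\<^esub> s \<alpha> B = s \<alpha> B) \<longrightarrow> e \<otimes>\<^bsub>G\<^esub> y = y"
    by (elim exE conjE)
  show ?case
  proof (intro exI[of _ "Z \<union> Z'"] conjI ballI impI)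
    fix e assume e: "e \<in> carrier G" "\<forall>\<alpha> B. (\<alpha>, B) \<in> Z \<union> Z' \<longrightarrow> e \<otimes>\<^bsub>G\<^esub> s \<alpha> B = s \<alpha> B"
    then have "e \<otimes>\<^bsub>G\<^esub> x = x" "e \<otimes>\<^bsub>G\<^esub> y = y" using Z(3) Z'(3) by blast+
    then show "e \<otimes>\<^bsub>G\<^esub> (x \<oplus>\<^bsub>G\<^esub> y) = x \<oplus>\<^bsub>G\<^esub> y"
      using e(1) A_closed[OF add(1)] A_closed[OF add(2)] by (simp add: U.G.r_distr)
  qed (use Z Z' in auto)
qed

lemma neg_edges:
  assumes "x \<in> A (- 1)"
  shows "\<exists>Z. finite Z \<and> (Z \<subseteq> Sigma L \<I>) \<and>
    (\<forall>e\<in>carrier G. (\<forall>\<alpha> B. (\<alpha>, B) \<in> Z \<longrightarrow> t \<alpha> B \<otimes>\<^bsub>G\<^esub> e = t \<alpha> B) \<longrightarrow> x \<otimes>\<^bsub>G\<^esub> e = x)"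
  using assms iffD2[OF neg_less_0_iff_less zero_less_one[where 'a = int]]
proof (induction rule: A_neg_induct)
  case zero
  show ?case by (intro exI[of _ "{}"]) simp
next
  case (prod \<alpha> B y)
  then show ?case using A_closed[OF prod(3)]
    by (intro exI[of _ "{(\<alpha>, B)}"]) (auto simp: U.G.m_assoc)
next
  case (add x y)
  from add(3) obtain Z where Z: "finite Z" "Z \<subseteq> Sigma L \<I>"
    "\<forall>e\<in>carrier G. (\<forall>\<alpha> B. (\<alpha>, B) \<in> Z \<longrightarrow> t \<alpha> B \<otimes>\<^bsub>G\<^esub> e = t \<alpha> B) \<longrightarrow> x \<otimes>\<^bsub>G\<^esub> e = x"
    by (elim exE conjE)
  from add(4) obtain Z' where Z': "finite Z'" "Z' \<subseteq> Sigma L \<I>"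
    "\<forall>e\<in>carrier G. (\<forall>\<alpha> B. (\<alpha>, B) \<in> Z' \<longrightarrow> t \<alpha> B \<otimes>\<^bsub>G\<^esub> e = t \<alpha> B) \<longrightarrow> y \<otimes>\<^bsub>G\<^esub> e = y"
    by (elim exE conjE)
  show ?case
  proof (intro exI[of _ "Z \<union> Z'"] conjI ballI impI)
    fix e assume e: "e \<in> carrier G" "\<forall>\<alpha> B. (\<alpha>, B) \<in> Z \<union> Z' \<longrightarrow> t \<alpha> B \<otimes>\<^bsub>G\<^esub> e = t \<alpha> B"
    then have "x \<otimes>\<^bsub>G\<^esub> e = x" "y \<otimes>\<^bsub>G\<^esub> e = y" using Z(3) Z'(3) by blast+
    then show "(x \<oplus>\<^bsub>G\<^esub> y) \<otimes>\<^bsub>G\<^esub> e = x \<oplus>\<^bsub>G\<^esub> y"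
      using e(1) A_closed[OF add(1)] A_closed[OF add(2)] by (simp add: U.G.l_distr)
  qed (use Z Z' in auto)
qed

lemma graded: "semisaturated_graded_rng G A"
proof (intro semisaturated_graded_rng.intro U.G.rng_axioms semisaturated_graded_rng_axioms.intro)
  show "additive_subgroup (A n) G" for n by (rule A_subgroup)
  show "x \<otimes>\<^bsub>G\<^esub> y \<in> A (m + n)" if "x \<in> A m" "y \<in> A n" for x y m n using that by (rule A_mult)
  show "\<exists>N a. finite N \<and> (\<forall>n. a n \<in> A n) \<and> x = (\<Oplus>\<^bsub>G\<^esub>n\<in>N. a n)" if "x \<in> carrier G" for x
    using U.hcomp_decomposition[OF that, of gbds_deg] unfolding A_eq by metis
  show "a m = \<zero>\<^bsub>G\<^esub>" if "finite N" "\<And>n. n \<in> N \<Longrightarrow> a n \<in> A n" "(\<Oplus>\<^bsub>G\<^esub>n\<in>N. a n) = \<zero>\<^bsub>G\<^esub>" "m \<in> N" for N a m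
    using U.hcomp_independent[OF Rel_homog that(1) that(2)[unfolded A_eq] that(3,4)] .
  show "A n \<subseteq> span_prod G (A 1) (A (n - 1))" if n: "n > 0" for n
  proof
    have sub: "additive_subgroup (span_prod G (A 1) (A (n - 1))) G"
      by (rule U.G.span_prod_subgroup) (blast intro: A_closed)+
    show "x \<in> span_prod G (A 1) (A (n - 1))" if "x \<in> A n" for x
      using that n
    proof (induction rule: A_pos_induct)
      case zero
      show ?case by (rule additive_subgroup.zero_closed[OF sub])
    next
      case (prod \<alpha> B y)
      then show ?case using A_gens(2) by (intro U.G.span_prod_mem)
    next
      case (add x y)
      then show ?case by (intro additive_subgroup.a_closed[OF sub])
    qed
  qed
  show "A n \<subseteq> span_prod G (A (n + 1)) (A (- 1))" if n: "n < 0" for n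
  proof
    have sub: "additive_subgroup (span_prod G (A (n + 1)) (A (- 1))) G"
      by (rule U.G.span_prod_subgroup) (blast intro: A_closed)+
    show "x \<in> span_prod G (A (n + 1)) (A (- 1))" if "x \<in> A n" for x
      using that n
    proof (induction rule: A_neg_induct)
      case zero
      show ?case by (rule additive_subgroup.zero_closed[OF sub])
    next
      case (prod \<alpha> B y)
      then show ?case using A_gens(3) by (intro U.G.span_prod_mem)
    next
      case (add x y)
      then show ?case by (intro additive_subgroup.a_closed[OF sub])
    qed
  qed
  show "\<exists>e\<in>KK. (\<forall>q\<in>F. e \<otimes>\<^bsub>G\<^esub> q = q) \<and> (\<forall>p\<in>H. p \<otimes>\<^bsub>G\<^esub> e = p)"
    if FH: "finite F" "F \<subseteq> A 1" "finite H" "H \<subseteq> A (- 1)" for F H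
  proof -
    obtain Z where Z: "\<And>x. x \<in> A 1 \<Longrightarrow> finite (Z x) \<and> (Z x \<subseteq> Sigma L \<I>) \<and>
        (\<forall>e\<in>carrier G. (\<forall>\<alpha> B. (\<alpha>, B) \<in> Z x \<longrightarrow> e \<otimes>\<^bsub>G\<^esub> s \<alpha> B = s \<alpha> B) \<longrightarrow> e \<otimes>\<^bsub>G\<^esub> x = x)"
      using pos_edges by metis
    obtain Z' where Z': "\<And>x. x \<in> A (- 1) \<Longrightarrow> finite (Z' x) \<and> (Z' x \<subseteq> Sigma L \<I>) \<and>
        (\<forall>e\<in>carrier G. (\<forall>\<alpha> B. (\<alpha>, B) \<in> Z' x \<longrightarrow> t \<alpha> B \<otimes>\<^bsub>G\<^esub> e = t \<alpha> B) \<longrightarrow> x \<otimes>\<^bsub>G\<^esub> e = x)"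
      using neg_edges by metis
    let ?Z = "(\<Union>x\<in>F. Z x) \<union> (\<Union>x\<in>H. Z' x)"
    have "finite ?Z" using FH Z Z' by blast
    moreover have "?Z \<subseteq> Sigma L \<I>" using FH Z Z' by blast
    ultimately obtain e where e: "e \<in> KK"
      "\<forall>\<alpha> B. (\<alpha>, B) \<in> ?Z \<longrightarrow> e \<otimes>\<^bsub>G\<^esub> s \<alpha> B = s \<alpha> B \<and> t \<alpha> B \<otimes>\<^bsub>G\<^esub> e = t \<alpha> B"
      using unit_for_edges[of ?Z] by blast
    have ec: "e \<in> carrier G" using e(1) KK_A0 A_closed by blast
    have "e \<otimes>\<^bsub>G\<^esub> q = q" if "q \<in> F" for q
      using Z[of q] e(2) ec FH(2) that by blast
    moreover have "x \<otimes>\<^bsub>G\<^esub> e = x" if "x \<in> H" for x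
      using Z'[of x] e(2) ec FH(4) that by blast
    ultimately show ?thesis using e(1) by blast
  qed
qed

end

theorem theorem5p2:
  fixes R :: "'r::{comm_ring, comm_monoid_mult} itself"
    and L :: "'l set"
    and \<theta> :: "'l \<Rightarrow> 'b::generalized_boolean_algebra \<Rightarrow> 'b"
    and \<I> :: "'l \<Rightarrow> 'b set"
  assumes "generalized_boolean_dynamical_system L \<theta> \<I>"
  shows "\<exists>(S :: ('r, 'b, 'l) gbds_elem set)
           (J :: (('r, 'b, 'l) gbds_elem, ('r, 'b, 'l) gbds_elem) bimodule)
           (I :: (('r, 'b, 'l) gbds_elem, ('r, 'b, 'l) gbds_elem) bimodule) \<psi> K.
           subrng S (gbds_alg R L \<theta> \<I>) \<and>
           (let S' = (gbds_alg R L \<theta> \<I>)\<lparr>carrier := S\<rparr> in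
              ring_system S' J I \<psi> \<and>
              condition_FS S' J I \<psi> \<and>
              greatest_faithful_compatible S' J I \<psi> K \<and>
              graded_isomorphic (gbds_alg R L \<theta> \<I>) (gbds_component R L \<theta> \<I>)
                (cp_ring S' J I \<psi> K) (cp_component S' J I \<psi> K))"
proof -
  interpret gbds_algebra L \<theta> \<I> R
    by (rule gbds_algebra.intro[OF assms])
  interpret M: semisaturated_graded_rng G A by (rule graded)
  have "subrng (A 0) G"
    unfolding subrng_def using A_subgroup A_mult[of _ 0 _ 0] by simp
  then show ?thesis
    unfolding Let_def
    by (intro exI[of _ "A 0"] exI[of _ M.P] exI[of _ M.Q] exI[of _ M.\<psi>] exI[of _ M.K] conjI
      M.sys.ring_system_axioms M.FS M.K_greatest M.graded_isomorphic_cp_ring)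
qed

end
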